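(* Let $G=SL_2(\mathbb{Q})$, let $A\subset L(\mathbb{Q}^2)$ be the von Neumann subalgebra of elements whose Fourier coefficients are invariant under $v\mapsto -v$, and let $q=\frac{u_{id}+u_{-id}}{2}$, a central projection in $A\rtimes G$. If $P$ is any intermediate von Neumann algebra $L(G)\subset P\subset A\rtimes G$, then \[P\in \Big\{L(G),\ A\rtimes G,\ qL(G)\oplus (1-q)(A\rtimes G),\ (1-q)L(G)\oplus q(A\rtimes G)\Big\}.\]
   Context: For a countable discrete group $\Gamma$, $L(\Gamma)$ denotes its group von Neumann algebra, with canonical unitaries $u_g$, $g\in\Gamma$. $G=SL_2(\mathbb{Q})$ acts on $\mathbb{Q}^2$ by matrix multiplication from the left, and $L(\mathbb{Q}^2)$, $L(G)$ are regarded as subalgebras of $L(\mathbb{Q}^2\rtimes G)$. $A$ is the von Neumann subalgebra of $L(\mathbb{Q}^2)$ consisting of all elements $\sum_{x,y}c_{x,y}u_{x,y}$ (Fourier expansion over $(x,y)\in\mathbb{Q}^2$) with $c_{x,y}=c_{-x,-y}$ for all $(x,y)\in\mathbb{Q}^2$. It is invariant under conjugation by $u_g$, $g\in G$, and $A\rtimes G\subset L(\mathbb{Q}^2\rtimes G)$ is the von Neumann subalgebra generated by $A$ and $L(G)$ (the crossed product). $id$ denotes the identity matrix in $G$ and $-id$ its negative. Equivalently, $A\rtimes G\cong L^\infty(Y)\rtimes G$, where $G\curvearrowright Y$ is the quotient of the algebraic action $G\curvearrowright\widehat{\mathbb{Q}^2}$ (Pontryagin dual with Haar measure) by the relation $\phi\sim\phi'$,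 $\phi'(x,y):=\phi(-x,-y)$. *)

theory Defs
  imports
    "HOL-Analysis.Analysis"
    "HOL-Algebra.Group"
    "HOL-Library.Function_Algebras"
    "HOL-Library.Set_Algebras"
begin

section \<open>The Hilbert space of square-summable functions on a set\<close>

text \<open>
  Vectors are functions vanishing outside the index set, and operators are functions on vectors
  vanishing outside the Hilbert space. Hence equality of vectors and of operators is equality of
  functions, composition of operators is \<open>\<circ>\<close>, and sums and differences of operators are the
  pointwise ones of \<^theory>\<open>HOL-Library.Function_Algebras\<close>.
\<close>

definition ell2 :: "'a set \<Rightarrow> ('a \<Rightarrow> complex) set" where
  "ell2 X = {f. (\<forall>x. x \<notin> X \<longrightarrow> f x = 0) \<and> (\<lambda>x. (cmod (f x))\<^sup>2) summable_on X}"

definition ell2_inner :: "'a set \<Rightarrow> ('a \<Rightarrow> complex) \<Rightarrow> ('a \<Rightarrow> complex) \<Rightarrow> complex" where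
  "ell2_inner X f h = (\<Sum>\<^sub>\<infinity>x\<in>X. f x * cnj (h x))"

definition ell2_norm :: "'a set \<Rightarrow> ('a \<Rightarrow> complex) \<Rightarrow> real" where
  "ell2_norm X f = sqrt (\<Sum>\<^sub>\<infinity>x\<in>X. (cmod (f x))\<^sup>2)"

type_synonym 'a operator = "('a \<Rightarrow> complex) \<Rightarrow> ('a \<Rightarrow> complex)"

definition bounded_ops :: "'a set \<Rightarrow> 'a operator set" where
  "bounded_ops X = {T.
     (\<forall>f\<in>ell2 X. T f \<in> ell2 X) \<and>
     (\<forall>f\<in>ell2 X. \<forall>h\<in>ell2 X. T (f + h) = T f + T h) \<and>
     (\<forall>c. \<forall>f\<in>ell2 X. T (\<lambda>x. c * f x) = (\<lambda>x. c * T f x)) \<and>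
     (\<exists>K. \<forall>f\<in>ell2 X. ell2_norm X (T f) \<le> K * ell2_norm X f) \<and>
     (\<forall>f. f \<notin> ell2 X \<longrightarrow> T f = 0)}"

definition id_op :: "'a set \<Rightarrow> 'a operator" where
  "id_op X = (\<lambda>f. if f \<in> ell2 X then f else 0)"

definition adjoint_pair :: "'a set \<Rightarrow> 'a operator \<Rightarrow> 'a operator \<Rightarrow> bool" where
  "adjoint_pair X S T \<longleftrightarrow>
     (\<forall>f\<in>ell2 X. \<forall>h\<in>ell2 X. ell2_inner X (T f) h = ell2_inner X f (S h))"


section \<open>Von Neumann algebras\<close>

definition commutant :: "'a set \<Rightarrow> 'a operator set \<Rightarrow> 'a operator set" where
  "commutant X M = {T \<in> bounded_ops X. \<forall>S\<in>M. S \<circ> T = T \<circ> S}"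

definition von_neumann_algebra :: "'a set \<Rightarrow> 'a operator set \<Rightarrow> bool" where
  "von_neumann_algebra X M \<longleftrightarrow>
     M \<subseteq> bounded_ops X \<and>
     (\<forall>T\<in>M. \<exists>S\<in>M. adjoint_pair X S T) \<and>
     commutant X (commutant X M) = M"

definition generated_vna :: "'a set \<Rightarrow> 'a operator set \<Rightarrow> 'a operator set" where
  "generated_vna X S = \<Inter>{M. von_neumann_algebra X M \<and> S \<subseteq> M}"

definition central_projection :: "'a set \<Rightarrow> 'a operator set \<Rightarrow> 'a operator \<Rightarrow> bool" where
  "central_projection X M p \<longleftrightarrow>
     p \<in> M \<and> p \<circ> p = p \<and> adjoint_pair X p p \<and> (\<forall>T\<in>M. p \<circ> T = T \<circ> p)"

definition corner :: "'a operator \<Rightarrow> 'a operator set \<Rightarrow> 'a operator set" where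
  "corner p M = {p \<circ> T | T. T \<in> M}"


section \<open>Group von Neumann algebras\<close>

definition canonical_unitary :: "('a, 'b) monoid_scheme \<Rightarrow> 'a \<Rightarrow> 'a operator" where
  "canonical_unitary \<Gamma> g = (\<lambda>f. if f \<in> ell2 (carrier \<Gamma>)
     then (\<lambda>x. if x \<in> carrier \<Gamma> then f (inv\<^bsub>\<Gamma>\<^esub> g \<otimes>\<^bsub>\<Gamma>\<^esub> x) else 0) else 0)"

text \<open>
  For a subgroup \<open>H\<close> of \<open>\<Gamma>\<close> this is the copy of \<open>L(H)\<close> inside \<open>L(\<Gamma>)\<close>, acting on the Hilbert
  space of \<open>\<Gamma>\<close>.
\<close>

definition group_vna :: "('a, 'b) monoid_scheme \<Rightarrow> 'a set \<Rightarrow> 'a operator set" where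
  "group_vna \<Gamma> H = generated_vna (carrier \<Gamma>) (canonical_unitary \<Gamma> ` H)"

text \<open>
  The coefficient \<open>c g\<close> in the Fourier expansion \<open>T = (\<Sum>g. c g u g)\<close>: apply both sides to the
  basis vector at the unit and evaluate at \<open>g\<close>.
\<close>

definition fourier_coeff :: "('a, 'b) monoid_scheme \<Rightarrow> 'a operator \<Rightarrow> 'a \<Rightarrow> complex" where
  "fourier_coeff \<Gamma> T g = T (\<lambda>x. if x = \<one>\<^bsub>\<Gamma>\<^esub> then 1 else 0) g"


section \<open>The semidirect product of the rational plane with the special linear group\<close>

type_synonym q2sl2 = "(rat^2) \<times> (rat^2^2)"

definition SL2Q :: "(rat^2^2) set" where
  "SL2Q = {g. det g = 1}"

definition Q2_SL2Q :: "q2sl2 monoid" where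
  "Q2_SL2Q = \<lparr>carrier = UNIV \<times> SL2Q,
     mult = (\<lambda>(v, g) (w, h). (v + g *v w, g ** h)),
     one = (0, mat 1)\<rparr>"

lemma group_Q2_SL2Q: "group Q2_SL2Q"
proof (rule groupI)
  fix x assume "x \<in> carrier Q2_SL2Q"
  then obtain v g where x: "x = (v, g)" and g: "det g = 1"
    by (auto simp: Q2_SL2Q_def SL2Q_def)
  then obtain h where h: "g ** h = mat 1" "h ** g = mat 1"
    using invertible_det_nz[of g] by (auto simp: invertible_def)
  have "det h = 1"
    using arg_cong[OF h(2), of det] g by (simp add: det_mul)
  with h x show "\<exists>y\<in>carrier Q2_SL2Q. y \<otimes>\<^bsub>Q2_SL2Q\<^esub> x = \<one>\<^bsub>Q2_SL2Q\<^esub>"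
    by (intro bexI[of _ "(- (h *v v), h)"]) (auto simp: Q2_SL2Q_def SL2Q_def)
qed (auto simp: Q2_SL2Q_def SL2Q_def det_mul matrix_mul_assoc matrix_vector_mul_assoc
       matrix_vector_right_distrib add.assoc)

abbreviation \<Lambda> :: "q2sl2 set" where
  "\<Lambda> \<equiv> carrier Q2_SL2Q"

definition u :: "rat^2 \<Rightarrow> rat^2^2 \<Rightarrow> q2sl2 operator" where
  "u v g = canonical_unitary Q2_SL2Q (v, g)"

definition L_Q2 :: "q2sl2 operator set" where
  "L_Q2 = group_vna Q2_SL2Q {(v, mat 1) | v. True}"

definition L_SL2Q :: "q2sl2 operator set" where
  "L_SL2Q = group_vna Q2_SL2Q {(0, g) | g. g \<in> SL2Q}"

definition A_even :: "q2sl2 operator set" where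
  "A_even = {T \<in> L_Q2. \<forall>v. fourier_coeff Q2_SL2Q T (v, mat 1)
                          = fourier_coeff Q2_SL2Q T (- v, mat 1)}"

definition A_crossed_SL2Q :: "q2sl2 operator set" where
  "A_crossed_SL2Q = generated_vna \<Lambda> (A_even \<union> L_SL2Q)"

definition q :: "q2sl2 operator" where
  "q = (\<lambda>f x. (u 0 (mat 1) f x + u 0 (- mat 1) f x) / 2)"

end

theory Submission
  imports Defs
begin

text \<open>
  Let \<open>P\<close> be intermediate, \<open>E\<close> the orthogonal projection onto the closure of \<open>P \<delta>\<close>, and \<open>\<eta> = \<plusminus>1\<close> the
  value of \<open>u\<^bsub>-id\<^esub>\<close> on one of the two corners cut out by \<open>q\<close> and \<open>1 - q\<close>. In that corner consider
  \<open>\<zeta>\<^sub>v = E \<delta>\<^sub>v\<close> for \<open>v \<noteq> 0\<close> in the plane. It is invariant under conjugation by the stabilizer of \<open>v\<close>,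
  a unipotent group all of whose nontrivial orbits are infinite; hence \<open>\<zeta>\<^sub>v\<close> for \<open>v = (1, 0)\<close> is
  supported on the points \<open>((s, 0), \<plusminus>n(x))\<close> with \<open>n(x)\<close> upper unipotent, and is given there by a
  function \<open>\<phi>(s, x)\<close> that is even in \<open>s\<close>. Comparing coefficients in \<open>E(\<zeta>\<^sub>v * \<delta>\<^sub>w) = \<zeta>\<^sub>v * \<zeta>\<^sub>w\<close> for \<open>v = (1, 0)\<close>
  and \<open>w = (0, 1)\<close> gives \<open>\<phi>(s, x) \<phi>(r, -y) = 0\<close> whenever \<open>y \<noteq> 0\<close> and \<open>s y \<noteq> 2 r\<close>, so by evenness \<open>\<phi>\<close> vanishes
  for \<open>x \<noteq> 0\<close>, and then \<open>\<phi>(s) \<phi>(r) = \<phi>(s / r) \<phi>(r)\<close>, which together with summability forces \<open>\<phi>(r) = 0\<close>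
  for \<open>r \<noteq> \<plusminus>1\<close>. Thus \<open>\<zeta>\<^sub>v\<close> is a multiple of the corner of \<open>\<delta>\<^sub>v + \<delta>\<^sub>-\<^sub>v\<close>, and since \<open>E\<close> is a projection
  only two multiples are possible: in each corner \<open>P\<close> is either as small or as large as it can be.
\<close>

section \<open>Square-summable functions\<close>

text \<open>No conditional expectation is formed on operators. An element T of the left algebra is
  determined by its vector \<open>T (ket \<one>)\<close>, and the closure of the vectors of P
  determines P, because P is its own double commutant; hence it suffices to know the reproducing
  kernel of that closure. The kernel is invariant under both multiplications by SL2(Q), which is
  transitive on nonzero vectors, so one base point decides. The element -id shapes the result: it is
  central in SL2(Q) and acts by -1 on the plane, so its unitary commutes with the whole crossed
  product, and P can behave independently on its two eigenspaces. Evenness in s expresses this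
  commutation. The points (1, 0) and (0, 1) have opposite unipotent stabilizers: a product of an
  upper and a lower unipotent factors uniquely up to inserting -id, so the convolution has only two
  terms. In the projected sum the relevant matrix has upper left entry \<plusminus>(1 - s y / r),
  which must be \<plusminus>1; this is the origin of s y \<noteq> 2 r. The vector \<delta>_v has
  four translates under -id on the left and on the right, so the multiple t of their signed sum
  satisfies t = 4 t^2: it is 0 or 1/4.\<close>

lemma ell2_outside: "f \<in> ell2 X \<Longrightarrow> x \<notin> X \<Longrightarrow> f x = 0"
  by (simp add: ell2_def)

lemma ell2_summable: "f \<in> ell2 X \<Longrightarrow> (\<lambda>x. (cmod (f x))\<^sup>2) summable_on X"
  by (simp add: ell2_def)

lemma ell2_zero [simp]: "0 \<in> ell2 X"
  by (simp add: ell2_def)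

lemma ell2_scale: "f \<in> ell2 X \<Longrightarrow> (\<lambda>x. c * f x) \<in> ell2 X"
  by (auto simp: ell2_def norm_mult power_mult_distrib intro!: summable_on_cmult_right)

lemma cmod_add_sq_le: "(cmod (a + b))\<^sup>2 \<le> 2 * (cmod a)\<^sup>2 + 2 * (cmod b)\<^sup>2"
proof -
  have "(cmod (a + b))\<^sup>2 \<le> (cmod a + cmod b)\<^sup>2"
    by (intro power_mono norm_triangle_ineq) auto
  also have "\<dots> \<le> 2 * (cmod a)\<^sup>2 + 2 * (cmod b)\<^sup>2"
    using sum_squares_bound[of "cmod a" "cmod b"] by (simp add: power2_sum)
  finally show ?thesis .
qed

lemma ell2_add:
  assumes "f \<in> ell2 X" "h \<in> ell2 X"
  shows "f + h \<in> ell2 X"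
proof -
  have "(\<lambda>x. 2 * (cmod (f x))\<^sup>2 + 2 * (cmod (h x))\<^sup>2) summable_on X"
    using assms by (intro summable_on_add summable_on_cmult_right ell2_summable)
  then have "(\<lambda>x. (cmod (f x + h x))\<^sup>2) summable_on X"
    by (rule summable_on_comparison_test) (auto intro: cmod_add_sq_le)
  then show ?thesis
    using assms by (auto simp: ell2_def)
qed

lemma ell2_diff:
  assumes "f \<in> ell2 X" "h \<in> ell2 X"
  shows "f - h \<in> ell2 X"
proof -
  have "f - h = f + (\<lambda>x. - 1 * h x)" by (auto simp: fun_eq_iff)
  then show ?thesis using assms ell2_add ell2_scale by metis
qed

lemma ell2_comp_inj:
  assumes f: "f \<in> ell2 X" and \<sigma>: "bij_betw \<sigma> X X" and h: "\<And>x. x \<in> X \<Longrightarrow> h x = f (\<sigma> x)"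
    and out: "\<And>x. x \<notin> X \<Longrightarrow> h x = 0"
  shows "h \<in> ell2 X"
proof -
  have "(\<lambda>x. (cmod (f (\<sigma> x)))\<^sup>2) summable_on X"
    using summable_on_reindex_bij_betw[OF \<sigma>, of "\<lambda>x. (cmod (f x))\<^sup>2"] ell2_summable[OF f] by simp
  then have "(\<lambda>x. (cmod (h x))\<^sup>2) summable_on X"
    by (subst summable_on_cong[where g = "\<lambda>x. (cmod (f (\<sigma> x)))\<^sup>2"]) (auto simp: h)
  then show ?thesis by (auto simp: ell2_def out)
qed

lemma ell2_norm_nonneg [simp]: "0 \<le> ell2_norm X f"
  by (simp add: ell2_norm_def infsum_nonneg)

lemma ell2_norm_sq: "(ell2_norm X f)\<^sup>2 = (\<Sum>\<^sub>\<infinity>x\<in>X. (cmod (f x))\<^sup>2)"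
  by (simp add: ell2_norm_def infsum_nonneg)

lemma ell2_finite_sum_le:
  assumes "f \<in> ell2 X" "finite F" "F \<subseteq> X"
  shows "(\<Sum>x\<in>F. (cmod (f x))\<^sup>2) \<le> (ell2_norm X f)\<^sup>2"
  unfolding ell2_norm_sq
  by (rule finite_sum_le_infsum) (use assms in \<open>auto simp: ell2_summable\<close>)

lemma cmod_le_ell2_norm:
  assumes "f \<in> ell2 X"
  shows "cmod (f x) \<le> ell2_norm X f"
proof (cases "x \<in> X")
  case True
  then have "(cmod (f x))\<^sup>2 \<le> (ell2_norm X f)\<^sup>2"
    using ell2_finite_sum_le[OF assms, of "{x}"] by simp
  then show ?thesis using power2_le_imp_le ell2_norm_nonneg by blast
next
  case False
  then show ?thesis using ell2_outside[OF assms] by simp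
qed

lemma ell2_norm_le:
  assumes "f \<in> ell2 X" "0 \<le> B"
    and "\<And>F. finite F \<Longrightarrow> F \<subseteq> X \<Longrightarrow> (\<Sum>x\<in>F. (cmod (f x))\<^sup>2) \<le> B\<^sup>2"
  shows "ell2_norm X f \<le> B"
proof -
  have "(ell2_norm X f)\<^sup>2 \<le> B\<^sup>2"
    unfolding ell2_norm_sq
    by (rule infsum_le_finite_sums) (use assms in \<open>auto simp: ell2_summable\<close>)
  then show ?thesis using power2_le_imp_le assms(2) by blast
qed

lemma ell2I_bounded:
  assumes "\<And>x. x \<notin> X \<Longrightarrow> f x = 0"
    and "\<And>F. finite F \<Longrightarrow> F \<subseteq> X \<Longrightarrow> (\<Sum>x\<in>F. (cmod (f x))\<^sup>2) \<le> B"
  shows "f \<in> ell2 X"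
proof -
  have "(\<lambda>x. (cmod (f x))\<^sup>2) summable_on X"
    by (rule nonneg_bounded_partial_sums_imp_summable_on[where C = B])
       (use assms(2) in \<open>auto simp: eventually_finite_subsets_at_top\<close>)
  then show ?thesis using assms(1) by (simp add: ell2_def)
qed

lemma ell2_abs_prod:
  assumes "f \<in> ell2 X" "h \<in> ell2 X"
  shows "(\<lambda>x. cmod (f x) * cmod (h x)) summable_on X"
proof -
  have "(\<lambda>x. (cmod (f x))\<^sup>2 + (cmod (h x))\<^sup>2) summable_on X"
    using assms by (intro summable_on_add ell2_summable)
  then show ?thesis
  proof (rule summable_on_comparison_test)
    show "cmod (f x) * cmod (h x) \<le> (cmod (f x))\<^sup>2 + (cmod (h x))\<^sup>2" for x
      using sum_squares_bound[of "cmod (f x)" "cmod (h x)"]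
        mult_nonneg_nonneg[OF norm_ge_zero norm_ge_zero, of "f x" "h x"] by linarith
  qed auto
qed

lemma ell2_prod_summable:
  assumes "f \<in> ell2 X" "h \<in> ell2 X"
  shows "(\<lambda>x. f x * cnj (h x)) summable_on X"
  by (rule abs_summable_summable) (use ell2_abs_prod[OF assms] in \<open>simp add: norm_mult\<close>)

lemma ell2_cauchy_schwarz:
  assumes "f \<in> ell2 X" "h \<in> ell2 X"
  shows "cmod (ell2_inner X f h) \<le> ell2_norm X f * ell2_norm X h"
proof -
  have "cmod (ell2_inner X f h) \<le> (\<Sum>\<^sub>\<infinity>x\<in>X. cmod (f x) * cmod (h x))"
    unfolding ell2_inner_def
    using norm_infsum_bound[of "\<lambda>x. f x * cnj (h x)" X] ell2_abs_prod[OF assms]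
    by (simp add: norm_mult)
  also have "\<dots> \<le> ell2_norm X f * ell2_norm X h"
  proof (rule infsum_le_finite_sums)
    fix F assume F: "finite F" "F \<subseteq> X"
    have "(\<Sum>x\<in>F. cmod (f x) * cmod (h x)) \<le> L2_set (\<lambda>x. cmod (f x)) F * L2_set (\<lambda>x. cmod (h x)) F"
      using L2_set_mult_ineq[of "\<lambda>x. cmod (f x)" "\<lambda>x. cmod (h x)" F] by simp
    also have "\<dots> \<le> ell2_norm X f * ell2_norm X h"
      by (intro mult_mono)
         (auto simp: L2_set_def sum_nonneg intro!: real_le_lsqrt ell2_finite_sum_le assms F)
    finally show "(\<Sum>x\<in>F. cmod (f x) * cmod (h x)) \<le> ell2_norm X f * ell2_norm X h" .
  qed (rule ell2_abs_prod[OF assms])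
  finally show ?thesis .
qed

lemma ell2_inner_add_left:
  assumes "f \<in> ell2 X" "g \<in> ell2 X" "h \<in> ell2 X"
  shows "ell2_inner X (f + g) h = ell2_inner X f h + ell2_inner X g h"
  unfolding ell2_inner_def
  using infsum_add[OF ell2_prod_summable[OF assms(1,3)] ell2_prod_summable[OF assms(2,3)]]
  by (simp add: distrib_right)

lemma ell2_inner_scale_left: "ell2_inner X (\<lambda>x. c * f x) h = c * ell2_inner X f h"
  unfolding ell2_inner_def by (simp add: mult.assoc infsum_cmult_right')

lemma ell2_inner_cnj: "cnj (ell2_inner X f h) = ell2_inner X h f"
  unfolding ell2_inner_def by (subst infsum_cnj [symmetric]) (simp add: mult.commute)

lemma ell2_inner_zero_left [simp]: "ell2_inner X 0 h = 0"
  by (simp add: ell2_inner_def)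

lemma ell2_inner_diff_left:
  assumes "f \<in> ell2 X" "g \<in> ell2 X" "h \<in> ell2 X"
  shows "ell2_inner X (f - g) h = ell2_inner X f h - ell2_inner X g h"
proof -
  have eq: "f - g = f + (\<lambda>x. - 1 * g x)" by (auto simp: fun_eq_iff)
  show ?thesis
    unfolding eq ell2_inner_add_left[OF assms(1) ell2_scale[OF assms(2)] assms(3)]
      ell2_inner_scale_left by simp
qed

lemma ell2_inner_add_right:
  assumes "f \<in> ell2 X" "g \<in> ell2 X" "h \<in> ell2 X"
  shows "ell2_inner X h (f + g) = ell2_inner X h f + ell2_inner X h g"
  by (metis assms complex_cnj_add ell2_inner_add_left ell2_inner_cnj)

lemma ell2_inner_diff_right:
  assumes "f \<in> ell2 X" "g \<in> ell2 X" "h \<in> ell2 X"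
  shows "ell2_inner X h (f - g) = ell2_inner X h f - ell2_inner X h g"
  by (metis assms complex_cnj_diff ell2_inner_diff_left ell2_inner_cnj)

lemma ell2_inner_scale_right: "ell2_inner X f (\<lambda>x. c * h x) = cnj c * ell2_inner X f h"
  by (metis complex_cnj_mult ell2_inner_scale_left ell2_inner_cnj)

lemma ell2_inner_self:
  assumes "f \<in> ell2 X"
  shows "ell2_inner X f f = of_real ((ell2_norm X f)\<^sup>2)"
proof -
  have "((\<lambda>x. of_real ((cmod (f x))\<^sup>2) :: complex) has_sum of_real ((ell2_norm X f)\<^sup>2)) X"
    unfolding has_sum_of_real_iff ell2_norm_sq
    by (rule has_sum_infsum[OF ell2_summable[OF assms]])
  then show ?thesis
    unfolding ell2_inner_def by (intro infsumI) (simp only: complex_norm_square)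
qed

lemma ell2_norm_add_sq:
  assumes "f \<in> ell2 X" "h \<in> ell2 X"
  shows "(ell2_norm X (f + h))\<^sup>2
    = (ell2_norm X f)\<^sup>2 + 2 * Re (ell2_inner X f h) + (ell2_norm X h)\<^sup>2"
proof -
  have "complex_of_real ((ell2_norm X (f + h))\<^sup>2)
      = ell2_inner X f f + (ell2_inner X f h + ell2_inner X h f) + ell2_inner X h h"
    unfolding ell2_inner_self [OF ell2_add[OF assms], symmetric]
    using assms by (simp add: ell2_inner_add_left ell2_inner_add_right ell2_add)
  also have "ell2_inner X f h + ell2_inner X h f = of_real (2 * Re (ell2_inner X f h))"
    by (subst ell2_inner_cnj [of X f h, symmetric]) (rule complex_add_cnj)
  also have "ell2_inner X f f + of_real (2 * Re (ell2_inner X f h)) + ell2_inner X h h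
      = of_real ((ell2_norm X f)\<^sup>2 + 2 * Re (ell2_inner X f h) + (ell2_norm X h)\<^sup>2)"
    unfolding ell2_inner_self[OF assms(1)] ell2_inner_self[OF assms(2)] by simp
  finally show ?thesis using of_real_eq_iff by blast
qed

lemma ell2_norm_scale: "ell2_norm X (\<lambda>x. c * f x) = cmod c * ell2_norm X f"
  by (simp add: ell2_norm_def norm_mult power_mult_distrib infsum_cmult_right' real_sqrt_mult)

lemma ell2_norm_triangle:
  assumes "f \<in> ell2 X" "h \<in> ell2 X"
  shows "ell2_norm X (f + h) \<le> ell2_norm X f + ell2_norm X h"
proof -
  have "Re (ell2_inner X f h) \<le> ell2_norm X f * ell2_norm X h"
    using ell2_cauchy_schwarz[OF assms] complex_Re_le_cmod order_trans by blast
  then have "(ell2_norm X (f + h))\<^sup>2 \<le> (ell2_norm X f + ell2_norm X h)\<^sup>2"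
    by (simp add: ell2_norm_add_sq[OF assms] power2_sum)
  then show ?thesis by (rule power2_le_imp_le) simp
qed

lemma ell2_norm_uminus: "ell2_norm X (f - h) = ell2_norm X (h - f)"
  by (simp add: ell2_norm_def norm_minus_commute)

lemma ell2_norm_diff_triangle:
  assumes "f \<in> ell2 X" "g \<in> ell2 X" "h \<in> ell2 X"
  shows "ell2_norm X (f - h) \<le> ell2_norm X (f - g) + ell2_norm X (g - h)"
  using ell2_norm_triangle[of "f - g" X "g - h"] assms by (simp add: ell2_diff)

text \<open>Coordinates converge because each is bounded by the norm. A bound on the finite partial
  sums of \<open>f m - f n\<close> survives the limit in n, which puts the pointwise limit in the
  space and gives convergence in norm.\<close>

lemma ell2_complete:
  fixes f :: "nat \<Rightarrow> 'a \<Rightarrow> complex"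
  assumes f: "\<And>n. f n \<in> ell2 X"
    and cauchy: "\<And>e. e > 0 \<Longrightarrow> \<exists>N. \<forall>m\<ge>N. \<forall>n\<ge>N. ell2_norm X (f m - f n) < e"
  shows "\<exists>g\<in>ell2 X. \<forall>e>0. \<exists>N. \<forall>n\<ge>N. ell2_norm X (f n - g) \<le> e"
proof -
  have "Cauchy (\<lambda>n. f n x)" for x
  proof (rule metric_CauchyI)
    fix e :: real assume "e > 0"
    then obtain N where N: "\<And>m n. m \<ge> N \<Longrightarrow> n \<ge> N \<Longrightarrow> ell2_norm X (f m - f n) < e"
      using cauchy by blast
    show "\<exists>M. \<forall>m\<ge>M. \<forall>n\<ge>M. dist (f m x) (f n x) < e"
    proof (intro exI[of _ N] allI impI)
      fix m n assume "N \<le> m" "N \<le> n"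
      then show "dist (f m x) (f n x) < e"
        using N[of m n] cmod_le_ell2_norm[OF ell2_diff[OF f f], of m n x] by (simp add: dist_norm)
    qed
  qed
  then have "\<exists>l. (\<lambda>n. f n x) \<longlonglongrightarrow> l" for x
    using Cauchy_convergent convergent_def by blast
  then obtain g where g: "\<And>x. (\<lambda>n. f n x) \<longlonglongrightarrow> g x" by metis
  have g_out: "g x = 0" if "x \<notin> X" for x
    using g[of x] ell2_outside[OF f that] LIMSEQ_unique[OF _ tendsto_const] by fastforce
  have key: "(\<Sum>x\<in>F. (cmod ((f m - g) x))\<^sup>2) \<le> e\<^sup>2"
    if N: "\<And>m n. m \<ge> N \<Longrightarrow> n \<ge> N \<Longrightarrow> ell2_norm X (f m - f n) < e" and m: "m \<ge> N"
      and F: "finite F" "F \<subseteq> X" for N m e F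
  proof (rule LIMSEQ_le_const2)
    show "(\<lambda>n. \<Sum>x\<in>F. (cmod ((f m - f n) x))\<^sup>2) \<longlonglongrightarrow> (\<Sum>x\<in>F. (cmod ((f m - g) x))\<^sup>2)"
      by (auto intro!: tendsto_intros g)
    show "\<exists>M. \<forall>n\<ge>M. (\<Sum>x\<in>F. (cmod ((f m - f n) x))\<^sup>2) \<le> e\<^sup>2"
    proof (intro exI allI impI)
      fix n assume n: "N \<le> n"
      have "(\<Sum>x\<in>F. (cmod ((f m - f n) x))\<^sup>2) \<le> (ell2_norm X (f m - f n))\<^sup>2"
        by (rule ell2_finite_sum_le[OF ell2_diff[OF f f] F])
      also have "\<dots> \<le> e\<^sup>2"
        using N[OF m n] by (intro power_mono) auto
      finally show "(\<Sum>x\<in>F. (cmod ((f m - f n) x))\<^sup>2) \<le> e\<^sup>2" .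
    qed
  qed
  have diff: "\<exists>N. f N - g \<in> ell2 X"
  proof -
    obtain N where N: "\<And>m n. m \<ge> N \<Longrightarrow> n \<ge> N \<Longrightarrow> ell2_norm X (f m - f n) < 1"
      using cauchy[of 1] by auto
    have "f N - g \<in> ell2 X"
      by (rule ell2I_bounded[where B = "1\<^sup>2"])
         (use key[OF N] ell2_outside[OF f] g_out in auto)
    then show ?thesis by blast
  qed
  then obtain N0 where "f N0 - g \<in> ell2 X" by blast
  then have gX: "g \<in> ell2 X"
    using ell2_diff[OF f[of N0], of "f N0 - g"] by simp
  show ?thesis
  proof (intro bexI[OF _ gX] allI impI)
    fix e :: real assume e: "e > 0"
    then obtain N where N: "\<And>m n. m \<ge> N \<Longrightarrow> n \<ge> N \<Longrightarrow> ell2_norm X (f m - f n) < e"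
      using cauchy by blast
    show "\<exists>N. \<forall>n\<ge>N. ell2_norm X (f n - g) \<le> e"
      by (intro exI[of _ N] allI impI ell2_norm_le ell2_diff f gX key[OF N]) (use e in auto)
  qed
qed

section \<open>Closed subspaces and orthogonal projection\<close>

definition closed_subspace :: "'a set \<Rightarrow> ('a \<Rightarrow> complex) set \<Rightarrow> bool" where
  "closed_subspace X H \<longleftrightarrow> H \<subseteq> ell2 X \<and> 0 \<in> H \<and> (\<forall>f\<in>H. \<forall>h\<in>H. f + h \<in> H) \<and>
     (\<forall>c. \<forall>f\<in>H. (\<lambda>x. c * f x) \<in> H) \<and>
     (\<forall>f\<in>ell2 X. (\<forall>e>0. \<exists>h\<in>H. ell2_norm X (f - h) < e) \<longrightarrow> f \<in> H)"

lemma closed_subspaceD: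
  assumes "closed_subspace X H"
  shows "H \<subseteq> ell2 X" "0 \<in> H" "f \<in> H \<Longrightarrow> h \<in> H \<Longrightarrow> f + h \<in> H" "f \<in> H \<Longrightarrow> (\<lambda>x. c * f x) \<in> H"
    "f \<in> ell2 X \<Longrightarrow> (\<And>e. e > 0 \<Longrightarrow> \<exists>h\<in>H. ell2_norm X (f - h) < e) \<Longrightarrow> f \<in> H"
  using assms unfolding closed_subspace_def by blast+

text \<open>A minimizing sequence is Cauchy by the parallelogram law, its limit attains the
  distance, and varying the limit along k gives orthogonality.\<close>

lemma ell2_projection:
  assumes H: "closed_subspace X H" and f: "f \<in> ell2 X"
  shows "\<exists>p\<in>H. \<forall>k\<in>H. ell2_inner X k (f - p) = 0"
proof -
  note HD = closed_subspaceD[OF H]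
  have HX: "h \<in> ell2 X" if "h \<in> H" for h using HD(1) that by blast
  define d where "d = Inf ((\<lambda>h. (ell2_norm X (f - h))\<^sup>2) ` H)"
  have bdd: "bdd_below ((\<lambda>h. (ell2_norm X (f - h))\<^sup>2) ` H)"
    by (intro bdd_belowI[of _ 0]) auto
  have d_le: "d \<le> (ell2_norm X (f - h))\<^sup>2" if "h \<in> H" for h
    unfolding d_def using that bdd by (auto intro: cInf_lower)
  have "\<exists>h\<in>H. (ell2_norm X (f - h))\<^sup>2 < d + 1 / (real n + 1)" for n
  proof -
    have "d < d + 1 / (real n + 1)" by simp
    then show ?thesis
      unfolding d_def using cInf_lessD[of "(\<lambda>h. (ell2_norm X (f - h))\<^sup>2) ` H"] HD(2) by blast
  qed
  then obtain h where hH: "\<And>n. h n \<in> H"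
    and h: "\<And>n. (ell2_norm X (f - h n))\<^sup>2 < d + 1 / (real n + 1)" by metis
  have par: "(ell2_norm X (h m - h n))\<^sup>2
      \<le> 2 * (ell2_norm X (f - h m))\<^sup>2 + 2 * (ell2_norm X (f - h n))\<^sup>2 - 4 * d" for m n
  proof -
    let ?a = "f - h m" and ?b = "f - h n"
    have ab: "?a \<in> ell2 X" "?b \<in> ell2 X" "(\<lambda>x. - 1 * ?b x) \<in> ell2 X"
      using f hH HX ell2_diff ell2_scale by blast+
    \<comment> \<open>Parallelogram law: \<open>?a + ?b\<close> is twice the difference of f and
      this midpoint, which lies in H, so its squared norm is at least 4 d.\<close>
    have mid: "(\<lambda>x. 1/2 * (h m + h n) x) \<in> H" using HD(3,4) hH by blast
    have e1: "?a + ?b = (\<lambda>x. 2 * (f - (\<lambda>x. 1/2 * (h m + h n) x)) x)"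
      by (auto simp: fun_eq_iff algebra_simps)
    have e2: "h m - h n = - (?a + (\<lambda>x. - 1 * ?b x))"
      by (auto simp: fun_eq_iff)
    have "(ell2_norm X (?a + ?b))\<^sup>2 = 4 * (ell2_norm X (f - (\<lambda>x. 1/2 * (h m + h n) x)))\<^sup>2"
      by (subst e1, subst ell2_norm_scale) (simp add: power_mult_distrib)
    then have 1: "(ell2_norm X (?a + ?b))\<^sup>2 \<ge> 4 * d"
      using d_le[OF mid] by simp
    have "ell2_norm X (h m - h n) = ell2_norm X (?a + (\<lambda>x. - 1 * ?b x))"
      unfolding e2 by (simp add: ell2_norm_def norm_minus_commute)
    then have 2: "(ell2_norm X (h m - h n))\<^sup>2
      = (ell2_norm X ?a)\<^sup>2 - 2 * Re (ell2_inner X ?a ?b) + (ell2_norm X ?b)\<^sup>2"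
      using ell2_norm_add_sq[OF ab(1,3)] ell2_inner_scale_right[of X ?a "-1" ?b]
        ell2_norm_scale[of X "-1" ?b] by simp
    show ?thesis using 1 2 ell2_norm_add_sq[OF ab(1,2)] by simp
  qed
  have cauchy: "\<exists>N. \<forall>m\<ge>N. \<forall>n\<ge>N. ell2_norm X (h m - h n) < e" if "e > 0" for e
  proof -
    \<comment> \<open>By \<open>par\<close> and the choice of h, the squared distance is at most 2 /
      (m + 1) + 2 / (n + 1), hence at most 4 / (N + 1).\<close>
    obtain N where N: "real N > 4 / e\<^sup>2" using reals_Archimedean2 by blast
    show ?thesis
    proof (intro exI allI impI)
      fix m n assume mn: "N \<le> m" "N \<le> n"
      have "4 / (real N + 1) < e\<^sup>2"
        using N that by (auto simp: field_simps) (smt (verit) zero_less_power)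
      moreover have "1 / (real m + 1) \<le> 1 / (real N + 1)" "1 / (real n + 1) \<le> 1 / (real N + 1)"
        using mn by (auto simp: frac_le)
      ultimately have "(ell2_norm X (h m - h n))\<^sup>2 < e\<^sup>2"
        using par[of m n] h[of m] h[of n] by simp
      then show "ell2_norm X (h m - h n) < e"
        using that power_less_imp_less_base by (metis less_eq_real_def)
    qed
  qed
  obtain p where p: "p \<in> ell2 X" and lim: "\<And>e. e > 0 \<Longrightarrow> \<exists>N. \<forall>n\<ge>N. ell2_norm X (h n - p) \<le> e"
    using ell2_complete[of h X] HX[OF hH] cauchy by metis
  have pH: "p \<in> H"
  proof (rule HD(5)[OF p])
    fix e :: real assume "e > 0"
    then obtain N where "ell2_norm X (h N - p) \<le> e / 2" using lim[of "e/2"] by auto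
    then show "\<exists>h\<in>H. ell2_norm X (p - h) < e"
      using hH[of N] \<open>e > 0\<close> by (intro bexI[of _ "h N"]) (auto simp: ell2_norm_uminus[of X p])
  qed
  have pd: "ell2_norm X (f - p) \<le> sqrt d"
  proof (rule field_le_epsilon)
    fix e :: real assume e: "e > 0"
    obtain N where N: "\<And>n. n \<ge> N \<Longrightarrow> ell2_norm X (h n - p) \<le> e / 2" using lim[of "e/2"] e by auto
    have d0: "d \<ge> 0" unfolding d_def using HD(2) by (intro cInf_greatest) auto
    obtain M where M: "real M > 4 / e\<^sup>2" using reals_Archimedean2 by blast
    let ?n = "max M N"
    have "1 / (real ?n + 1) < (e/2)\<^sup>2"
    proof -
      have "real ?n + 1 > 4 / e\<^sup>2" using M by linarith
      then show ?thesis using e by (auto simp: field_simps power2_eq_square)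
    qed
    then have "(ell2_norm X (f - h ?n))\<^sup>2 \<le> d + (e/2)\<^sup>2" using h[of ?n] by linarith
    also have "\<dots> \<le> (sqrt d + e/2)\<^sup>2"
      using d0 e by (simp add: power2_sum)
    finally have "ell2_norm X (f - h ?n) \<le> sqrt d + e/2"
      using power2_le_imp_le d0 e by (metis add_nonneg_nonneg half_gt_zero less_eq_real_def real_sqrt_ge_zero)
    then show "ell2_norm X (f - p) \<le> sqrt d + e"
      using ell2_norm_diff_triangle[OF f HX[OF hH] p, of ?n] N[of ?n] by simp
  qed
  have "ell2_inner X k (f - p) = 0" if k: "k \<in> H" for k
  proof (rule ccontr)
    define g where "g = f - p"
    define c where "c = ell2_inner X g k"
    assume "ell2_inner X k (f - p) \<noteq> 0"
    then have c0: "c \<noteq> 0" using ell2_inner_cnj[of X k g] by (auto simp: g_def c_def)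
    have g: "g \<in> ell2 X" unfolding g_def using f p ell2_diff by blast
    have kn: "ell2_norm X k > 0"
      using ell2_cauchy_schwarz[OF g HX[OF k]] c0[unfolded c_def] ell2_norm_nonneg[of X k]
      by (metis less_eq_real_def mult_zero_right norm_le_zero_iff)
    \<comment> \<open>The t that minimizes the norm of g + t k. It lowers the squared norm by a
      positive amount, against the minimality of d.\<close>
    define t where "t = - c / of_real ((ell2_norm X k)\<^sup>2)"
    have tk: "(\<lambda>x. t * k x) \<in> ell2 X" using HX k ell2_scale by blast
    have "p + (\<lambda>x. - t * k x) \<in> H" using HD(3,4) pH k by blast
    then have "d \<le> (ell2_norm X (f - (p + (\<lambda>x. - t * k x))))\<^sup>2" by (rule d_le)
    also have "f - (p + (\<lambda>x. - t * k x)) = g + (\<lambda>x. t * k x)" by (auto simp: fun_eq_iff g_def)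
    also have "(ell2_norm X (g + (\<lambda>x. t * k x)))\<^sup>2
      = (ell2_norm X g)\<^sup>2 + 2 * Re (cnj t * c) + (cmod t)\<^sup>2 * (ell2_norm X k)\<^sup>2"
      by (simp add: c_def ell2_norm_add_sq[OF g tk] ell2_inner_scale_right ell2_norm_scale power_mult_distrib)
    also have "cnj t * c = - of_real ((cmod c)\<^sup>2 / (ell2_norm X k)\<^sup>2)"
      unfolding t_def by (simp add: complex_norm_square mult.commute del: of_real_power)
    also have "(cmod t)\<^sup>2 = (cmod c)\<^sup>2 / (ell2_norm X k)^4"
      unfolding t_def by (simp add: norm_divide power_divide norm_power)
    finally have "d \<le> (ell2_norm X g)\<^sup>2 - (cmod c)\<^sup>2 / (ell2_norm X k)\<^sup>2"
      using kn by (simp add: field_simps power2_eq_square power4_eq_xxxx)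
    moreover have "(cmod c)\<^sup>2 / (ell2_norm X k)\<^sup>2 > 0" using c0 kn by simp
    moreover have "(ell2_norm X g)\<^sup>2 \<le> d"
    proof -
      have "d \<ge> 0" unfolding d_def using HD(2) by (intro cInf_greatest) auto
      then show ?thesis using power_mono[OF pd, of 2] by (simp add: g_def)
    qed
    ultimately show False by linarith
  qed
  then show ?thesis using pH by blast
qed

section \<open>Basis vectors, evaluation functionals and finite truncations\<close>

definition ket :: "'a \<Rightarrow> 'a \<Rightarrow> complex" where
  "ket y = (\<lambda>x. if x = y then 1 else 0)"

lemma ket_ell2 [simp]: "y \<in> X \<Longrightarrow> ket y \<in> ell2 X"
proof (rule ell2I_bounded[where B = 1])
  fix F :: "'a set" assume "finite F"
  then have "(\<Sum>x\<in>F. (cmod (ket y x))\<^sup>2) = (\<Sum>x\<in>F. if x = y then 1 else 0)"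
    by (intro sum.cong) (auto simp: ket_def)
  then show "(\<Sum>x\<in>F. (cmod (ket y x))\<^sup>2) \<le> 1" using \<open>finite F\<close> by simp
qed (auto simp: ket_def)

lemma ell2_inner_ket:
  assumes "y \<in> X"
  shows "ell2_inner X f (ket y) = f y"
proof -
  have "ell2_inner X f (ket y) = (\<Sum>\<^sub>\<infinity>x\<in>{y}. f x * cnj (ket y x))"
    unfolding ell2_inner_def by (rule infsum_cong_neutral) (use assms in \<open>auto simp: ket_def\<close>)
  then show ?thesis by (simp add: ket_def)
qed

lemma ell2_inner_ket_left: "y \<in> X \<Longrightarrow> ell2_inner X (ket y) f = cnj (f y)"
  using ell2_inner_ket[of y X f] ell2_inner_cnj[of X f "ket y"] by simp

lemma ell2_eqI:
  assumes "f \<in> ell2 X" "h \<in> ell2 X" "\<And>x. x \<in> X \<Longrightarrow> f x = h x"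
  shows "f = h"
  using assms ell2_outside by (metis ext)

text \<open>The witness is the orthogonal projection of \<open>ket y\<close>: on H, pairing with it
  equals pairing with \<open>ket y\<close>. For H the closure of the vectors of P, this is how E
  applied to a basis vector is obtained.\<close>

lemma reproducing_kernel:
  assumes H: "closed_subspace X H" and y: "y \<in> X"
  shows "\<exists>z\<in>H. \<forall>f\<in>H. ell2_inner X f z = f y"
proof -
  obtain p where p: "p \<in> H" "\<And>k. k \<in> H \<Longrightarrow> ell2_inner X k (ket y - p) = 0"
    using ell2_projection[OF H ket_ell2[OF y]] by blast
  have "ell2_inner X f p = f y" if "f \<in> H" for f
    using p that closed_subspaceD(1)[OF H] y ell2_inner_diff_right[of "ket y" X p f]
    by (auto simp: ell2_inner_ket subset_iff)
  then show ?thesis using p(1) by blast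
qed

definition trunc :: "'a set \<Rightarrow> ('a \<Rightarrow> complex) \<Rightarrow> 'a \<Rightarrow> complex" where
  "trunc F f = (\<lambda>x. if x \<in> F then f x else 0)"

lemma trunc_ell2: "f \<in> ell2 X \<Longrightarrow> trunc F f \<in> ell2 X"
  by (auto simp: ell2_def trunc_def elim!: summable_on_comparison_test)

lemma trunc_empty [simp]: "trunc {} f = 0"
  by (auto simp: trunc_def)

lemma trunc_insert: "a \<notin> F \<Longrightarrow> trunc (insert a F) f = trunc F f + (\<lambda>x. f a * ket a x)"
  by (auto simp: trunc_def ket_def fun_eq_iff)

lemma trunc_tendsto:
  assumes f: "f \<in> ell2 X"
  shows "((\<lambda>F. ell2_norm X (f - trunc F f)) \<longlongrightarrow> 0) (finite_subsets_at_top X)"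
proof -
  have "(sum (\<lambda>x. (cmod (f x))\<^sup>2) \<longlongrightarrow> (ell2_norm X f)\<^sup>2) (finite_subsets_at_top X)"
    using has_sum_infsum[OF ell2_summable[OF f]] by (simp add: ell2_norm_sq has_sum_def)
  from tendsto_diff[OF tendsto_const[of "(ell2_norm X f)\<^sup>2"] this]
  have "((\<lambda>F. (ell2_norm X f)\<^sup>2 - sum (\<lambda>x. (cmod (f x))\<^sup>2) F) \<longlongrightarrow> 0) (finite_subsets_at_top X)"
    by simp
  from tendsto_real_sqrt[OF this]
  have lim: "((\<lambda>F. sqrt ((ell2_norm X f)\<^sup>2 - sum (\<lambda>x. (cmod (f x))\<^sup>2) F)) \<longlongrightarrow> 0)
    (finite_subsets_at_top X)" by simp
  have "ell2_norm X (f - trunc F f) = sqrt ((ell2_norm X f)\<^sup>2 - sum (\<lambda>x. (cmod (f x))\<^sup>2) F)"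
    if F: "finite F" "F \<subseteq> X" for F
  proof -
    have "(\<Sum>\<^sub>\<infinity>x\<in>X. (cmod ((f - trunc F f) x))\<^sup>2) = (\<Sum>\<^sub>\<infinity>x\<in>X - F. (cmod (f x))\<^sup>2)"
      by (rule infsum_cong_neutral) (auto simp: trunc_def)
    also have "\<dots> = (\<Sum>\<^sub>\<infinity>x\<in>X. (cmod (f x))\<^sup>2) - (\<Sum>\<^sub>\<infinity>x\<in>F. (cmod (f x))\<^sup>2)"
      by (rule infsum_Diff) (use ell2_summable[OF f] F in auto)
    finally show ?thesis using F by (simp add: ell2_norm_def infsum_nonneg)
  qed
  then have "\<forall>\<^sub>F F in finite_subsets_at_top X.
      sqrt ((ell2_norm X f)\<^sup>2 - sum (\<lambda>x. (cmod (f x))\<^sup>2) F) = ell2_norm X (f - trunc F f)"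
    by (auto simp: eventually_finite_subsets_at_top)
  from Lim_transform_eventually[OF lim this] show ?thesis .
qed

lemma closed_subspace_ket:
  assumes H: "closed_subspace X H" and f: "f \<in> ell2 X"
    and k: "\<And>x. x \<in> X \<Longrightarrow> f x \<noteq> 0 \<Longrightarrow> ket x \<in> H"
  shows "f \<in> H"
proof (rule closed_subspaceD(5)[OF H f])
  have fin: "trunc F f \<in> H" if "finite F" "F \<subseteq> X" for F
    using that
  proof (induction F rule: finite_induct)
    case (insert a F)
    have "(\<lambda>x. f a * ket a x) \<in> H"
    proof (cases "f a = 0")
      case True
      then have "(\<lambda>x. f a * ket a x) = 0" by auto
      then show ?thesis using closed_subspaceD(2)[OF H] by simp
    qed (use insert k closed_subspaceD(4)[OF H] in auto)
    moreover have "trunc F f \<in> H" using insert by auto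
    ultimately show ?case
      unfolding trunc_insert[OF insert(2)] using closed_subspaceD(3)[OF H] by blast
  qed (use closed_subspaceD(2)[OF H] in simp)
  fix e :: real assume "e > 0"
  then have "\<forall>\<^sub>F F in finite_subsets_at_top X. ell2_norm X (f - trunc F f) < e"
    using order_tendstoD(2)[OF trunc_tendsto[OF f]] by blast
  then obtain F where "finite F" "F \<subseteq> X" "ell2_norm X (f - trunc F f) < e"
    unfolding eventually_finite_subsets_at_top by blast
  then show "\<exists>h\<in>H. ell2_norm X (f - h) < e" using fin by blast
qed

section \<open>Bounded operators and commutants\<close>

lemma closed_subspace_Int:
  assumes "closed_subspace X H" "closed_subspace X K"
  shows "closed_subspace X (H \<inter> K)"
  unfolding closed_subspace_def
proof (intro conjI ballI allI impI)
  fix f assume f: "f \<in> ell2 X" and *: "\<forall>e>0. \<exists>h\<in>H \<inter> K. ell2_norm X (f - h) < e"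
  show "f \<in> H \<inter> K"
    using closed_subspaceD(5)[OF assms(1) f] closed_subspaceD(5)[OF assms(2) f] * by blast
qed (use closed_subspaceD(1-4)[OF assms(1)] closed_subspaceD(1-4)[OF assms(2)] in auto)

lemma closed_subspace_orthogonal:
  assumes A: "A \<subseteq> ell2 X"
  shows "closed_subspace X {f \<in> ell2 X. \<forall>a\<in>A. ell2_inner X f a = 0}"
  unfolding closed_subspace_def
proof (intro conjI ballI allI impI)
  fix f assume f: "f \<in> ell2 X"
    and *: "\<forall>e>0. \<exists>h\<in>{f \<in> ell2 X. \<forall>a\<in>A. ell2_inner X f a = 0}. ell2_norm X (f - h) < e"
  have "ell2_inner X f a = 0" if a: "a \<in> A" for a
  proof -
    have aX: "a \<in> ell2 X" using A a by blast
    have "cmod (ell2_inner X f a) \<le> 0 + e" if e: "e > 0" for e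
    proof -
      let ?N = "ell2_norm X a + 1"
      have N: "?N > 0" by (rule add_nonneg_pos) auto
      obtain h where h: "h \<in> ell2 X" "ell2_inner X h a = 0" "ell2_norm X (f - h) < e / ?N"
        using *[rule_format, of "e / ?N"] a e N by (auto simp: divide_pos_pos)
      have "cmod (ell2_inner X f a) = cmod (ell2_inner X (f - h) a)"
        using ell2_inner_diff_left[OF f h(1) aX] h(2) by simp
      also have "\<dots> \<le> ell2_norm X (f - h) * ell2_norm X a"
        by (rule ell2_cauchy_schwarz[OF ell2_diff[OF f h(1)] aX])
      also have "\<dots> \<le> e / ?N * ?N"
        using h(3) e N by (intro mult_mono) (auto simp: divide_nonneg_pos)
      also have "\<dots> = e" using N by simp
      finally show ?thesis by simp
    qed
    then show ?thesis using field_le_epsilon[of "cmod (ell2_inner X f a)" 0] by simp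
  qed
  then show "f \<in> {f \<in> ell2 X. \<forall>a\<in>A. ell2_inner X f a = 0}" using f by blast
qed (use A in \<open>auto simp: ell2_inner_add_left ell2_inner_scale_left ell2_add ell2_scale subset_iff\<close>)

definition ell2_closure :: "'a set \<Rightarrow> ('a \<Rightarrow> complex) set \<Rightarrow> ('a \<Rightarrow> complex) set" where
  "ell2_closure X D = {f \<in> ell2 X. \<forall>e>0. \<exists>h\<in>D. ell2_norm X (f - h) < e}"

lemma ell2_closureE:
  assumes "f \<in> ell2_closure X D" "e > 0"
  obtains h where "h \<in> D" "ell2_norm X (f - h) < e"
  using assms unfolding ell2_closure_def by blast

lemma ell2_closure_subset: "D \<subseteq> ell2 X \<Longrightarrow> D \<subseteq> ell2_closure X D"
proof
  fix f assume D: "D \<subseteq> ell2 X" "f \<in> D"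
  have "ell2_norm X (f - f) = 0" by (simp add: ell2_norm_def)
  then have "\<exists>h\<in>D. ell2_norm X (f - h) < e" if "e > 0" for e
    using that D(2) by (intro bexI[of _ f]) auto
  then show "f \<in> ell2_closure X D" using D unfolding ell2_closure_def by blast
qed

lemma ell2_closure_minimal: "closed_subspace X H \<Longrightarrow> D \<subseteq> H \<Longrightarrow> ell2_closure X D \<subseteq> H"
  unfolding ell2_closure_def using closed_subspaceD(5) by blast

lemma closed_subspace_closure:
  assumes D: "D \<subseteq> ell2 X" and 0: "0 \<in> D" and add: "\<And>f h. f \<in> D \<Longrightarrow> h \<in> D \<Longrightarrow> f + h \<in> D"
    and scale: "\<And>c f. f \<in> D \<Longrightarrow> (\<lambda>x. c * f x) \<in> D"
  shows "closed_subspace X (ell2_closure X D)"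
  unfolding closed_subspace_def
proof (intro conjI ballI allI impI)
  show "0 \<in> ell2_closure X D" using 0 ell2_closure_subset[OF D] by blast
  show "ell2_closure X D \<subseteq> ell2 X" by (auto simp: ell2_closure_def)
next
  fix f h assume fh: "f \<in> ell2_closure X D" "h \<in> ell2_closure X D"
  then have fhX: "f \<in> ell2 X" "h \<in> ell2 X" by (auto simp: ell2_closure_def)
  have "\<exists>k\<in>D. ell2_norm X (f + h - k) < e" if e: "e > 0" for e
  proof -
    obtain f' h' where d: "f' \<in> D" "ell2_norm X (f - f') < e/2" "h' \<in> D" "ell2_norm X (h - h') < e/2"
      using ell2_closureE[OF fh(1) half_gt_zero[OF e]] ell2_closureE[OF fh(2) half_gt_zero[OF e]] by metis
    have eq: "f + h - (f' + h') = (f - f') + (h - h')" by simp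
    have "ell2_norm X (f + h - (f' + h')) \<le> ell2_norm X (f - f') + ell2_norm X (h - h')"
      unfolding eq using d D fhX by (intro ell2_norm_triangle ell2_diff) auto
    then show ?thesis using add d by (intro bexI[of _ "f' + h'"]) auto
  qed
  then show "f + h \<in> ell2_closure X D" using fhX ell2_add by (auto simp: ell2_closure_def)
next
  fix c f assume f: "f \<in> ell2_closure X D"
  have "\<exists>k\<in>D. ell2_norm X ((\<lambda>x. c * f x) - k) < e" if e: "e > 0" for e
  proof -
    have pos: "cmod c + 1 > 0" by (rule add_nonneg_pos) auto
    obtain f' where f': "f' \<in> D" "ell2_norm X (f - f') < e / (cmod c + 1)"
      using ell2_closureE[OF f divide_pos_pos[OF e pos]] by blast
    have eq: "(\<lambda>x. c * f x) - (\<lambda>x. c * f' x) = (\<lambda>x. c * (f - f') x)"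
      by (auto simp: fun_eq_iff algebra_simps)
    have "ell2_norm X ((\<lambda>x. c * f x) - (\<lambda>x. c * f' x)) \<le> (cmod c + 1) * ell2_norm X (f - f')"
      unfolding eq ell2_norm_scale by (intro mult_right_mono) auto
    also have "\<dots> < (cmod c + 1) * (e / (cmod c + 1))"
      using pos f' by (intro mult_strict_left_mono)
    also have "\<dots> = e" using pos by simp
    finally show ?thesis using scale f' by (intro bexI[of _ "\<lambda>x. c * f' x"]) auto
  qed
  then show "(\<lambda>x. c * f x) \<in> ell2_closure X D"
    using f ell2_scale by (auto simp: ell2_closure_def)
next
  fix f assume f: "f \<in> ell2 X" and *: "\<forall>e>0. \<exists>h\<in>ell2_closure X D. ell2_norm X (f - h) < e"
  have "\<exists>k\<in>D. ell2_norm X (f - k) < e" if e: "e > 0" for e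
  proof -
    obtain h where h: "h \<in> ell2_closure X D" "ell2_norm X (f - h) < e/2"
      using * e half_gt_zero by blast
    then obtain k where k: "k \<in> D" "ell2_norm X (h - k) < e/2"
      using ell2_closureE[OF _ half_gt_zero[OF e]] by blast
    have "ell2_norm X (f - k) < e"
      using ell2_norm_diff_triangle[OF f, of h k] h k D by (force simp: ell2_closure_def)
    then show ?thesis using k by blast
  qed
  then show "f \<in> ell2_closure X D" using f by (auto simp: ell2_closure_def)
qed

section \<open>Bounded operators, their matrices and their adjoints\<close>

lemma bounded_opsD:
  assumes "T \<in> bounded_ops X"
  shows "f \<in> ell2 X \<Longrightarrow> T f \<in> ell2 X"
    "f \<in> ell2 X \<Longrightarrow> h \<in> ell2 X \<Longrightarrow> T (f + h) = T f + T h"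
    "f \<in> ell2 X \<Longrightarrow> T (\<lambda>x. c * f x) = (\<lambda>x. c * T f x)"
    "f \<notin> ell2 X \<Longrightarrow> T f = 0"
  using assms by (auto simp: bounded_ops_def)

lemma bounded_ops_ell2: "T \<in> bounded_ops X \<Longrightarrow> T f \<in> ell2 X"
  by (metis bounded_opsD(1,4) ell2_zero)

lemma bounded_ops_bound:
  assumes "T \<in> bounded_ops X"
  obtains K where "K > 0" "\<And>f. f \<in> ell2 X \<Longrightarrow> ell2_norm X (T f) \<le> K * ell2_norm X f"
proof -
  obtain K where K: "\<And>f. f \<in> ell2 X \<Longrightarrow> ell2_norm X (T f) \<le> K * ell2_norm X f"
    using assms unfolding bounded_ops_def by blast
  have "K * ell2_norm X f \<le> max K 1 * ell2_norm X f" for f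
    by (intro mult_right_mono) auto
  then show ?thesis using K by (intro that[of "max K 1"]) (auto intro: order_trans)
qed

lemma bounded_opsI:
  assumes "\<And>f. f \<in> ell2 X \<Longrightarrow> T f \<in> ell2 X"
    and "\<And>f h. f \<in> ell2 X \<Longrightarrow> h \<in> ell2 X \<Longrightarrow> T (f + h) = T f + T h"
    and "\<And>c f. f \<in> ell2 X \<Longrightarrow> T (\<lambda>x. c * f x) = (\<lambda>x. c * T f x)"
    and "\<And>f. f \<in> ell2 X \<Longrightarrow> ell2_norm X (T f) \<le> K * ell2_norm X f"
    and "\<And>f. f \<notin> ell2 X \<Longrightarrow> T f = 0"
  shows "T \<in> bounded_ops X"
  unfolding bounded_ops_def using assms by blast

lemma bounded_ops_zero: "T \<in> bounded_ops X \<Longrightarrow> T 0 = 0"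
  using bounded_opsD(3)[of T X 0 0] ell2_zero[of X] by (simp add: zero_fun_def)

lemma bounded_ops_diff:
  assumes "T \<in> bounded_ops X" "f \<in> ell2 X" "h \<in> ell2 X"
  shows "T (f - h) = T f - T h"
  using bounded_opsD(2)[OF assms(1) ell2_diff[OF assms(2,3)] assms(3)] by (simp add: eq_diff_eq)

lemma bounded_ops_add:
  assumes S: "S \<in> bounded_ops X" and T: "T \<in> bounded_ops X"
  shows "S + T \<in> bounded_ops X"
proof -
  obtain K where K: "\<And>f. f \<in> ell2 X \<Longrightarrow> ell2_norm X (S f) \<le> K * ell2_norm X f"
    using bounded_ops_bound[OF S] by blast
  obtain L where L: "\<And>f. f \<in> ell2 X \<Longrightarrow> ell2_norm X (T f) \<le> L * ell2_norm X f"
    using bounded_ops_bound[OF T] by blast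
  show ?thesis
  proof (rule bounded_opsI[where K = "K + L"])
    fix f assume f: "f \<in> ell2 X"
    show "ell2_norm X ((S + T) f) \<le> (K + L) * ell2_norm X f"
      using ell2_norm_triangle[OF bounded_opsD(1)[OF S f] bounded_opsD(1)[OF T f]] K[OF f] L[OF f]
      by (simp add: distrib_right)
  qed (use S T in \<open>auto simp: bounded_opsD ell2_add fun_eq_iff distrib_left\<close>)
qed

lemma bounded_ops_scale:
  assumes T: "T \<in> bounded_ops X"
  shows "(\<lambda>f x. c * T f x) \<in> bounded_ops X"
proof -
  obtain L where L: "\<And>f. f \<in> ell2 X \<Longrightarrow> ell2_norm X (T f) \<le> L * ell2_norm X f"
    using bounded_ops_bound[OF T] by blast
  show ?thesis
  proof (rule bounded_opsI[where K = "cmod c * L"])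
    fix f assume f: "f \<in> ell2 X"
    show "ell2_norm X (\<lambda>x. c * T f x) \<le> cmod c * L * ell2_norm X f"
      using mult_left_mono[OF L[OF f], of "cmod c"] by (simp add: ell2_norm_scale mult.assoc)
  qed (use T in \<open>auto simp: bounded_opsD ell2_scale fun_eq_iff distrib_left\<close>)
qed

lemma bounded_ops_comp:
  assumes S: "S \<in> bounded_ops X" and T: "T \<in> bounded_ops X"
  shows "S \<circ> T \<in> bounded_ops X"
proof -
  obtain K where K: "K > 0" "\<And>f. f \<in> ell2 X \<Longrightarrow> ell2_norm X (S f) \<le> K * ell2_norm X f"
    using bounded_ops_bound[OF S] by blast
  obtain L where L: "\<And>f. f \<in> ell2 X \<Longrightarrow> ell2_norm X (T f) \<le> L * ell2_norm X f"
    using bounded_ops_bound[OF T] by blast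
  show ?thesis
  proof (rule bounded_opsI[where K = "K * L"])
    fix f assume f: "f \<in> ell2 X"
    show "ell2_norm X ((S \<circ> T) f) \<le> K * L * ell2_norm X f"
      using order_trans[OF K(2)[OF bounded_opsD(1)[OF T f]] mult_left_mono[OF L[OF f]]] K(1)
      by (simp add: mult.assoc)
    show "(S \<circ> T) (f + h) = (S \<circ> T) f + (S \<circ> T) h" if "h \<in> ell2 X" for h
      unfolding comp_apply by (metis S T f that bounded_opsD(1,2))
  next
    fix f assume "f \<notin> ell2 X"
    then show "(S \<circ> T) f = 0" unfolding comp_apply by (metis S T bounded_opsD(4) bounded_ops_zero)
  qed (use S T in \<open>auto simp: bounded_opsD(1,3)\<close>)
qed

lemma id_op_bounded: "id_op X \<in> bounded_ops X"
  by (rule bounded_opsI[where K = 1]) (auto simp: id_op_def ell2_add ell2_scale)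

lemma ell2_closure_op:
  assumes T: "T \<in> bounded_ops X" and D: "D \<subseteq> ell2 X" and TD: "\<And>h. h \<in> D \<Longrightarrow> T h \<in> D'"
    and f: "f \<in> ell2_closure X D"
  shows "T f \<in> ell2_closure X D'"
proof -
  have fX: "f \<in> ell2 X" using f by (simp add: ell2_closure_def)
  obtain K where K: "K > 0" "\<And>f. f \<in> ell2 X \<Longrightarrow> ell2_norm X (T f) \<le> K * ell2_norm X f"
    using bounded_ops_bound[OF T] by blast
  have "\<exists>h\<in>D'. ell2_norm X (T f - h) < e" if e: "e > 0" for e
  proof -
    obtain h where h: "h \<in> D" "ell2_norm X (f - h) < e / K"
      using ell2_closureE[OF f divide_pos_pos[OF e K(1)]] by blast
    have hX: "h \<in> ell2 X" using h D by blast
    have "ell2_norm X (T f - T h) \<le> K * ell2_norm X (f - h)"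
      using K(2)[OF ell2_diff[OF fX hX]] bounded_ops_diff[OF T fX hX] by simp
    also have "\<dots> < e" using h(2) K(1) by (simp add: pos_less_divide_eq mult.commute)
    finally show ?thesis using TD h(1) by blast
  qed
  then show ?thesis using bounded_opsD(1)[OF T fX] by (simp add: ell2_closure_def)
qed

lemma bounded_ops_trunc:
  assumes T: "T \<in> bounded_ops X" and f: "f \<in> ell2 X" and h: "h \<in> ell2 X" and F: "finite F" "F \<subseteq> X"
  shows "ell2_inner X (T (trunc F f)) h = (\<Sum>x\<in>F. f x * ell2_inner X (T (ket x)) h)"
  using F
proof (induction F rule: finite_induct)
  case empty
  then show ?case
    by (simp only: trunc_empty bounded_ops_zero[OF T] ell2_inner_zero_left sum.empty)
next
  case (insert a F)
  have a: "ket a \<in> ell2 X" using insert by simp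
  have eq: "T (trunc (insert a F) f) = T (trunc F f) + (\<lambda>x. f a * T (ket a) x)"
    unfolding trunc_insert[OF insert(2)]
    by (simp add: bounded_opsD(2,3)[OF T] trunc_ell2[OF f] a ell2_scale)
  have "ell2_inner X (T (trunc (insert a F) f)) h
    = ell2_inner X (T (trunc F f)) h + f a * ell2_inner X (T (ket a)) h"
    unfolding eq
    by (subst ell2_inner_add_left)
       (simp_all only: ell2_inner_scale_left ell2_scale bounded_ops_ell2[OF T] h)
  then show ?case using insert by simp
qed

text \<open>The truncations of f converge in norm, and T followed by pairing with h is continuous,
  so the expansion of f may be inserted term by term.\<close>

lemma bounded_ops_has_sum_inner:
  assumes T: "T \<in> bounded_ops X" and f: "f \<in> ell2 X" and h: "h \<in> ell2 X"
  shows "((\<lambda>x. f x * ell2_inner X (T (ket x)) h) has_sum ell2_inner X (T f) h) X"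
proof -
  obtain K where K: "K > 0" "\<And>f. f \<in> ell2 X \<Longrightarrow> ell2_norm X (T f) \<le> K * ell2_norm X f"
    using bounded_ops_bound[OF T] by blast
  let ?s = "\<lambda>F. \<Sum>x\<in>F. f x * ell2_inner X (T (ket x)) h"
  have "cmod (?s F - ell2_inner X (T f) h) \<le> K * ell2_norm X h * ell2_norm X (f - trunc F f)"
    if F: "finite F" "F \<subseteq> X" for F
  proof -
    have tX: "trunc F f \<in> ell2 X" using trunc_ell2[OF f] .
    have "ell2_inner X (T f) h - ?s F = ell2_inner X (T (f - trunc F f)) h"
      by (simp add: bounded_ops_diff[OF T f tX] ell2_inner_diff_left bounded_opsD(1)[OF T] f tX h
          bounded_ops_trunc[OF T f h F])
    then have "cmod (?s F - ell2_inner X (T f) h) = cmod (ell2_inner X (T (f - trunc F f)) h)"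
      by (metis norm_minus_commute)
    also have "\<dots> \<le> ell2_norm X (T (f - trunc F f)) * ell2_norm X h"
      by (intro ell2_cauchy_schwarz bounded_opsD(1)[OF T] ell2_diff f tX h)
    also have "\<dots> \<le> (K * ell2_norm X (f - trunc F f)) * ell2_norm X h"
      by (intro mult_right_mono K(2) ell2_diff f tX) auto
    finally show ?thesis by (simp add: mult_ac)
  qed
  then have ev: "\<forall>\<^sub>F F in finite_subsets_at_top X.
      norm (?s F - ell2_inner X (T f) h) \<le> K * ell2_norm X h * ell2_norm X (f - trunc F f)"
    by (auto simp: eventually_finite_subsets_at_top)
  have "((\<lambda>F. K * ell2_norm X h * ell2_norm X (f - trunc F f)) \<longlongrightarrow> K * ell2_norm X h * 0)
      (finite_subsets_at_top X)"
    by (intro tendsto_intros trunc_tendsto f)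
  then have "((\<lambda>F. ?s F - ell2_inner X (T f) h) \<longlongrightarrow> 0) (finite_subsets_at_top X)"
    using Lim_null_comparison[OF ev] by simp
  then show ?thesis unfolding has_sum_def using LIM_zero_iff by blast
qed

lemma bounded_ops_matrix:
  assumes T: "T \<in> bounded_ops X" and f: "f \<in> ell2 X"
  shows "T f y = (\<Sum>\<^sub>\<infinity>x\<in>X. f x * T (ket x) y)"
proof (cases "y \<in> X")
  case True
  then show ?thesis
    using infsumI[OF bounded_ops_has_sum_inner[OF T f ket_ell2[OF True]]] by (simp add: ell2_inner_ket)
next
  case False
  then show ?thesis using ell2_outside[OF bounded_ops_ell2[OF T]] by simp
qed

lemma bounded_ops_eqI:
  assumes S: "S \<in> bounded_ops X" and T: "T \<in> bounded_ops X"
    and eq: "\<And>x. x \<in> X \<Longrightarrow> S (ket x) = T (ket x)"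
  shows "S = T"
proof
  fix f show "S f = T f"
  proof (cases "f \<in> ell2 X")
    case True
    show ?thesis
      unfolding bounded_ops_matrix[OF S True, abs_def] bounded_ops_matrix[OF T True, abs_def]
      by (intro ext infsum_cong) (simp add: eq)
  qed (simp add: bounded_opsD(4)[OF S] bounded_opsD(4)[OF T])
qed

text \<open>The value of the adjoint at x is forced to be the pairing of h with
  \<open>T (ket x)\<close>. That this is square-summable comes from testing T on finite truncations
  of the candidate.\<close>

lemma adjoint_exists:
  assumes T: "T \<in> bounded_ops X"
  shows "\<exists>S\<in>bounded_ops X. adjoint_pair X S T"
proof -
  define S where "S = (\<lambda>h. if h \<in> ell2 X then (\<lambda>x. if x \<in> X then ell2_inner X h (T (ket x)) else 0) else 0)"
  obtain K where K: "K > 0" "\<And>f. f \<in> ell2 X \<Longrightarrow> ell2_norm X (T f) \<le> K * ell2_norm X f"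
    using bounded_ops_bound[OF T] by blast
  have bound: "(\<Sum>x\<in>F. (cmod (S h x))\<^sup>2) \<le> (K * ell2_norm X h)\<^sup>2"
    if h: "h \<in> ell2 X" and F: "finite F" "F \<subseteq> X" for h F
  proof -
    let ?s = "\<Sum>x\<in>F. (cmod (S h x))\<^sup>2"
    \<comment> \<open>Testing T on this truncation gives
      \<open>?s \<le> K * ell2_norm X h * sqrt ?s\<close>; cancelling the root bounds
      \<open>?s\<close> independently of F.\<close>
    define g where "g = trunc F (S h)"
    have g_sum: "(\<Sum>x\<in>A. (cmod (g x))\<^sup>2) \<le> ?s" if A: "finite A" for A
    proof -
      have "(\<Sum>x\<in>A. (cmod (g x))\<^sup>2) = (\<Sum>x\<in>A \<inter> F. (cmod (S h x))\<^sup>2)"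
        by (subst sum.inter_restrict[OF A]) (auto simp: g_def trunc_def intro!: sum.cong)
      also have "\<dots> \<le> ?s" by (rule sum_mono2) (use F in auto)
      finally show ?thesis .
    qed
    have s0: "?s \<ge> 0" by (simp add: sum_nonneg)
    have gX: "g \<in> ell2 X"
      by (rule ell2I_bounded[OF _ g_sum]) (use F in \<open>auto simp: g_def trunc_def\<close>)
    have gn: "ell2_norm X g \<le> sqrt ?s"
      by (rule ell2_norm_le[OF gX]) (use g_sum s0 in auto)
    have "ell2_inner X (T g) h = (\<Sum>x\<in>F. g x * ell2_inner X (T (ket x)) h)"
      using bounded_ops_trunc[OF T gX h F] by (simp add: g_def trunc_def cong: if_cong)
    also have "\<dots> = (\<Sum>x\<in>F. of_real ((cmod (S h x))\<^sup>2))"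
      using F h by (intro sum.cong)
        (auto simp only: g_def trunc_def S_def complex_norm_square ell2_inner_cnj if_True subset_iff)
    finally have "?s = cmod (ell2_inner X (T g) h)"
      using s0 by (simp flip: of_real_sum del: of_real_power)
    also have "\<dots> \<le> ell2_norm X (T g) * ell2_norm X h"
      by (intro ell2_cauchy_schwarz bounded_opsD(1)[OF T] gX h)
    also have "\<dots> \<le> K * ell2_norm X g * ell2_norm X h"
      by (intro mult_right_mono K(2) gX) auto
    also have "\<dots> \<le> K * sqrt ?s * ell2_norm X h"
      using K(1) gn by (intro mult_right_mono mult_left_mono) auto
    finally have *: "?s \<le> (K * ell2_norm X h) * sqrt ?s" by (simp add: mult_ac)
    have "sqrt ?s \<le> K * ell2_norm X h"
    proof (cases "?s = 0")
      case True
      then show ?thesis using K(1) by simp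
    next
      case False
      then have pos: "sqrt ?s > 0" using s0 by simp
      have "sqrt ?s * sqrt ?s \<le> (K * ell2_norm X h) * sqrt ?s" using * s0 by simp
      then show ?thesis using pos by (rule mult_right_le_imp_le)
    qed
    then have "(sqrt ?s)\<^sup>2 \<le> (K * ell2_norm X h)\<^sup>2" using s0 by (intro power_mono) auto
    then show ?thesis using s0 by simp
  qed
  have SX: "S h \<in> ell2 X" if "h \<in> ell2 X" for h
    by (rule ell2I_bounded[OF _ bound[OF that]]) (auto simp: S_def)
  have TX: "T (ket x) \<in> ell2 X" for x using bounded_ops_ell2[OF T] .
  have "S \<in> bounded_ops X"
  proof (rule bounded_opsI[where K = K])
    show "ell2_norm X (S f) \<le> K * ell2_norm X f" if "f \<in> ell2 X" for f
      by (rule ell2_norm_le[OF SX[OF that] _ bound[OF that]]) (use K(1) in auto)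
  qed (auto simp: SX, auto simp: S_def fun_eq_iff ell2_add ell2_scale ell2_inner_add_left
      ell2_inner_scale_left TX)
  moreover have "adjoint_pair X S T"
    unfolding adjoint_pair_def
  proof (intro ballI)
    fix f h assume f: "f \<in> ell2 X" and h: "h \<in> ell2 X"
    have "ell2_inner X f (S h) = (\<Sum>\<^sub>\<infinity>x\<in>X. f x * ell2_inner X (T (ket x)) h)"
      unfolding ell2_inner_def[of X f] by (intro infsum_cong) (simp add: S_def h ell2_inner_cnj)
    then show "ell2_inner X (T f) h = ell2_inner X f (S h)"
      using infsumI[OF bounded_ops_has_sum_inner[OF T f h]] by simp
  qed
  ultimately show ?thesis by blast
qed

lemma adjoint_pairD:
  "adjoint_pair X S T \<Longrightarrow> f \<in> ell2 X \<Longrightarrow> h \<in> ell2 X \<Longrightarrow> ell2_inner X (T f) h = ell2_inner X f (S h)"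
  by (simp add: adjoint_pair_def)

lemma adjoint_pair_sym: "adjoint_pair X S T \<Longrightarrow> adjoint_pair X T S"
  unfolding adjoint_pair_def by (metis ell2_inner_cnj)

section \<open>Commutants, von Neumann algebras and generated algebras\<close>

lemma commutantD:
  assumes "T \<in> commutant X M"
  shows "T \<in> bounded_ops X" "S \<in> M \<Longrightarrow> S (T f) = T (S f)"
  using assms by (auto simp: commutant_def fun_eq_iff)

lemma commutantI: "T \<in> bounded_ops X \<Longrightarrow> (\<And>S f. S \<in> M \<Longrightarrow> S (T f) = T (S f)) \<Longrightarrow> T \<in> commutant X M"
  by (auto simp: commutant_def fun_eq_iff)

lemma commutant_comp: "S \<in> commutant X M \<Longrightarrow> T \<in> commutant X M \<Longrightarrow> S \<circ> T \<in> commutant X M"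
  by (rule commutantI) (simp_all add: bounded_ops_comp commutantD(1), metis commutantD(2))

lemma commutant_add:
  assumes "M \<subseteq> bounded_ops X" "S \<in> commutant X M" "T \<in> commutant X M"
  shows "S + T \<in> commutant X M"
proof (rule commutantI)
  fix R f assume R: "R \<in> M"
  then show "R ((S + T) f) = (S + T) (R f)"
    using assms bounded_opsD(2)[of R X "S f" "T f"] commutantD(2)[OF assms(2) R, of f]
      commutantD(2)[OF assms(3) R, of f] by (auto simp: bounded_ops_ell2 commutantD(1) subset_iff)
qed (use assms in \<open>simp add: bounded_ops_add commutantD(1)\<close>)

lemma commutant_scale:
  assumes "M \<subseteq> bounded_ops X" "T \<in> commutant X M"
  shows "(\<lambda>f x. c * T f x) \<in> commutant X M"
proof (rule commutantI)
  fix R f assume R: "R \<in> M"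
  then show "R (\<lambda>x. c * T f x) = (\<lambda>x. c * T (R f) x)"
    using assms bounded_opsD(3)[of R X "T f" c] commutantD(2)[OF assms(2) R, of f]
    by (auto simp: bounded_ops_ell2 commutantD(1) subset_iff)
qed (use assms in \<open>simp add: bounded_ops_scale commutantD(1)\<close>)

lemma commutant_bounded: "commutant X M \<subseteq> bounded_ops X"
  by (auto simp: commutant_def)

lemma commutant_id_op:
  assumes "M \<subseteq> bounded_ops X"
  shows "id_op X \<in> commutant X M"
proof (rule commutantI[OF id_op_bounded])
  fix R f assume "R \<in> M"
  then show "R (id_op X f) = id_op X (R f)"
    using assms by (auto simp: id_op_def bounded_ops_ell2 bounded_ops_zero bounded_opsD(4) subset_iff)
qed

lemma commutant_antimono: "M \<subseteq> N \<Longrightarrow> commutant X N \<subseteq> commutant X M"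
  by (auto simp: commutant_def)

lemma double_commutant_supset: "M \<subseteq> bounded_ops X \<Longrightarrow> M \<subseteq> commutant X (commutant X M)"
  by (auto simp: commutant_def)

text \<open>A self-adjoint set has a self-adjoint commutant, and a third commutant is the first.
  This bounds generated algebras from above: it suffices to find the generators inside such a
  commutant.\<close>

lemma von_neumann_algebra_commutant:
  assumes M: "M \<subseteq> bounded_ops X" and adj: "\<And>T. T \<in> M \<Longrightarrow> \<exists>S\<in>M. adjoint_pair X S T"
  shows "von_neumann_algebra X (commutant X M)"
  unfolding von_neumann_algebra_def
proof (intro conjI ballI)
  show "commutant X (commutant X (commutant X M)) = commutant X M"
    by (intro equalityI commutant_antimono double_commutant_supset M commutant_bounded)
  fix T assume T: "T \<in> commutant X M"
  then obtain S where S: "S \<in> bounded_ops X" "adjoint_pair X S T"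
    using adjoint_exists commutantD(1) by blast
  have "S \<in> commutant X M"
  proof (rule commutantI[OF S(1)])
    fix R h assume R: "R \<in> M"
    then obtain R' where R': "R' \<in> M" "adjoint_pair X R' R" using adj by blast
    note Rb = R[THEN subsetD[OF M]] and Rb' = R'(1)[THEN subsetD[OF M]]
    show "R (S h) = S (R h)"
    proof (cases "h \<in> ell2 X")
      case h: True
      show ?thesis
      proof (rule ell2_eqI[of _ X])
        fix x assume x: "x \<in> X"
        let ?f = "ket x"
        have f: "?f \<in> ell2 X" using x by simp
        have "ell2_inner X ?f (R (S h)) = ell2_inner X (R' ?f) (S h)"
          using adjoint_pairD[OF adjoint_pair_sym[OF R'(2)] f] bounded_ops_ell2[OF S(1)] by simp
        also have "\<dots> = ell2_inner X (T (R' ?f)) h"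
          using adjoint_pairD[OF S(2) _ h] bounded_ops_ell2[OF Rb'] by simp
        also have "\<dots> = ell2_inner X (R' (T ?f)) h"
          using commutantD(2)[OF T R'(1)] by simp
        also have "\<dots> = ell2_inner X (T ?f) (R h)"
          using adjoint_pairD[OF adjoint_pair_sym[OF R'(2)] _ h] bounded_ops_ell2[OF commutantD(1)[OF T]]
          by simp
        also have "\<dots> = ell2_inner X ?f (S (R h))"
          using adjoint_pairD[OF S(2) f] bounded_ops_ell2[OF Rb] by simp
        finally show "R (S h) x = S (R h) x" using x by (simp add: ell2_inner_ket_left)
      qed (use bounded_ops_ell2 S(1) Rb in blast)+
    qed (simp add: bounded_opsD(4)[OF S(1)] bounded_opsD(4)[OF Rb] bounded_ops_zero[OF S(1)]
        bounded_ops_zero[OF Rb])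
  qed
  then show "\<exists>S\<in>commutant X M. adjoint_pair X S T" using S(2) by blast
qed (rule commutant_bounded)

lemma von_neumann_algebraD:
  assumes "von_neumann_algebra X P"
  shows "P \<subseteq> bounded_ops X" "T \<in> P \<Longrightarrow> \<exists>S\<in>P. adjoint_pair X S T"
    "commutant X (commutant X P) = P"
  using assms by (auto simp: von_neumann_algebra_def)

lemma von_neumann_algebra_closed:
  assumes P: "von_neumann_algebra X P" and "S \<in> P" "T \<in> P"
  shows "S \<circ> T \<in> P" "S + T \<in> P" "(\<lambda>f x. c * T f x) \<in> P" "id_op X \<in> P"
proof -
  note C = von_neumann_algebraD(3)[OF P]
  show "S \<circ> T \<in> P" using commutant_comp assms(2,3) C by metis
  show "S + T \<in> P" using commutant_add[OF commutant_bounded] assms(2,3) C by metis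
  show "(\<lambda>f x. c * T f x) \<in> P" using commutant_scale[OF commutant_bounded] assms(3) C by metis
  show "id_op X \<in> P" using commutant_id_op[OF commutant_bounded] C by metis
qed

lemma generated_vna_superset: "S \<subseteq> generated_vna X S"
  by (auto simp: generated_vna_def)

lemma generated_vna_minimal: "von_neumann_algebra X M \<Longrightarrow> S \<subseteq> M \<Longrightarrow> generated_vna X S \<subseteq> M"
  by (auto simp: generated_vna_def)

lemma generated_vnaI:
  "(\<And>M. von_neumann_algebra X M \<Longrightarrow> S \<subseteq> M \<Longrightarrow> T \<in> M) \<Longrightarrow> T \<in> generated_vna X S"
  by (auto simp: generated_vna_def)

lemma generated_vnaD: "T \<in> generated_vna X A \<Longrightarrow> von_neumann_algebra X M \<Longrightarrow> A \<subseteq> M \<Longrightarrow> T \<in> M"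
  by (auto simp: generated_vna_def)

lemma generated_vna_closed:
  assumes "S \<in> generated_vna X A" "T \<in> generated_vna X A"
  shows "S \<circ> T \<in> generated_vna X A" "S + T \<in> generated_vna X A"
    "(\<lambda>f x. a * T f x) \<in> generated_vna X A" "id_op X \<in> generated_vna X A"
proof -
  note closed = von_neumann_algebra_closed[OF _ generated_vnaD[OF assms(1)] generated_vnaD[OF assms(2)]]
  show "S \<circ> T \<in> generated_vna X A" "S + T \<in> generated_vna X A"
    "(\<lambda>f x. a * T f x) \<in> generated_vna X A" "id_op X \<in> generated_vna X A"
    by (rule generated_vnaI, rule closed; assumption)+
qed

section \<open>Left translation operators of a group\<close>

text \<open>Off \<open>ell2 X\<close> both operators give 0, and both map 0 to 0, so commutation is
  a question about the Hilbert space alone.\<close>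

lemma bounded_ops_commute_ext:
  assumes "S \<in> bounded_ops X" "T \<in> bounded_ops X"
    and "f \<in> ell2 X \<Longrightarrow> S (T f) = T (S f)"
  shows "S (T f) = T (S f)"
  using assms bounded_opsD(4) bounded_ops_zero by (metis (no_types))

definition reindex_op :: "'a set \<Rightarrow> ('a \<Rightarrow> 'a) \<Rightarrow> 'a operator" where
  "reindex_op X \<sigma> = (\<lambda>f. if f \<in> ell2 X then (\<lambda>x. if x \<in> X then f (\<sigma> x) else 0) else 0)"

lemma reindex_op_apply: "f \<in> ell2 X \<Longrightarrow> x \<in> X \<Longrightarrow> reindex_op X \<sigma> f x = f (\<sigma> x)"
  by (simp add: reindex_op_def)

lemma reindex_op_bounded:
  assumes \<sigma>: "bij_betw \<sigma> X X"
  shows "reindex_op X \<sigma> \<in> bounded_ops X"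
proof (rule bounded_opsI[where K = 1])
  fix f assume f: "f \<in> ell2 X"
  show "reindex_op X \<sigma> f \<in> ell2 X"
    by (rule ell2_comp_inj[OF f \<sigma>]) (simp_all add: reindex_op_def f)
  have "(\<Sum>\<^sub>\<infinity>x\<in>X. (cmod (reindex_op X \<sigma> f x))\<^sup>2) = (\<Sum>\<^sub>\<infinity>x\<in>X. (cmod (f (\<sigma> x)))\<^sup>2)"
    by (rule infsum_cong) (simp add: reindex_op_apply f)
  also have "\<dots> = (\<Sum>\<^sub>\<infinity>x\<in>X. (cmod (f x))\<^sup>2)"
    by (rule infsum_reindex_bij_betw[OF \<sigma>])
  finally show "ell2_norm X (reindex_op X \<sigma> f) \<le> 1 * ell2_norm X f"
    by (simp add: ell2_norm_def)
qed (auto simp: reindex_op_def ell2_add ell2_scale fun_eq_iff)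

lemma reindex_op_adjoint:
  assumes \<sigma>: "bij_betw \<sigma> X X" and \<tau>: "\<And>x. x \<in> X \<Longrightarrow> \<tau> (\<sigma> x) = x"
  shows "adjoint_pair X (reindex_op X \<tau>) (reindex_op X \<sigma>)"
  unfolding adjoint_pair_def
proof (intro ballI)
  fix f h assume fh: "f \<in> ell2 X" "h \<in> ell2 X"
  have "ell2_inner X f (reindex_op X \<tau> h) = (\<Sum>\<^sub>\<infinity>x\<in>X. f x * cnj (reindex_op X \<tau> h x))"
    by (simp add: ell2_inner_def)
  also have "\<dots> = (\<Sum>\<^sub>\<infinity>x\<in>X. f (\<sigma> x) * cnj (reindex_op X \<tau> h (\<sigma> x)))"
    by (rule infsum_reindex_bij_betw[OF \<sigma>, symmetric])
  also have "\<dots> = (\<Sum>\<^sub>\<infinity>x\<in>X. reindex_op X \<sigma> f x * cnj (h x))"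
    by (rule infsum_cong) (use bij_betwE[OF \<sigma>] in \<open>simp add: reindex_op_apply fh \<tau>\<close>)
  finally show "ell2_inner X (reindex_op X \<sigma> f) h = ell2_inner X f (reindex_op X \<tau> h)"
    by (simp add: ell2_inner_def)
qed

text \<open>The projection onto the functions supported in A. Commuting with it is how the support
  of the elements of \<open>group_vna G H\<close> is controlled.\<close>

definition restrict_op :: "'a set \<Rightarrow> 'a set \<Rightarrow> 'a operator" where
  "restrict_op X A = (\<lambda>f. if f \<in> ell2 X then trunc A f else 0)"

lemma restrict_op_bounded: "restrict_op X A \<in> bounded_ops X"
proof (rule bounded_opsI[where K = 1])
  fix f assume f: "f \<in> ell2 X"
  have "(\<Sum>x\<in>F. (cmod (trunc A f x))\<^sup>2) \<le> (ell2_norm X f)\<^sup>2" if F: "finite F" "F \<subseteq> X" for F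
    by (rule order_trans[OF sum_mono ell2_finite_sum_le[OF f F]]) (simp add: trunc_def)
  then show "ell2_norm X (restrict_op X A f) \<le> 1 * ell2_norm X f"
    by (simp add: restrict_op_def f trunc_ell2 ell2_norm_le)
qed (auto simp: restrict_op_def ell2_add ell2_scale trunc_ell2, auto simp: trunc_def fun_eq_iff)

lemma restrict_op_adjoint: "adjoint_pair X (restrict_op X A) (restrict_op X A)"
  unfolding adjoint_pair_def ell2_inner_def
  by (auto simp: restrict_op_def trunc_def intro!: infsum_cong)

section \<open>Left and right regular representations\<close>

definition rtrans :: "('a, 'b) monoid_scheme \<Rightarrow> 'a \<Rightarrow> 'a operator" where
  "rtrans G g = reindex_op (carrier G) (\<lambda>x. x \<otimes>\<^bsub>G\<^esub> g)"

text \<open>The commutant of the right regular representation, which is the full group von Neumann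
  algebra. In this form its elements are recognized by commutation, and they turn out to be the left
  convolutions by \<open>T (ket \<one>)\<close>.\<close>

definition left_ops :: "('a, 'b) monoid_scheme \<Rightarrow> 'a operator set" where
  "left_ops G = commutant (carrier G) (rtrans G ` carrier G)"

lemma canonical_unitary_reindex:
  "canonical_unitary G g = reindex_op (carrier G) (\<lambda>x. inv\<^bsub>G\<^esub> g \<otimes>\<^bsub>G\<^esub> x)"
  by (simp add: canonical_unitary_def reindex_op_def)

context group
begin

lemma bij_left: "g \<in> carrier G \<Longrightarrow> bij_betw (\<lambda>x. g \<otimes> x) (carrier G) (carrier G)"
  by (rule bij_betw_byWitness[where f' = "\<lambda>x. inv g \<otimes> x"]) (auto simp: m_assoc[symmetric])

lemma bij_right: "g \<in> carrier G \<Longrightarrow> bij_betw (\<lambda>x. x \<otimes> g) (carrier G) (carrier G)"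
  by (rule bij_betw_byWitness[where f' = "\<lambda>x. x \<otimes> inv g"]) (auto simp: m_assoc)

lemma bij_inv_mult: "y \<in> carrier G \<Longrightarrow> bij_betw (\<lambda>x. inv x \<otimes> y) (carrier G) (carrier G)"
  by (rule bij_betw_byWitness[where f' = "\<lambda>x. y \<otimes> inv x"])
     (auto simp: m_assoc inv_mult_group, auto simp: m_assoc[symmetric])

lemma canonical_unitary_bounded:
  "g \<in> carrier G \<Longrightarrow> canonical_unitary G g \<in> bounded_ops (carrier G)"
  by (simp add: canonical_unitary_reindex reindex_op_bounded bij_left)

lemma canonical_unitary_apply:
  "f \<in> ell2 (carrier G) \<Longrightarrow> x \<in> carrier G \<Longrightarrow> canonical_unitary G g f x = f (inv g \<otimes> x)"
  by (simp add: canonical_unitary_def)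

lemma canonical_unitary_adjoint:
  "g \<in> carrier G \<Longrightarrow>
    adjoint_pair (carrier G) (canonical_unitary G (inv g)) (canonical_unitary G g)"
  unfolding canonical_unitary_reindex
  by (rule reindex_op_adjoint) (auto simp: bij_left m_assoc[symmetric])

lemma rtrans_bounded: "g \<in> carrier G \<Longrightarrow> rtrans G g \<in> bounded_ops (carrier G)"
  by (simp add: rtrans_def reindex_op_bounded bij_right)

lemma rtrans_apply:
  "f \<in> ell2 (carrier G) \<Longrightarrow> x \<in> carrier G \<Longrightarrow> rtrans G g f x = f (x \<otimes> g)"
  by (simp add: rtrans_def reindex_op_apply)

lemma rtrans_adjoint:
  "g \<in> carrier G \<Longrightarrow> adjoint_pair (carrier G) (rtrans G (inv g)) (rtrans G g)"
  unfolding rtrans_def by (rule reindex_op_adjoint) (auto simp: bij_right m_assoc)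

lemma rtrans_ket:
  assumes "g \<in> carrier G" "x \<in> carrier G"
  shows "rtrans G g (ket x) = ket (x \<otimes> inv g)"
proof (rule ell2_eqI[of _ "carrier G"])
  show "rtrans G g (ket x) \<in> ell2 (carrier G)"
    using bounded_ops_ell2[OF rtrans_bounded[OF assms(1)]] .
  fix y assume y: "y \<in> carrier G"
  then have "y \<otimes> g = x \<longleftrightarrow> y = x \<otimes> inv g"
    using assms by (metis inv_solve_right)
  then show "rtrans G g (ket x) y = ket (x \<otimes> inv g) y"
    using assms y by (simp add: rtrans_apply) (simp add: ket_def)
qed (use assms in simp)

lemma canonical_unitary_ket:
  assumes "g \<in> carrier G" "x \<in> carrier G"
  shows "canonical_unitary G g (ket x) = ket (g \<otimes> x)"
proof (rule ell2_eqI[of _ "carrier G"])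
  show "canonical_unitary G g (ket x) \<in> ell2 (carrier G)"
    using bounded_ops_ell2[OF canonical_unitary_bounded[OF assms(1)]] .
  fix y assume y: "y \<in> carrier G"
  then have "inv g \<otimes> y = x \<longleftrightarrow> y = g \<otimes> x"
    using assms by (metis inv_solve_left)
  then show "canonical_unitary G g (ket x) y = ket (g \<otimes> x) y"
    using assms y by (simp add: canonical_unitary_apply) (simp add: ket_def)
qed (use assms in simp)

lemma canonical_unitary_left_ops:
  assumes g: "g \<in> carrier G"
  shows "canonical_unitary G g \<in> left_ops G"
  unfolding left_ops_def
proof (rule commutantI[OF canonical_unitary_bounded[OF g]])
  fix S f assume "S \<in> rtrans G ` carrier G"
  then obtain h where h: "h \<in> carrier G" "S = rtrans G h" by auto
  note b = canonical_unitary_bounded[OF g] rtrans_bounded[OF h(1)]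
  show "S (canonical_unitary G g f) = canonical_unitary G g (S f)"
    unfolding h(2)
  proof (rule bounded_ops_commute_ext[OF b(2,1)], rule ell2_eqI[of _ "carrier G"])
    fix x assume "f \<in> ell2 (carrier G)" "x \<in> carrier G"
    then show "rtrans G h (canonical_unitary G g f) x = canonical_unitary G g (rtrans G h f) x"
      using g h b by (simp add: bounded_ops_ell2 rtrans_apply canonical_unitary_apply m_assoc)
  qed (use b bounded_ops_ell2 in blast)+
qed

lemma left_ops_bounded: "T \<in> left_ops G \<Longrightarrow> T \<in> bounded_ops (carrier G)"
  unfolding left_ops_def by (rule commutantD(1))

lemma left_ops_ket:
  assumes T: "T \<in> left_ops G" and w: "w \<in> carrier G"
  shows "T (ket w) = rtrans G (inv w) (T (ket \<one>))"
proof -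
  have "rtrans G (inv w) (T (ket \<one>)) = T (rtrans G (inv w) (ket \<one>))"
    using T w unfolding left_ops_def by (intro commutantD(2)) auto
  then show ?thesis using w by (simp add: rtrans_ket)
qed

lemma left_ops_eqI:
  assumes S: "S \<in> left_ops G" and T: "T \<in> left_ops G" and eq: "S (ket \<one>) = T (ket \<one>)"
  shows "S = T"
proof (rule bounded_ops_eqI[OF left_ops_bounded[OF S] left_ops_bounded[OF T]])
  fix x assume "x \<in> carrier G"
  then show "S (ket x) = T (ket x)"
    by (subst left_ops_ket[OF S], assumption, subst left_ops_ket[OF T], assumption) (simp add: eq)
qed

text \<open>Pairing t with this function gives the value at y of the convolution t * f; the
  conjugate undoes the one in \<open>ell2_inner\<close>.\<close>

definition conv_kernel :: "('a \<Rightarrow> complex) \<Rightarrow> 'a \<Rightarrow> 'a \<Rightarrow> complex" where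
  "conv_kernel f y = (\<lambda>z. if z \<in> carrier G then cnj (f (inv z \<otimes> y)) else 0)"

lemma conv_kernel_ell2:
  assumes f: "f \<in> ell2 (carrier G)" and y: "y \<in> carrier G"
  shows "conv_kernel f y \<in> ell2 (carrier G)"
proof -
  have "(\<lambda>x. cnj (f x)) \<in> ell2 (carrier G)" using f by (auto simp: ell2_def)
  then show ?thesis
    by (rule ell2_comp_inj[OF _ bij_inv_mult[OF y]]) (auto simp: conv_kernel_def)
qed

text \<open>Expand f in basis vectors, move each \<open>T (ket x)\<close> back to
  \<open>T (ket \<one>)\<close> by a right translation, and substitute x = z^-1 y.\<close>

lemma left_ops_convolution:
  assumes T: "T \<in> left_ops G" and f: "f \<in> ell2 (carrier G)" and y: "y \<in> carrier G"
  shows "T f y = ell2_inner (carrier G) (T (ket \<one>)) (conv_kernel f y)"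
proof -
  let ?X = "carrier G" and ?t = "T (ket \<one>)"
  note Tb = left_ops_bounded[OF T]
  have "T f y = (\<Sum>\<^sub>\<infinity>x\<in>?X. f x * T (ket x) y)" by (rule bounded_ops_matrix[OF Tb f])
  also have "\<dots> = (\<Sum>\<^sub>\<infinity>x\<in>?X. f x * ?t (y \<otimes> inv x))"
  proof (rule infsum_cong)
    fix x assume x: "x \<in> ?X"
    show "f x * T (ket x) y = f x * ?t (y \<otimes> inv x)"
      by (subst left_ops_ket[OF T x]) (simp add: rtrans_apply y bounded_ops_ell2[OF Tb])
  qed
  also have "\<dots> = (\<Sum>\<^sub>\<infinity>z\<in>?X. f (inv z \<otimes> y) * ?t (y \<otimes> inv (inv z \<otimes> y)))"
    by (rule infsum_reindex_bij_betw[OF bij_inv_mult[OF y], symmetric])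
  also have "\<dots> = (\<Sum>\<^sub>\<infinity>z\<in>?X. ?t z * cnj (conv_kernel f y z))"
    by (rule infsum_cong)
       (simp add: conv_kernel_def inv_mult_group m_assoc[symmetric] y)
  finally show ?thesis by (simp add: ell2_inner_def)
qed

text \<open>
  For \<open>T\<close> in the left algebra, both \<open>S (T (ket w)) y\<close> and \<open>T (S (ket w)) y\<close> are continuous
  functionals of the single vector \<open>T (ket \<one>)\<close>. This replaces the commutation theorem for
  tracial von Neumann algebras.
\<close>

lemma commuting_closed_subspace:
  assumes S: "S \<in> bounded_ops (carrier G)"
  shows "\<exists>C. closed_subspace (carrier G) C \<and>
    (\<forall>T\<in>left_ops G. T (ket \<one>) \<in> C \<longleftrightarrow> S \<circ> T = T \<circ> S)"
proof -
  let ?X = "carrier G"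
  obtain S' where S': "S' \<in> bounded_ops ?X" "adjoint_pair ?X S' S"
    using adjoint_exists[OF S] by blast
  note SX = bounded_ops_ell2[OF S] and S'X = bounded_ops_ell2[OF S'(1)]
  \<comment> \<open>\<open>h1 w y\<close> represents \<open>T (S (ket w)) y\<close> through the
    convolution formula, \<open>h2 w y\<close> represents \<open>S (T (ket w)) y\<close> through the
    adjoint of S.\<close>
  define h1 where "h1 w y = conv_kernel (S (ket w)) y" for w y
  define h2 where "h2 w y = rtrans G w (S' (ket y))" for w y
  have h: "h1 w y \<in> ell2 ?X" "h2 w y \<in> ell2 ?X" if "w \<in> ?X" "y \<in> ?X" for w y
    using that by (simp_all add: h1_def h2_def conv_kernel_ell2 SX bounded_ops_ell2[OF rtrans_bounded])
  define A where "A = {h1 w y - h2 w y | w y. w \<in> ?X \<and> y \<in> ?X}"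
  have key: "ell2_inner ?X (T (ket \<one>)) (h1 w y - h2 w y) = T (S (ket w)) y - S (T (ket w)) y"
    if T: "T \<in> left_ops G" and wy: "w \<in> ?X" "y \<in> ?X" for T w y
  proof -
    note TX = bounded_ops_ell2[OF left_ops_bounded[OF T]]
    have "S (T (ket w)) y = ell2_inner ?X (S (T (ket w))) (ket y)"
      using wy by (simp add: ell2_inner_ket)
    also have "\<dots> = ell2_inner ?X (rtrans G (inv w) (T (ket \<one>))) (S' (ket y))"
      using adjoint_pairD[OF S'(2) TX] wy
      by (subst left_ops_ket[OF T wy(1), symmetric]) simp
    also have "\<dots> = ell2_inner ?X (T (ket \<one>)) (rtrans G (inv (inv w)) (S' (ket y)))"
      by (rule adjoint_pairD[OF rtrans_adjoint TX S'X]) (use wy in simp)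
    finally have "S (T (ket w)) y = ell2_inner ?X (T (ket \<one>)) (h2 w y)"
      using wy by (simp add: h2_def)
    moreover have "T (S (ket w)) y = ell2_inner ?X (T (ket \<one>)) (h1 w y)"
      unfolding h1_def by (rule left_ops_convolution[OF T SX wy(2)])
    ultimately show ?thesis
      using ell2_inner_diff_right[OF h[OF wy] TX] by simp
  qed
  have "T (ket \<one>) \<in> {f \<in> ell2 ?X. \<forall>a\<in>A. ell2_inner ?X f a = 0} \<longleftrightarrow> S \<circ> T = T \<circ> S"
    if T: "T \<in> left_ops G" for T
  proof -
    note Tb = left_ops_bounded[OF T]
    have "S \<circ> T = T \<circ> S \<longleftrightarrow> (\<forall>w\<in>?X. \<forall>y\<in>?X. T (S (ket w)) y = S (T (ket w)) y)"
    proof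
      assume *: "\<forall>w\<in>?X. \<forall>y\<in>?X. T (S (ket w)) y = S (T (ket w)) y"
      show "S \<circ> T = T \<circ> S"
      proof (rule bounded_ops_eqI[OF bounded_ops_comp[OF S Tb] bounded_ops_comp[OF Tb S]])
        fix w assume w: "w \<in> ?X"
        show "(S \<circ> T) (ket w) = (T \<circ> S) (ket w)"
          by (rule ell2_eqI[of _ ?X])
             (use * w in \<open>simp_all add: SX bounded_ops_ell2[OF Tb]\<close>)
      qed
    qed (metis comp_apply)
    also have "\<dots> \<longleftrightarrow> (\<forall>a\<in>A. ell2_inner ?X (T (ket \<one>)) a = 0)"
      unfolding A_def using key[OF T] by (auto simp del: minus_apply) (metis right_minus_eq)
    finally show ?thesis using bounded_ops_ell2[OF Tb] by simp
  qed
  moreover have "closed_subspace ?X {f \<in> ell2 ?X. \<forall>a\<in>A. ell2_inner ?X f a = 0}"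
    by (rule closed_subspace_orthogonal) (auto simp: A_def intro: ell2_diff h)
  ultimately show ?thesis by blast
qed

text \<open>Fix S in the commutant. Commuting with S is a closed linear condition on the vector of
  T, by \<open>commuting_closed_subspace\<close>, and it holds for the vectors of P; so it passes to
  T.\<close>

lemma double_commutantI:
  assumes P: "P \<subseteq> left_ops G" and T: "T \<in> left_ops G"
    and cl: "\<And>C. closed_subspace (carrier G) C \<Longrightarrow> (\<lambda>S. S (ket \<one>)) ` P \<subseteq> C \<Longrightarrow> T (ket \<one>) \<in> C"
  shows "T \<in> commutant (carrier G) (commutant (carrier G) P)"
proof (rule commutantI[OF left_ops_bounded[OF T]])
  fix S f assume S: "S \<in> commutant (carrier G) P"
  obtain C where C: "closed_subspace (carrier G) C"
    "\<And>T. T \<in> left_ops G \<Longrightarrow> T (ket \<one>) \<in> C \<longleftrightarrow> S \<circ> T = T \<circ> S"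
    using commuting_closed_subspace[OF commutantD(1)[OF S]] by blast
  have "(\<lambda>S. S (ket \<one>)) ` P \<subseteq> C"
    using C(2) P S by (fastforce simp: commutant_def)
  then have "S \<circ> T = T \<circ> S" using cl[OF C(1)] C(2)[OF T] by blast
  then show "S (T f) = T (S f)" by (metis comp_apply)
qed

text \<open>P is recovered from the closure of its vectors: this is the way back from the Hilbert
  space to operators.\<close>

lemma von_neumann_algebra_memI:
  assumes P: "von_neumann_algebra (carrier G) P" "P \<subseteq> left_ops G" and T: "T \<in> left_ops G"
    and cl: "T (ket \<one>) \<in> ell2_closure (carrier G) ((\<lambda>S. S (ket \<one>)) ` P)"
  shows "T \<in> P"
proof -
  have "T \<in> commutant (carrier G) (commutant (carrier G) P)"
    by (rule double_commutantI[OF P(2) T]) (use cl ell2_closure_minimal in blast)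
  then show ?thesis using von_neumann_algebraD(3)[OF P(1)] by simp
qed

text \<open>Each \<open>ket h\<close> is the vector of the unitary of h, and a vector supported on H
  is a limit of combinations of these.\<close>

lemma group_vna_memI:
  assumes H: "H \<subseteq> carrier G" and T: "T \<in> left_ops G"
    and supp: "\<And>x. x \<in> carrier G \<Longrightarrow> x \<notin> H \<Longrightarrow> T (ket \<one>) x = 0"
  shows "T \<in> group_vna G H"
  unfolding group_vna_def
proof (rule generated_vnaI)
  fix M assume M: "von_neumann_algebra (carrier G) M" "canonical_unitary G ` H \<subseteq> M"
  have "T \<in> commutant (carrier G) (commutant (carrier G) (canonical_unitary G ` H))"
  proof (rule double_commutantI[OF _ T])
    show "canonical_unitary G ` H \<subseteq> left_ops G" using canonical_unitary_left_ops H by blast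
    fix C assume C: "closed_subspace (carrier G) C"
      "(\<lambda>S. S (ket \<one>)) ` canonical_unitary G ` H \<subseteq> C"
    have "ket h \<in> C" if "h \<in> H" for h
    proof -
      have "canonical_unitary G h (ket \<one>) \<in> C" using C(2) that by auto
      then show ?thesis using canonical_unitary_ket[of h \<one>] that H by auto
    qed
    then show "T (ket \<one>) \<in> C"
      using closed_subspace_ket[OF C(1) bounded_ops_ell2[OF left_ops_bounded[OF T]]] supp by blast
  qed
  then show "T \<in> M"
    using commutant_antimono[OF commutant_antimono[OF M(2)]] von_neumann_algebraD(3)[OF M(1)] by blast
qed

text \<open>The right translations together with the projection onto functions supported on H form a
  self-adjoint set commuting with the unitaries of H, so its commutant contains
  \<open>group_vna G H\<close>. The projection fixes \<open>ket \<one>\<close>, which confines the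
  vector of T to H.\<close>

lemma group_vna_support:
  assumes H: "subgroup H G" and T: "T \<in> group_vna G H"
  shows "T \<in> left_ops G" "\<And>x. x \<notin> H \<Longrightarrow> T (ket \<one>) x = 0"
proof -
  let ?X = "carrier G"
  let ?R = "rtrans G ` ?X \<union> {restrict_op ?X H}"
  have HX: "H \<subseteq> ?X" using subgroup.subset[OF H] .
  have vna: "von_neumann_algebra ?X (commutant ?X ?R)"
  proof (rule von_neumann_algebra_commutant)
    fix T assume "T \<in> ?R"
    then show "\<exists>S\<in>?R. adjoint_pair ?X S T"
      using rtrans_adjoint restrict_op_adjoint[of ?X H] by auto
  qed (auto simp: rtrans_bounded restrict_op_bounded)
  have "canonical_unitary G h \<in> commutant ?X ?R" if h: "h \<in> H" for h
  proof (rule commutantI)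
    have hX: "h \<in> ?X" using h HX by blast
    show "canonical_unitary G h \<in> bounded_ops ?X" using canonical_unitary_bounded[OF hX] .
    fix S f assume "S \<in> ?R"
    then consider "S \<in> rtrans G ` ?X" | "S = restrict_op ?X H" by auto
    then show "S (canonical_unitary G h f) = canonical_unitary G h (S f)"
    proof cases
      case 1
      then show ?thesis
        using canonical_unitary_left_ops[OF hX] unfolding left_ops_def by (rule commutantD(2)[rotated])
    next
      case 2
      note b = canonical_unitary_bounded[OF hX] restrict_op_bounded[of ?X H]
      show ?thesis unfolding 2
      proof (rule bounded_ops_commute_ext[OF b(2,1)], rule ell2_eqI[of _ ?X])
        fix x assume f: "f \<in> ell2 ?X" and x: "x \<in> ?X"
        have "inv h \<otimes> x \<in> H \<longleftrightarrow> x \<in> H"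
          using H h x hX
          by (metis inv_closed l_one m_assoc r_inv subgroup.m_closed subgroup.m_inv_closed)
        then show "restrict_op ?X H (canonical_unitary G h f) x
            = canonical_unitary G h (restrict_op ?X H f) x"
          using f x hX bounded_ops_ell2[OF b(1)] bounded_ops_ell2[OF b(2)]
          by (simp add: restrict_op_def trunc_def canonical_unitary_apply trunc_ell2[unfolded trunc_def])
      qed (use b bounded_ops_ell2 in blast)+
    qed
  qed
  then have T': "T \<in> commutant ?X ?R"
    using T generated_vna_minimal[OF vna] unfolding group_vna_def by blast
  show "T \<in> left_ops G"
    using T' commutant_antimono[of "rtrans G ` ?X" ?R] unfolding left_ops_def by blast
  show "T (ket \<one>) x = 0" if "x \<notin> H" for x
  proof -
    have one: "restrict_op ?X H (ket \<one>) = ket \<one>"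
      using subgroup.one_closed[OF H] by (auto simp: restrict_op_def trunc_def ket_def fun_eq_iff ket_ell2[unfolded ket_def])
    have "T (ket \<one>) x = restrict_op ?X H (T (ket \<one>)) x"
      using commutantD(2)[OF T', of "restrict_op ?X H" "ket \<one>"] one by simp
    also have "\<dots> = 0"
      using that bounded_ops_ell2[OF commutantD(1)[OF T']] by (simp add: restrict_op_def trunc_def)
    finally show ?thesis .
  qed
qed

end

section \<open>Intermediate algebras and reproducing kernels\<close>

text \<open>K stands for the acting group and c for -id; \<eta> selects an eigenspace of the unitary
  of c. The evenness of A enters as \<open>comm_c\<close>.\<close>

locale intermediate_algebra = group G for G (structure) +
  fixes K :: "'a set" and c :: 'a and P :: "'a operator set" and \<eta> :: complex
  assumes K: "subgroup K G" and c: "c \<in> K" "c \<otimes> c = \<one>"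
    and vna: "von_neumann_algebra (carrier G) P" and left: "P \<subseteq> left_ops G"
    and comm_c: "\<And>T f. T \<in> P \<Longrightarrow> canonical_unitary G c (T f) = T (canonical_unitary G c f)"
    and unitaries: "\<And>g. g \<in> K \<Longrightarrow> canonical_unitary G g \<in> P"
    and \<eta>: "\<eta> = 1 \<or> \<eta> = - 1"
begin

section \<open>The Hilbert space of one corner\<close>

abbreviation X where "X \<equiv> carrier G"

definition HP :: "('a \<Rightarrow> complex) set" where
  "HP = ell2_closure X ((\<lambda>T. T (ket \<one>)) ` P)"

text \<open>The \<eta>-eigenspace of the unitary of c in \<open>HP\<close>, since c is its own
  inverse.\<close>

definition H :: "('a \<Rightarrow> complex) set" where
  "H = {f \<in> HP. \<forall>x\<in>X. f (c \<otimes> x) = \<eta> * f x}"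

lemma KX: "g \<in> K \<Longrightarrow> g \<in> X"
  using subgroup.subset[OF K] by blast

lemma cX [simp]: "c \<in> X"
  using KX c by blast

lemma inv_c [simp]: "inv c = c"
  using c by (simp add: inv_equality)

lemma c_cancel [simp]: "x \<in> X \<Longrightarrow> c \<otimes> (c \<otimes> x) = x" "x \<in> X \<Longrightarrow> x \<otimes> c \<otimes> c = x"
  using c(2) by (simp_all add: m_assoc m_assoc[symmetric])

lemma \<eta>_simps [simp]: "\<eta> * \<eta> = 1" "cnj \<eta> = \<eta>" "\<eta> * (\<eta> * a) = a"
  using \<eta> by auto

lemma P_bounded: "T \<in> P \<Longrightarrow> T \<in> bounded_ops X"
  using von_neumann_algebraD(1)[OF vna] by blast

lemma P_ell2: "T \<in> P \<Longrightarrow> T f \<in> ell2 X"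
  using P_bounded bounded_ops_ell2 by blast

lemma P_ket_ell2: "(\<lambda>T. T (ket \<one>)) ` P \<subseteq> ell2 X"
  using P_ell2 by blast

lemma closed_HP: "closed_subspace X HP"
  unfolding HP_def
proof (rule closed_subspace_closure[OF P_ket_ell2])
  note id = unitaries[OF subgroup.one_closed[OF K]]
  show "0 \<in> (\<lambda>T. T (ket \<one>)) ` P"
    by (rule image_eqI[OF _ von_neumann_algebra_closed(3)[OF vna id id, of 0]]) auto
  show "f + h \<in> (\<lambda>T. T (ket \<one>)) ` P"
    if fh: "f \<in> (\<lambda>T. T (ket \<one>)) ` P" "h \<in> (\<lambda>T. T (ket \<one>)) ` P" for f h
  proof -
    obtain S T where "S \<in> P" "T \<in> P" "f = S (ket \<one>)" "h = T (ket \<one>)" using fh by auto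
    then show ?thesis
      by (intro image_eqI[OF _ von_neumann_algebra_closed(2)[OF vna, of S T]]) auto
  qed
  show "(\<lambda>x. a * f x) \<in> (\<lambda>T. T (ket \<one>)) ` P" if f: "f \<in> (\<lambda>T. T (ket \<one>)) ` P" for a f
  proof -
    obtain T where "T \<in> P" "f = T (ket \<one>)" using f by auto
    then show ?thesis
      by (intro image_eqI[OF _ von_neumann_algebra_closed(3)[OF vna, of T T a]]) auto
  qed
qed

lemma HP_ell2: "f \<in> HP \<Longrightarrow> f \<in> ell2 X"
  using closed_subspaceD(1)[OF closed_HP] by blast

lemma P_HP: "T \<in> P \<Longrightarrow> T (ket \<one>) \<in> HP"
  unfolding HP_def using ell2_closure_subset[OF P_ket_ell2] by blast

lemma H_HP: "f \<in> H \<Longrightarrow> f \<in> HP" and H_ell2: "f \<in> H \<Longrightarrow> f \<in> ell2 X"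
  by (simp_all add: H_def HP_ell2)

text \<open>Pairing with \<open>a - b\<close> is continuous and vanishes on the vectors of P, hence
  on their closure.\<close>

lemma HP_orthogonal:
  assumes f: "f \<in> HP" and a: "a \<in> ell2 X" "b \<in> ell2 X"
    and eq: "\<And>T. T \<in> P \<Longrightarrow> ell2_inner X (T (ket \<one>)) a = ell2_inner X (T (ket \<one>)) b"
  shows "ell2_inner X f a = ell2_inner X f b"
proof -
  have "HP \<subseteq> {f \<in> ell2 X. \<forall>d\<in>{a - b}. ell2_inner X f d = 0}"
    unfolding HP_def
    by (intro ell2_closure_minimal closed_subspace_orthogonal)
       (use a eq P_ell2 in \<open>auto simp only: ell2_inner_diff_right ell2_diff mem_Collect_eq subset_iff
          singleton_iff image_iff diff_self\<close>)
  then show ?thesis using f a by (auto simp: subset_iff ell2_inner_diff_right simp del: minus_apply)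
qed

lemma closed_H: "closed_subspace X H"
proof -
  \<comment> \<open>The eigenvalue equation at x is orthogonality to one vector, so closedness comes
    from \<open>closed_subspace_orthogonal\<close>.\<close>
  let ?A = "{ket (c \<otimes> x) - (\<lambda>z. \<eta> * ket x z) | x. x \<in> X}"
  have A: "?A \<subseteq> ell2 X" by (auto intro!: ell2_diff ell2_scale)
  have "f (c \<otimes> x) = \<eta> * f x \<longleftrightarrow> ell2_inner X f (ket (c \<otimes> x) - (\<lambda>z. \<eta> * ket x z)) = 0"
    if "f \<in> ell2 X" "x \<in> X" for f x
    using that by (subst ell2_inner_diff_right)
      (simp_all add: ell2_scale ell2_inner_ket ell2_inner_scale_right)
  then have "H = HP \<inter> {f \<in> ell2 X. \<forall>a\<in>?A. ell2_inner X f a = 0}"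
    using HP_ell2 by (auto simp: H_def simp del: minus_apply)
  then show ?thesis using closed_subspace_Int[OF closed_HP closed_subspace_orthogonal[OF A]] by simp
qed

lemma op_HP:
  assumes S: "S \<in> bounded_ops X" and SP: "\<And>T. T \<in> P \<Longrightarrow> \<exists>T'\<in>P. S (T (ket \<one>)) = T' (ket \<one>)" and f: "f \<in> HP"
  shows "S f \<in> HP"
  using f unfolding HP_def by (rule ell2_closure_op[OF S P_ket_ell2, rotated]) (use SP in auto)

lemma P_invariant:
  assumes T: "T \<in> P" and f: "f \<in> HP"
  shows "T f \<in> HP"
proof (rule op_HP[OF P_bounded[OF T] _ f])
  fix S assume "S \<in> P"
  then show "\<exists>T'\<in>P. T (S (ket \<one>)) = T' (ket \<one>)"
    using von_neumann_algebra_closed(1)[OF vna T] by (intro bexI[of _ "T \<circ> S"]) auto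
qed

lemma rtrans_P:
  assumes g: "g \<in> X" and T: "T \<in> P"
  shows "rtrans G g (T f) = T (rtrans G g f)"
  using left T g unfolding left_ops_def by (intro commutantD(2)) auto

text \<open>Right translation by g turns the vector of T into the vector of T composed with the
  unitary of g^-1, and that composite is in P.\<close>

lemma rtrans_HP:
  assumes g: "g \<in> K" and f: "f \<in> HP"
  shows "rtrans G g f \<in> HP"
proof (rule op_HP[OF rtrans_bounded[OF KX[OF g]] _ f])
  fix T assume T: "T \<in> P"
  have "rtrans G g (T (ket \<one>)) = (T \<circ> canonical_unitary G (inv g)) (ket \<one>)"
    using KX[OF g] by (simp add: rtrans_P T rtrans_ket canonical_unitary_ket)
  moreover have "T \<circ> canonical_unitary G (inv g) \<in> P"
    using von_neumann_algebra_closed(1)[OF vna T unitaries] subgroup.m_inv_closed[OF K g] .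
  ultimately show "\<exists>T'\<in>P. rtrans G g (T (ket \<one>)) = T' (ket \<one>)" by blast
qed

text \<open>Applied to the unit vector, one side of the commutation shifts the coefficient function
  by c on the left, the other on the right.\<close>

lemma c_commute:
  assumes T: "T \<in> left_ops G" and comm: "canonical_unitary G c (T (ket \<one>)) = T (canonical_unitary G c (ket \<one>))"
    and x: "x \<in> X"
  shows "T (ket \<one>) (x \<otimes> c) = T (ket \<one>) (c \<otimes> x)"
proof -
  have TX: "T f \<in> ell2 X" for f using bounded_ops_ell2[OF left_ops_bounded[OF T]] .
  have "T (ket \<one>) (c \<otimes> x) = canonical_unitary G c (T (ket \<one>)) x"
    using x by (simp add: canonical_unitary_apply TX)
  also have "\<dots> = T (ket c) x" unfolding comm by (simp add: canonical_unitary_ket)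
  also have "\<dots> = T (ket \<one>) (x \<otimes> c)"
    using left_ops_ket[OF T, of c] x by (simp add: rtrans_apply TX)
  finally show ?thesis by simp
qed

lemma HP_c_commute:
  assumes f: "f \<in> HP" and x: "x \<in> X"
  shows "f (x \<otimes> c) = f (c \<otimes> x)"
proof -
  have "ell2_inner X f (ket (x \<otimes> c)) = ell2_inner X f (ket (c \<otimes> x))"
    by (rule HP_orthogonal[OF f]) (use x left comm_c c_commute in \<open>auto simp: ell2_inner_ket\<close>)
  then show ?thesis using x by (simp add: ell2_inner_ket)
qed

lemma H_c: "f \<in> H \<Longrightarrow> x \<in> X \<Longrightarrow> f (c \<otimes> x) = \<eta> * f x"
  and H_c': "f \<in> H \<Longrightarrow> x \<in> X \<Longrightarrow> f (x \<otimes> c) = \<eta> * f x"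
  using HP_c_commute[of f x] by (auto simp: H_def)

lemma HI: "f \<in> HP \<Longrightarrow> (\<And>x. x \<in> X \<Longrightarrow> f (c \<otimes> x) = \<eta> * f x) \<Longrightarrow> f \<in> H"
  by (simp add: H_def)

lemma P_H:
  assumes T: "T \<in> P" and f: "f \<in> H"
  shows "T f \<in> H"
proof (rule HI[OF P_invariant[OF T H_HP[OF f]]])
  fix x assume x: "x \<in> X"
  have cf: "canonical_unitary G c f = (\<lambda>z. \<eta> * f z)"
    by (rule ell2_eqI[of _ X])
       (use f H_ell2[OF f] bounded_ops_ell2[OF canonical_unitary_bounded[OF cX]] in
       \<open>simp_all add: ell2_scale canonical_unitary_apply H_c\<close>)
  have "T f (c \<otimes> x) = canonical_unitary G c (T f) x"
    using x by (simp add: canonical_unitary_apply P_ell2 T)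
  also have "\<dots> = T (\<lambda>z. \<eta> * f z) x" by (simp add: comm_c T cf)
  also have "\<dots> = \<eta> * T f x" by (simp add: bounded_opsD(3)[OF P_bounded[OF T] H_ell2[OF f]])
  finally show "T f (c \<otimes> x) = \<eta> * T f x" .
qed

lemma rtrans_H:
  assumes g: "g \<in> K" and f: "f \<in> H"
  shows "rtrans G g f \<in> H"
  by (rule HI) (use g f KX[OF g] in \<open>simp_all add: rtrans_HP H_HP rtrans_apply H_ell2 m_assoc H_c\<close>)

text \<open>The orthogonal projection of \<open>ket x\<close> onto \<open>H\<close>, that is,
  \<zeta> for the corner selected by \<eta>; as a function of two points it is the reproducing
  kernel of \<open>H\<close>.\<close>

definition Z :: "'a \<Rightarrow> 'a \<Rightarrow> complex" where
  "Z x = (SOME z. z \<in> H \<and> (\<forall>f\<in>H. ell2_inner X f z = f x))"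

lemma Z_H: "x \<in> X \<Longrightarrow> Z x \<in> H"
  and Z_reproducing: "x \<in> X \<Longrightarrow> f \<in> H \<Longrightarrow> ell2_inner X f (Z x) = f x"
proof -
  assume x: "x \<in> X"
  obtain z where "z \<in> H \<and> (\<forall>f\<in>H. ell2_inner X f z = f x)"
    using reproducing_kernel[OF closed_H x] by blast
  then have "Z x \<in> H \<and> (\<forall>f\<in>H. ell2_inner X f (Z x) = f x)"
    unfolding Z_def by (rule someI[where P = "\<lambda>z. z \<in> H \<and> (\<forall>f\<in>H. ell2_inner X f z = f x)"])
  then show "Z x \<in> H" "f \<in> H \<Longrightarrow> ell2_inner X f (Z x) = f x" by auto
qed

lemma Z_ell2: "x \<in> X \<Longrightarrow> Z x \<in> ell2 X"
  using Z_H H_ell2 by blast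

lemma Z_herm:
  assumes "x \<in> X" "y \<in> X"
  shows "Z x y = cnj (Z y x)"
  using Z_reproducing[OF assms(2) Z_H[OF assms(1)]] Z_reproducing[OF assms(1) Z_H[OF assms(2)]]
    ell2_inner_cnj[of X "Z y" "Z x"] by simp

lemma Z_c: "x \<in> X \<Longrightarrow> y \<in> X \<Longrightarrow> Z x (c \<otimes> y) = \<eta> * Z x y"
  and Z_c': "x \<in> X \<Longrightarrow> y \<in> X \<Longrightarrow> Z x (y \<otimes> c) = \<eta> * Z x y"
  using H_c H_c' Z_H by auto

text \<open>\<open>H\<close> is invariant under the unitary of g and under its adjoint, so
  projecting onto \<open>H\<close> commutes with left multiplication by g.\<close>

lemma Z_left:
  assumes g: "g \<in> K" and x: "x \<in> X" and y: "y \<in> X"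
  shows "Z (g \<otimes> x) (g \<otimes> y) = Z x y"
proof -
  note gX = KX[OF g] and gi = subgroup.m_inv_closed[OF K g]
  have "Z (g \<otimes> x) (g \<otimes> y) = canonical_unitary G (inv g) (Z (g \<otimes> x)) y"
    using gX x y by (simp add: canonical_unitary_apply Z_ell2)
  also have "\<dots> = ell2_inner X (canonical_unitary G (inv g) (Z (g \<otimes> x))) (Z y)"
    using gX x y by (simp add: Z_reproducing P_H unitaries gi Z_H)
  also have "\<dots> = ell2_inner X (Z (g \<otimes> x)) (canonical_unitary G (inv (inv g)) (Z y))"
    by (rule adjoint_pairD[OF canonical_unitary_adjoint]) (use gX x y in \<open>simp_all add: Z_ell2\<close>)
  also have "\<dots> = cnj (ell2_inner X (canonical_unitary G g (Z y)) (Z (g \<otimes> x)))"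
    using gX by (simp add: ell2_inner_cnj)
  also have "\<dots> = cnj (canonical_unitary G g (Z y) (g \<otimes> x))"
    using gX x y by (simp add: Z_reproducing P_H unitaries g Z_H)
  also have "\<dots> = cnj (Z y x)"
    using gX x y by (simp add: canonical_unitary_apply Z_ell2 m_assoc[symmetric])
  finally show ?thesis using Z_herm[OF x y] by simp
qed

lemma Z_right:
  assumes g: "g \<in> K" and x: "x \<in> X" and y: "y \<in> X"
  shows "Z (x \<otimes> g) (y \<otimes> g) = Z x y"
proof -
  note gX = KX[OF g] and gi = subgroup.m_inv_closed[OF K g]
  have "Z (x \<otimes> g) (y \<otimes> g) = rtrans G g (Z (x \<otimes> g)) y"
    using gX x y by (simp add: rtrans_apply Z_ell2)
  also have "\<dots> = ell2_inner X (rtrans G g (Z (x \<otimes> g))) (Z y)"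
    using gX x y by (simp add: Z_reproducing rtrans_H g Z_H)
  also have "\<dots> = ell2_inner X (Z (x \<otimes> g)) (rtrans G (inv g) (Z y))"
    by (rule adjoint_pairD[OF rtrans_adjoint]) (use gX x y in \<open>simp_all add: Z_ell2\<close>)
  also have "\<dots> = cnj (ell2_inner X (rtrans G (inv g) (Z y)) (Z (x \<otimes> g)))"
    using gX by (simp add: ell2_inner_cnj)
  also have "\<dots> = cnj (rtrans G (inv g) (Z y) (x \<otimes> g))"
    using gX x y by (simp add: Z_reproducing rtrans_H gi Z_H)
  also have "\<dots> = cnj (Z y x)"
    using gX x y by (simp add: rtrans_apply Z_ell2 m_assoc)
  finally show ?thesis using Z_herm[OF x y] by simp
qed

text \<open>This is twice the component of \<open>ket g\<close> in the \<eta>-eigenspace of the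
  unitary of c; \<open>ket g\<close> is in \<open>HP\<close> because the unitary of g is in
  P.\<close>

lemma ket_sum_H:
  assumes g: "g \<in> K"
  shows "ket g + (\<lambda>z. \<eta> * ket (c \<otimes> g) z) \<in> H"
proof -
  have kHP: "ket k \<in> HP" if "k \<in> K" for k
    using P_HP[OF unitaries[OF that]] KX[OF that] by (simp add: canonical_unitary_ket)
  have cg: "c \<otimes> g \<in> K" using subgroup.m_closed[OF K c(1) g] .
  have "ket g + (\<lambda>z. \<eta> * ket (c \<otimes> g) z) \<in> HP"
    using closed_subspaceD(3,4)[OF closed_HP] kHP[OF g] kHP[OF cg] by blast
  then show ?thesis
  proof (rule HI)
    fix x assume x: "x \<in> X"
    have "c \<otimes> x = g \<longleftrightarrow> x = c \<otimes> g" "c \<otimes> x = c \<otimes> g \<longleftrightarrow> x = g"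
      using x KX[OF g] c_cancel by (metis, metis)
    then show "(ket g + (\<lambda>z. \<eta> * ket (c \<otimes> g) z)) (c \<otimes> x)
      = \<eta> * (ket g + (\<lambda>z. \<eta> * ket (c \<otimes> g) z)) x"
      by (simp add: ket_def distrib_left)
  qed
qed

lemma ell2_inner_ket_sum:
  assumes "g \<in> X" and f: "f \<in> ell2 X" "\<And>x. x \<in> X \<Longrightarrow> f (c \<otimes> x) = \<eta> * f x"
  shows "ell2_inner X (ket g + (\<lambda>z. \<eta> * ket (c \<otimes> g) z)) f = 2 * cnj (f g)"
  using assms by (subst ell2_inner_add_left)
    (simp_all add: ell2_scale ell2_inner_ket_left ell2_inner_scale_left)

text \<open>The vectors of \<open>ket_sum_H\<close> are supported on K, so they vanish at x, while
  pairing them with \<open>Z x\<close> reads off twice the conjugate of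
  \<open>Z x g\<close>.\<close>

lemma Z_K:
  assumes x: "x \<in> X" "x \<notin> K" and g: "g \<in> K"
  shows "Z x g = 0"
proof -
  have "2 * cnj (Z x g) = ell2_inner X (ket g + (\<lambda>z. \<eta> * ket (c \<otimes> g) z)) (Z x)"
    by (rule ell2_inner_ket_sum[symmetric]) (use x KX[OF g] in \<open>simp_all add: Z_ell2 Z_c\<close>)
  also have "\<dots> = (ket g + (\<lambda>z. \<eta> * ket (c \<otimes> g) z)) x"
    by (rule Z_reproducing[OF x(1) ket_sum_H[OF g]])
  also have "\<dots> = 0"
    using x g subgroup.m_closed[OF K c(1) g] by (auto simp: ket_def)
  finally show ?thesis by simp
qed

text \<open>
  Both sides are \<open>(\<zeta>\<^sub>v * \<zeta>\<^sub>w) x\<close>, computed once as a convolution and once by projecting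
  \<open>\<zeta>\<^sub>v * \<delta>\<^sub>w\<close> onto the space: this is the identity \<open>E(E(a) b) = E(a) E(b)\<close> in vector form.
\<close>

lemma Z_convolution:
  assumes v: "v \<in> X" and w: "w \<in> X" and x: "x \<in> X"
  shows "(\<Sum>\<^sub>\<infinity>z\<in>X. Z v z * Z w (inv z \<otimes> x)) = (\<Sum>\<^sub>\<infinity>z\<in>X. Z v z * cnj (Z x (z \<otimes> w)))"
proof -
  have "ell2_inner X (Z v) (conv_kernel (Z w) x) = ell2_inner X (Z v) (rtrans G w (Z x))"
  proof (rule HP_orthogonal[OF H_HP[OF Z_H[OF v]]])
    fix T assume T: "T \<in> P"
    have Tl: "T \<in> left_ops G" using left T by blast
    obtain S where S: "S \<in> P" "adjoint_pair X S T" using von_neumann_algebraD(2)[OF vna T] by blast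
    have "ell2_inner X (T (ket \<one>)) (conv_kernel (Z w) x) = T (Z w) x"
      by (rule left_ops_convolution[OF Tl Z_ell2[OF w] x, symmetric])
    also have "\<dots> = ell2_inner X (T (Z w)) (Z x)"
      by (rule Z_reproducing[OF x P_H[OF T Z_H[OF w]], symmetric])
    also have "\<dots> = ell2_inner X (Z w) (S (Z x))"
      by (rule adjoint_pairD[OF S(2) Z_ell2[OF w] Z_ell2[OF x]])
    \<comment> \<open>The adjoint S is in P, so \<open>S (Z x)\<close> is again in \<open>H\<close>;
      the reproducing property at w is what replaces \<open>Z w\<close> by
      \<open>ket w\<close>.\<close>
    also have "\<dots> = cnj (S (Z x) w)"
      using Z_reproducing[OF w P_H[OF S(1) Z_H[OF x]]] by (metis ell2_inner_cnj)
    also have "\<dots> = ell2_inner X (T (ket w)) (Z x)"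
      using adjoint_pairD[OF S(2) ket_ell2[OF w] Z_ell2[OF x]] w by (simp add: ell2_inner_ket_left)
    also have "\<dots> = ell2_inner X (T (ket \<one>)) (rtrans G (inv (inv w)) (Z x))"
      unfolding left_ops_ket[OF Tl w]
      by (rule adjoint_pairD[OF rtrans_adjoint]) (use w x in \<open>simp_all add: P_ell2 T Z_ell2\<close>)
    finally show "ell2_inner X (T (ket \<one>)) (conv_kernel (Z w) x)
        = ell2_inner X (T (ket \<one>)) (rtrans G w (Z x))" using w by simp
  qed (use w x in \<open>simp_all add: conv_kernel_ell2 Z_ell2 bounded_ops_ell2[OF rtrans_bounded]\<close>)
  then show ?thesis
    unfolding ell2_inner_def using w x
    by (simp add: conv_kernel_def rtrans_apply Z_ell2 cong: infsum_cong)
qed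

section \<open>From the kernel of a corner back to the corner of P\<close>

definition proj :: "'a operator" where
  "proj = (\<lambda>f x. (id_op X f x + \<eta> * canonical_unitary G c f x) / 2)"

lemma proj_P: "proj \<in> P"
proof -
  note cl = von_neumann_algebra_closed[OF vna unitaries[OF c(1)] unitaries[OF c(1)]]
  have "(\<lambda>f x. 1 / 2 * (id_op X + (\<lambda>f x. \<eta> * canonical_unitary G c f x)) f x) \<in> P"
    using von_neumann_algebra_closed(2,3)[OF vna] cl by blast
  then show ?thesis by (simp add: proj_def)
qed

lemma proj_apply: "f \<in> ell2 X \<Longrightarrow> x \<in> X \<Longrightarrow> proj f x = (f x + \<eta> * f (c \<otimes> x)) / 2"
  by (simp add: proj_def id_op_def canonical_unitary_apply)

lemma proj_c: "f \<in> ell2 X \<Longrightarrow> x \<in> X \<Longrightarrow> proj f (c \<otimes> x) = \<eta> * proj f x"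
  by (simp add: proj_apply distrib_left add.commute)

lemma proj_left_ops: "T \<in> left_ops G \<Longrightarrow> proj \<circ> T \<in> left_ops G"
  using left proj_P commutant_comp unfolding left_ops_def by blast

text \<open>The value at x of a vector in \<open>H\<close> is its pairing with \<open>Z x\<close>,
  so a kernel vanishing off K confines the vectors of the corner to K.\<close>

lemma proj_comp_group_vna:
  assumes Z0: "\<And>x. x \<in> X \<Longrightarrow> x \<notin> K \<Longrightarrow> Z x = 0" and T: "T \<in> P"
  shows "proj \<circ> T \<in> group_vna G K"
proof (rule group_vna_memI)
  have "proj \<circ> T \<in> P" using von_neumann_algebra_closed(1)[OF vna proj_P T] .
  from P_HP[OF this] have "(proj \<circ> T) (ket \<one>) \<in> H"
    by (rule HI) (simp only: comp_apply proj_c P_ell2 T)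
  then show "(proj \<circ> T) (ket \<one>) x = 0" if "x \<in> X" "x \<notin> K" for x
    using Z_reproducing[OF that(1)] Z0[OF that] by (metis ell2_inner_cnj ell2_inner_zero_left complex_cnj_zero)
qed (use left T proj_left_ops subgroup.subset[OF K] in auto)

text \<open>The hypothesis makes \<open>Z x\<close> as large as possible: the signed average of the
  four translates of \<open>ket x\<close> by c. Pairing with it recovers the value at x of any
  function with both c-symmetries, and on K the vectors of \<open>ket_sum_H\<close> do the same.
  Hence no nonzero function with these symmetries is orthogonal to \<open>H\<close>, and the vector
  of \<open>proj \<circ> T\<close> lies in \<open>H\<close>.\<close>

lemma proj_comp_mem:
  assumes Z1: "\<And>x z. x \<in> X \<Longrightarrow> x \<notin> K \<Longrightarrow> Z x z
      = 1 / 4 * (ket x z + \<eta> * ket (c \<otimes> x) z + \<eta> * ket (x \<otimes> c) z + ket (c \<otimes> x \<otimes> c) z)"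
    and T: "T \<in> left_ops G" and comm: "canonical_unitary G c (T (ket \<one>)) = T (canonical_unitary G c (ket \<one>))"
  shows "proj \<circ> T \<in> P"
proof (rule von_neumann_algebra_memI[OF vna left proj_left_ops[OF T]])
  define f where "f = proj (T (ket \<one>))"
  have TX: "T (ket \<one>) \<in> ell2 X" using bounded_ops_ell2[OF left_ops_bounded[OF T]] .
  have f: "f \<in> ell2 X" unfolding f_def using P_ell2[OF proj_P] .
  have fc: "f (c \<otimes> x) = \<eta> * f x" if "x \<in> X" for x
    using proj_c[OF TX that] by (simp add: f_def)
  have fc': "f (x \<otimes> c) = \<eta> * f x" if "x \<in> X" for x
  proof -
    have "T (ket \<one>) (c \<otimes> (x \<otimes> c)) = T (ket \<one>) x"
      using c_commute[OF T comm, of "c \<otimes> x"] that by (simp add: m_assoc)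
    then show ?thesis
      using that c_commute[OF T comm that] by (simp add: f_def proj_apply TX distrib_left add.commute)
  qed
  obtain p where p: "p \<in> H" "\<And>k. k \<in> H \<Longrightarrow> ell2_inner X k (f - p) = 0"
    using ell2_projection[OF closed_H f] by blast
  \<comment> \<open>The part of the vector orthogonal to \<open>H\<close>. It keeps both symmetries
    and is shown to vanish pointwise.\<close>
  define k where "k = f - p"
  have kX: "k \<in> ell2 X" unfolding k_def using f p H_ell2 ell2_diff by blast
  have kc: "k (c \<otimes> x) = \<eta> * k x" "k (x \<otimes> c) = \<eta> * k x" if "x \<in> X" for x
    using that p(1) by (simp_all add: k_def fc fc' H_c H_c' right_diff_distrib)
  have "k x = 0" if x: "x \<in> X" for x
  proof (cases "x \<in> K")
    case True
    then show ?thesis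
      using p(2)[OF ket_sum_H[OF True], folded k_def] ell2_inner_ket_sum[OF x kX kc(1)] by simp
  next
    case False
    \<comment> \<open>The four kets are grouped into two sums of the shape treated in
      \<open>ell2_inner_ket_sum\<close>.\<close>
    have "Z x = (\<lambda>z. 1 / 4 * ((ket x + (\<lambda>z. \<eta> * ket (c \<otimes> x) z))
        + (\<lambda>z. \<eta> * (ket (x \<otimes> c) + (\<lambda>z. \<eta> * ket (c \<otimes> (x \<otimes> c)) z)) z)) z)"
      using Z1[OF x False] x by (auto simp: fun_eq_iff algebra_simps m_assoc)
    moreover have "ell2_inner X (\<lambda>z. 1 / 4 * ((ket x + (\<lambda>z. \<eta> * ket (c \<otimes> x) z))
        + (\<lambda>z. \<eta> * (ket (x \<otimes> c) + (\<lambda>z. \<eta> * ket (c \<otimes> (x \<otimes> c)) z)) z)) z) k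
      = 1 / 4 * (2 * cnj (k x) + \<eta> * (2 * cnj (k (x \<otimes> c))))"
      unfolding ell2_inner_scale_left using x
      by (subst ell2_inner_add_left)
         (simp_all only: ell2_inner_scale_left ell2_inner_ket_sum kX kc ell2_add ell2_scale ket_ell2 m_closed cX)
    ultimately have "ell2_inner X (Z x) k = 1 / 4 * (2 * cnj (k x) + \<eta> * (2 * cnj (k (x \<otimes> c))))"
      by (simp only:)
    also have "\<dots> = cnj (k x)"
      using x by (simp add: kc mult.left_commute[of \<eta> 2])
    finally show ?thesis using p(2)[OF Z_H[OF x]] by (simp add: k_def)
  qed
  then have "k = 0" using ell2_eqI[OF kX ell2_zero] by simp
  then have "f = p" by (simp add: k_def)
  then have "f \<in> HP" using p(1) H_HP by blast
  then show "(proj \<circ> T) (ket \<one>) \<in> ell2_closure X ((\<lambda>S. S (ket \<one>)) ` P)"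
    by (simp add: f_def HP_def)
qed

end

section \<open>The kernel of an intermediate algebra for the rational plane\<close>

lemma ell2_const_infinite:
  assumes f: "f \<in> ell2 X" and S: "S \<subseteq> X" "infinite S" and a: "\<And>x. x \<in> S \<Longrightarrow> f x = a"
  shows "a = 0"
proof (rule ccontr)
  assume "a \<noteq> 0"
  then have pos: "(cmod a)\<^sup>2 > 0" by simp
  obtain n where n: "real n * (cmod a)\<^sup>2 > (ell2_norm X f)\<^sup>2"
    using reals_Archimedean3[OF pos] by blast
  obtain F where F: "finite F" "card F = n" "F \<subseteq> S"
    using infinite_arbitrarily_large[OF S(2)] by blast
  have "(\<Sum>x\<in>F. (cmod (f x))\<^sup>2) = (\<Sum>x\<in>F. (cmod a)\<^sup>2)"
    by (rule sum.cong) (use a F in auto)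
  then have "real n * (cmod a)\<^sup>2 \<le> (ell2_norm X f)\<^sup>2"
    using ell2_finite_sum_le[OF f F(1)] F S by simp
  then show False using n by simp
qed

section \<open>Coordinates in the rational plane and in SL2(Q)\<close>

definition vec2 :: "rat \<Rightarrow> rat \<Rightarrow> rat^2" where
  "vec2 a b = vector [a, b]"

definition mat2 :: "rat \<Rightarrow> rat \<Rightarrow> rat \<Rightarrow> rat \<Rightarrow> rat^2^2" where
  "mat2 a b c d = vector [vector [a, b], vector [c, d]]"

lemma vec2_eq_iff [simp]: "vec2 a b = vec2 a' b' \<longleftrightarrow> a = a' \<and> b = b'"
  by (auto simp: vec2_def vec_eq_iff forall_2)

lemma mat2_eq_iff [simp]: "mat2 a b c d = mat2 a' b' c' d' \<longleftrightarrow> a = a' \<and> b = b' \<and> c = c' \<and> d = d'"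
  by (auto simp: mat2_def vec_eq_iff forall_2)

lemma vec2_cases: obtains a b where "v = vec2 a b"
proof
  show "v = vec2 (v $ 1) (v $ 2)" by (simp add: vec2_def vec_eq_iff forall_2)
qed

lemma mat2_cases: obtains a b c d where "g = mat2 a b c d"
proof
  show "g = mat2 (g $ 1 $ 1) (g $ 1 $ 2) (g $ 2 $ 1) (g $ 2 $ 2)"
    by (simp add: mat2_def vec_eq_iff forall_2)
qed

lemma vec2_zero: "0 = vec2 0 0"
  by (simp add: vec2_def vec_eq_iff forall_2)

lemma vec2_add [simp]: "vec2 a b + vec2 a' b' = vec2 (a + a') (b + b')"
  by (simp add: vec2_def vec_eq_iff forall_2)

lemma vec2_uminus [simp]: "- vec2 a b = vec2 (- a) (- b)"
  by (simp add: vec2_def vec_eq_iff forall_2)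

lemma mat2_uminus [simp]: "- mat2 a b c d = mat2 (- a) (- b) (- c) (- d)"
  by (simp add: mat2_def vec_eq_iff forall_2)

lemma mat_1_eq: "mat 1 = mat2 1 0 0 1"
  by (simp add: mat2_def mat_def vec_eq_iff forall_2)

lemma mat2_mult [simp]:
  "mat2 a b c d ** mat2 a' b' c' d' = mat2 (a * a' + b * c') (a * b' + b * d') (c * a' + d * c') (c * b' + d * d')"
  by (simp add: mat2_def matrix_matrix_mult_def vec_eq_iff forall_2 sum_2)

lemma mat2_mult_vec2 [simp]: "mat2 a b c d *v vec2 x y = vec2 (a * x + b * y) (c * x + d * y)"
  by (simp add: mat2_def vec2_def matrix_vector_mult_def vec_eq_iff forall_2 sum_2)

lemma det_mat2 [simp]: "det (mat2 a b c d) = a * d - b * c"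
  by (simp add: mat2_def det_2)

lemma mat2_SL2Q [simp]: "mat2 a b c d \<in> SL2Q \<longleftrightarrow> a * d - b * c = 1"
  by (simp add: SL2Q_def)

lemma \<Lambda>_iff [simp]: "(v, g) \<in> \<Lambda> \<longleftrightarrow> g \<in> SL2Q"
  by (simp add: Q2_SL2Q_def)

lemma \<Lambda>_cases:
  assumes "x \<in> \<Lambda>"
  obtains x1 x2 a b c d where "x = (vec2 x1 x2, mat2 a b c d)" "a * d - b * c = 1"
proof -
  obtain v g where x: "x = (v, g)" by fastforce
  obtain x1 x2 where v: "v = vec2 x1 x2" by (rule vec2_cases)
  obtain a b c d where g: "g = mat2 a b c d" by (rule mat2_cases)
  show thesis using that[of x1 x2 a b c d] assms by (simp add: x v g)
qed

lemma \<Lambda>_mult [simp]: "(v, g) \<otimes>\<^bsub>Q2_SL2Q\<^esub> (w, h) = (v + g *v w, g ** h)"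
  by (simp add: Q2_SL2Q_def)

lemma \<Lambda>_one: "\<one>\<^bsub>Q2_SL2Q\<^esub> = (vec2 0 0, mat2 1 0 0 1)"
  by (simp add: Q2_SL2Q_def vec2_zero mat_1_eq)

lemma \<Lambda>_inv [simp]:
  assumes "a * d - b * c = 1"
  shows "inv\<^bsub>Q2_SL2Q\<^esub> (vec2 x y, mat2 a b c d) = (vec2 (b * y - d * x) (c * x - a * y), mat2 d (- b) (- c) a)"
  by (rule group.inv_equality[OF group_Q2_SL2Q]) (use assms in \<open>auto simp: \<Lambda>_one algebra_simps\<close>)

lemma SL2Q_mult: "g \<in> SL2Q \<Longrightarrow> h \<in> SL2Q \<Longrightarrow> g ** h \<in> SL2Q"
  by (simp add: SL2Q_def det_mul)

lemma uminus_mat_1_SL2Q [simp]: "- mat 1 \<in> SL2Q"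
  by (simp add: mat_1_eq)

lemma subgroup_SL2Q: "subgroup ({0} \<times> SL2Q) Q2_SL2Q"
proof (rule group.subgroupI[OF group_Q2_SL2Q])
  show "{0} \<times> SL2Q \<noteq> {}" by (auto simp: SL2Q_def intro!: exI[of _ "mat 1"])
  fix x :: q2sl2 assume "x \<in> {0} \<times> SL2Q"
  then obtain g where g: "x = (0, g)" "g \<in> SL2Q" by auto
  obtain a b c d where abcd: "g = mat2 a b c d" by (rule mat2_cases)
  show "inv\<^bsub>Q2_SL2Q\<^esub> x \<in> {0} \<times> SL2Q"
    using g by (simp add: abcd vec2_zero mult.commute)
qed (auto simp: SL2Q_mult)

section \<open>Symmetries and support of the kernel at the base point\<close>

locale intermediate_SL2Q =
  intermediate_algebra Q2_SL2Q "{0} \<times> SL2Q" "(0, - mat 1)" P \<eta> for P \<eta>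
begin

abbreviation e where "e \<equiv> (vec2 1 0, mat2 1 0 0 1)"

lemma c_eq: "(0, - mat 1) = (vec2 0 0, mat2 (-1) 0 0 (-1))"
  by (simp add: vec2_zero mat_1_eq)

lemma Z_c_right: "x \<in> \<Lambda> \<Longrightarrow> a * d - b * c = 1 \<Longrightarrow>
    Z x (vec2 y1 y2, mat2 (- a) (- b) (- c) (- d)) = \<eta> * Z x (vec2 y1 y2, mat2 a b c d)"
  using Z_c'[of x "(vec2 y1 y2, mat2 a b c d)"] by (simp add: c_eq)

text \<open>Left multiplication by -id negates vector and matrix, right multiplication the matrix
  only; together they negate the vector alone, and the two factors \<eta> cancel.\<close>

lemma Z_even: "x \<in> \<Lambda> \<Longrightarrow> a * d - b * c = 1 \<Longrightarrow>
    Z x (vec2 (- y1) (- y2), mat2 a b c d) = Z x (vec2 y1 y2, mat2 a b c d)"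
  using Z_c[of x "(vec2 y1 y2, mat2 a b c d)"] Z_c_right[of x a d b c "- y1" "- y2"] \<eta>
  by (auto simp: c_eq)

lemma Z_transport_mult:
  assumes "k \<in> SL2Q" "g \<in> SL2Q" "y \<in> \<Lambda>"
  shows "Z ((0, k) \<otimes>\<^bsub>Q2_SL2Q\<^esub> e \<otimes>\<^bsub>Q2_SL2Q\<^esub> (0, g)) ((0, k) \<otimes>\<^bsub>Q2_SL2Q\<^esub> y \<otimes>\<^bsub>Q2_SL2Q\<^esub> (0, g)) = Z e y"
proof -
  have "(0, k) \<otimes>\<^bsub>Q2_SL2Q\<^esub> e \<in> \<Lambda>" "(0, k) \<otimes>\<^bsub>Q2_SL2Q\<^esub> y \<in> \<Lambda>"
    using assms by (intro m_closed; simp)+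
  then show ?thesis using assms by (simp add: Z_right Z_left del: \<Lambda>_mult)
qed

text \<open>The first point is (0, k) e (0, ki h). Solving for the second point in the same form,
  invariance on both sides strips off k and ki h.\<close>

lemma Z_transport:
  assumes k: "k \<in> SL2Q" "ki \<in> SL2Q" "k ** ki = mat 1" "ki ** k = mat 1"
    and h: "h \<in> SL2Q" "hi \<in> SL2Q" "hi ** h = mat 1" and m: "m \<in> SL2Q"
  shows "Z (k *v vec2 1 0, h) (w, m) = Z e (ki *v w, ki ** m ** hi ** k)"
proof -
  have cancel: "A ** k ** ki = A" "A ** hi ** h = A" for A
    by (metis k(3) h(3) matrix_mul_assoc matrix_mul_rid)+
  have "Z ((0, k) \<otimes>\<^bsub>Q2_SL2Q\<^esub> e \<otimes>\<^bsub>Q2_SL2Q\<^esub> (0, ki ** h))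
      ((0, k) \<otimes>\<^bsub>Q2_SL2Q\<^esub> (ki *v w, ki ** m ** hi ** k) \<otimes>\<^bsub>Q2_SL2Q\<^esub> (0, ki ** h))
    = Z e (ki *v w, ki ** m ** hi ** k)"
    by (rule Z_transport_mult) (use assms in \<open>simp_all add: SL2Q_mult\<close>)
  then show ?thesis
    by (simp add: mat_1_eq[symmetric] matrix_mul_assoc cancel k matrix_vector_mul_assoc)
qed

lemma e_mem [simp]: "e \<in> \<Lambda>"
  by simp

definition \<phi> :: "rat \<Rightarrow> rat \<Rightarrow> complex" where
  "\<phi> s x = Z e (vec2 s 0, mat2 1 x 0 1)"

lemma \<phi>_even: "\<phi> (- s) x = \<phi> s x"
  using Z_even[of e 1 1 x 0 s 0] by (simp add: \<phi>_def)

lemma \<phi>_neg: "Z e (vec2 s 0, mat2 (- 1) x 0 (- 1)) = \<eta> * \<phi> s (- x)"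
  using Z_c_right[of e 1 1 "- x" 0 s 0] by (simp add: \<phi>_def)

lemma \<phi>_0: "\<phi> 0 x = 0"
  unfolding \<phi>_def by (rule Z_K) (simp_all add: vec2_zero)

text \<open>
  \<open>Z e\<close> is square-summable and constant on conjugacy orbits of the upper unipotent group, so it
  vanishes wherever such an orbit is infinite.
\<close>

lemma Z_e_support:
  assumes det: "a * d - b * c = 1" and nz: "Z e (vec2 s t, mat2 a b c d) \<noteq> 0"
  shows "t = 0 \<and> c = 0 \<and> (a = 1 \<and> d = 1 \<or> a = - 1 \<and> d = - 1)"
proof -
  \<comment> \<open>The conjugate of the given point by the upper unipotent n(x). As n(x) fixes (1,
    0), conjugation by it fixes e.\<close>
  define orb where "orb = (\<lambda>x. (vec2 (s + x * t) t, mat2 (a + x * c) (b + x * d - x * (a + x * c)) c (d - x * c)))"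
  have orb_mem: "orb x \<in> \<Lambda>" for x using det by (simp add: orb_def algebra_simps)
  have const: "Z e (orb x) = Z e (vec2 s t, mat2 a b c d)" for x
    using Z_transport[of "mat2 1 (-x) 0 1" "mat2 1 x 0 1" "mat 1" "mat 1" "mat2 a b c d" "vec2 s t"] det
    by (simp add: mat_1_eq orb_def algebra_simps)
  have "\<not> inj orb"
  proof
    assume "inj orb"
    then have "infinite (range orb)" using range_inj_infinite finite_imageD infinite_UNIV_char_0 by blast
    then show False
      using ell2_const_infinite[of "Z e" \<Lambda> "range orb"] Z_ell2[OF e_mem] orb_mem const nz by blast
  qed
  then obtain x y where xy: "x \<noteq> y" "orb x = orb y" by (auto simp: inj_def)
  then have "t = 0 \<and> c = 0" by (auto simp: orb_def)
  \<comment> \<open>Once t = c = 0, the only entry of \<open>orb x\<close> that depends on x is b +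
    x (d - a).\<close>
  moreover from this xy(2) have "(x - y) * (d - a) = 0" by (simp add: orb_def algebra_simps)
  ultimately have "t = 0 \<and> c = 0 \<and> a = d" using xy(1) by simp
  then show ?thesis using det by (auto simp: power2_eq_square[symmetric] power2_eq_1_iff)
qed

lemma Z_e_support_cases:
  assumes "z \<in> \<Lambda>" "Z e z \<noteq> 0"
  obtains s \<epsilon> x where "\<epsilon> = 1 \<or> \<epsilon> = - 1" "z = (vec2 s 0, mat2 \<epsilon> x 0 \<epsilon>)"
proof -
  obtain s t a b c d where z: "z = (vec2 s t, mat2 a b c d)" "a * d - b * c = 1"
    using assms(1) by (rule \<Lambda>_cases)
  show thesis using Z_e_support[OF z(2)] assms(2) that[of a s b] by (auto simp: z(1))
qed

text \<open>The quarter turn takes (1, 0) to (0, 1); conjugation by it exchanges upper and lower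
  unipotents, which accounts for the signs.\<close>

lemma Z_e2:
  assumes "a * d - b * c = 1"
  shows "Z (vec2 0 1, mat2 1 0 0 1) (vec2 x y, mat2 a b c d) = Z e (vec2 y (- x), mat2 d (- c) (- b) a)"
  using Z_transport[of "mat2 0 (-1) 1 0" "mat2 0 1 (-1) 0" "mat 1" "mat 1" "mat2 a b c d" "vec2 x y"] assms
  by (simp add: mat_1_eq algebra_simps)

section \<open>The convolution identity for the points (1, 0) and (0, 1)\<close>

lemma infsum_two:
  assumes "z1 \<in> \<Lambda>" "z2 \<in> \<Lambda>" "z1 \<noteq> z2" "\<And>z. z \<in> \<Lambda> \<Longrightarrow> z \<noteq> z1 \<Longrightarrow> z \<noteq> z2 \<Longrightarrow> f z = (0 :: complex)"
  shows "(\<Sum>\<^sub>\<infinity>z\<in>\<Lambda>. f z) = f z1 + f z2"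
proof -
  have "(\<Sum>\<^sub>\<infinity>z\<in>\<Lambda>. f z) = (\<Sum>\<^sub>\<infinity>z\<in>{z1, z2}. f z)"
    by (rule infsum_cong_neutral) (use assms in auto)
  then show ?thesis using assms(3) by simp
qed

text \<open>The evaluation point is the product of (vec2 s 0, n(x)) and (vec2 0 r, m), with m lower
  unipotent with entry y. The supports of the two kernels allow only this factorization and the one
  with -id inserted between the factors. Both contribute equally, whence the factor 2.\<close>

lemma convolution_left:
  "(\<Sum>\<^sub>\<infinity>z\<in>\<Lambda>. Z e z * Z (vec2 0 1, mat2 1 0 0 1)
      (inv\<^bsub>Q2_SL2Q\<^esub> z \<otimes>\<^bsub>Q2_SL2Q\<^esub> (vec2 (s + r * x) r, mat2 (1 + x * y) x y 1)))
    = 2 * (\<phi> s x * \<phi> r (- y))"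
proof -
  let ?X = "(vec2 (s + r * x) r, mat2 (1 + x * y) x y 1)"
  let ?f = "\<lambda>z. Z e z * Z (vec2 0 1, mat2 1 0 0 1) (inv\<^bsub>Q2_SL2Q\<^esub> z \<otimes>\<^bsub>Q2_SL2Q\<^esub> ?X)"
  have val: "inv\<^bsub>Q2_SL2Q\<^esub> (vec2 s' 0, mat2 \<epsilon> x' 0 \<epsilon>) \<otimes>\<^bsub>Q2_SL2Q\<^esub> ?X
      = (vec2 (\<epsilon> * (s + r * x) - x' * r - \<epsilon> * s') (\<epsilon> * r),
         mat2 (\<epsilon> * (1 + x * y) - x' * y) (\<epsilon> * x - x') (\<epsilon> * y) \<epsilon>)"
    if "\<epsilon> = 1 \<or> \<epsilon> = - 1" for \<epsilon> s' x'
    using that by (auto simp: algebra_simps)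
  have det: "(\<epsilon> * (1 + x * y) - x' * y) * \<epsilon> - (\<epsilon> * x - x') * (\<epsilon> * y) = 1"
    if "\<epsilon> = 1 \<or> \<epsilon> = - 1" for \<epsilon> x'
    using that by (auto simp: algebra_simps)
  have "(\<Sum>\<^sub>\<infinity>z\<in>\<Lambda>. ?f z) = ?f (vec2 s 0, mat2 1 x 0 1) + ?f (vec2 s 0, mat2 (- 1) (- x) 0 (- 1))"
  proof (rule infsum_two)
    fix z assume z: "z \<in> \<Lambda>" "z \<noteq> (vec2 s 0, mat2 1 x 0 1)" "z \<noteq> (vec2 s 0, mat2 (- 1) (- x) 0 (- 1))"
    show "?f z = 0"
    proof (rule ccontr)
      assume nz: "?f z \<noteq> 0"
      then obtain s' \<epsilon> x' where \<epsilon>: "\<epsilon> = 1 \<or> \<epsilon> = - 1" and z': "z = (vec2 s' 0, mat2 \<epsilon> x' 0 \<epsilon>)"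
        using Z_e_support_cases[OF z(1)] by (metis mult_zero_left)
      \<comment> \<open>The second factor, transported to e, must satisfy the support condition as
        well; this forces s' = s and x' = \<epsilon> x.\<close>
      have "Z e (vec2 (\<epsilon> * r) (- (\<epsilon> * (s + r * x) - x' * r - \<epsilon> * s')),
          mat2 \<epsilon> (- (\<epsilon> * y)) (- (\<epsilon> * x - x')) (\<epsilon> * (1 + x * y) - x' * y)) \<noteq> 0"
        using nz unfolding z' val[OF \<epsilon>] Z_e2[OF det[OF \<epsilon>]] by auto
      moreover have "\<epsilon> * (\<epsilon> * (1 + x * y) - x' * y) - (- (\<epsilon> * y)) * (- (\<epsilon> * x - x')) = 1"
        using \<epsilon> by (auto simp: algebra_simps)
      ultimately have "- (\<epsilon> * (s + r * x) - x' * r - \<epsilon> * s') = 0" "- (\<epsilon> * x - x') = 0"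
        using Z_e_support by blast+
      then have "x' = \<epsilon> * x" "s' = s" using \<epsilon> by (auto simp: algebra_simps)
      then show False using z z' \<epsilon> by auto
    qed
  qed auto
  also have "?f (vec2 s 0, mat2 1 x 0 1) = \<phi> s x * \<phi> r (- y)"
    using val[of 1 s x] Z_e2[OF det[of 1 x], of 0 r] by (simp add: \<phi>_def)
  also have "?f (vec2 s 0, mat2 (- 1) (- x) 0 (- 1)) = \<phi> s x * \<phi> r (- y)"
    using val[of "-1" s "-x"] Z_e2[OF det[of "-1" "-x"], of 0 "-r"] \<phi>_even[of r "-y"]
    by (simp add: \<phi>_neg)
  finally show ?thesis by simp
qed

lemma \<phi>_product:
  "2 * (\<phi> s x * \<phi> r (- y)) = (\<Sum>\<^sub>\<infinity>z\<in>\<Lambda>. Z e z *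
      cnj (Z (vec2 (s + r * x) r, mat2 (1 + x * y) x y 1) (z \<otimes>\<^bsub>Q2_SL2Q\<^esub> (vec2 0 1, mat2 1 0 0 1))))"
  unfolding convolution_left[symmetric] by (rule Z_convolution) (simp_all add: algebra_simps)

text \<open>The transporting matrix has as first column the vector (s + r x, r) of the first point;
  its second column, which involves 1 / r, makes the determinant 1.\<close>

lemma Z_target:
  assumes r: "r \<noteq> 0" and \<epsilon>: "\<epsilon> = 1 \<or> \<epsilon> = - 1"
  shows "Z (vec2 (s + r * x) r, mat2 (1 + x * y) x y 1) ((vec2 s' 0, mat2 \<epsilon> x' 0 \<epsilon>) \<otimes>\<^bsub>Q2_SL2Q\<^esub> (vec2 0 1, mat2 1 0 0 1))
    = Z e (mat2 0 (1 / r) (- r) (s + r * x) *v vec2 (s' + x') \<epsilon>,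
        mat2 0 (1 / r) (- r) (s + r * x) ** mat2 \<epsilon> x' 0 \<epsilon> ** mat2 1 (- x) (- y) (1 + x * y)
          ** mat2 (s + r * x) (- 1 / r) r 0)"
  using Z_transport[of "mat2 (s + r * x) (- 1 / r) r 0" "mat2 0 (1 / r) (- r) (s + r * x)"
      "mat2 (1 + x * y) x y 1" "mat2 1 (- x) (- y) (1 + x * y)" "mat2 \<epsilon> x' 0 \<epsilon>" "vec2 (s' + x') \<epsilon>"] r \<epsilon>
  by (auto simp: mat_1_eq algebra_simps)

text \<open>In a nonzero summand the matrix seen by \<open>Z e\<close> has upper left entry
  \<epsilon> (1 - y s / r), whatever s' and x' are. The support condition asks for \<plusminus>1,
  which the hypotheses exclude, so the whole sum vanishes.\<close>

lemma \<phi>_product_zero: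
  assumes "s \<noteq> 0" "r \<noteq> 0" "y \<noteq> 0" "s * y \<noteq> 2 * r"
  shows "\<phi> s x * \<phi> r (- y) = 0"
proof -
  have "Z e z * cnj (Z (vec2 (s + r * x) r, mat2 (1 + x * y) x y 1) (z \<otimes>\<^bsub>Q2_SL2Q\<^esub> (vec2 0 1, mat2 1 0 0 1))) = 0"
    if z: "z \<in> \<Lambda>" for z
  proof (rule ccontr)
    assume nz: "\<not> ?thesis"
    then obtain s' \<epsilon> x' where \<epsilon>: "\<epsilon> = 1 \<or> \<epsilon> = - 1" and z': "z = (vec2 s' 0, mat2 \<epsilon> x' 0 \<epsilon>)"
      using Z_e_support_cases[OF z] by (metis mult_zero_left)
    define N where "N = mat2 0 (1 / r) (- r) (s + r * x) ** mat2 \<epsilon> x' 0 \<epsilon> ** mat2 1 (- x) (- y) (1 + x * y)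
          ** mat2 (s + r * x) (- 1 / r) r 0"
    have NS: "N \<in> SL2Q" unfolding N_def
      using assms \<epsilon> by (intro SL2Q_mult) (auto simp: algebra_simps)
    obtain a b c d where N: "N = mat2 a b c d" by (rule mat2_cases)
    have "r * (a * r) = r * (\<epsilon> * (r - y * s))"
      using N[symmetric] assms(2) unfolding N_def by (simp add: field_simps)
    then have "a * r = \<epsilon> * (r - y * s)" using assms(2) by simp
    then have "a = \<epsilon> * (1 - y * s / r)"
      using assms(2) by (simp add: field_simps)
    moreover have "Z e (mat2 0 (1 / r) (- r) (s + r * x) *v vec2 (s' + x') \<epsilon>, N) \<noteq> 0"
      using nz unfolding z' Z_target[OF assms(2) \<epsilon>] N_def by (metis complex_cnj_zero mult_zero_right)
    then have "a = 1 \<or> a = - 1"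
      unfolding N mat2_mult_vec2 using Z_e_support[of a d b c] NS N by auto
    ultimately have "y * s / r = 0 \<or> y * s / r = 2" using \<epsilon> by auto
    then show False using assms by (auto simp: field_simps)
  qed
  then have "2 * (\<phi> s x * \<phi> r (- y)) = 0"
    unfolding \<phi>_product by (intro infsum_0) auto
  then show ?thesis by simp
qed

lemma \<phi>_unipotent:
  assumes "x \<noteq> 0"
  shows "\<phi> s x = 0"
proof (cases "s = 0")
  case False
  \<comment> \<open>By evenness both products are the square of \<open>\<phi> s x\<close>. With y =
    - x the excluded value is x = - 2 for the first and x = 2 for the second, so one of the two
    always applies.\<close>
  have "\<phi> s x * \<phi> s (- (- x)) = 0 \<or> \<phi> (- s) x * \<phi> s (- (- x)) = 0"
    using \<phi>_product_zero[of s s "- x" x] \<phi>_product_zero[of "- s" s "- x" x] False assms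
    by (cases "x = 2") auto
  then show ?thesis by (auto simp: \<phi>_even)
qed (simp add: \<phi>_0)

text \<open>The matrix diag(1/r, r) takes (1, 0) to (1/r, 0), so \<open>\<phi> r 0\<close> is also
  the kernel between (1/r, 0) and (1, 0), and the kernel is Hermitian.\<close>

lemma \<phi>_herm:
  assumes "r \<noteq> 0"
  shows "cnj (\<phi> (1 / r) 0) = \<phi> r 0"
proof -
  have "Z (vec2 (1 / r) 0, mat2 1 0 0 1) e = \<phi> r 0"
    using Z_transport[of "mat2 (1 / r) 0 0 r" "mat2 r 0 0 (1 / r)" "mat 1" "mat 1" "mat 1" "vec2 1 0"] assms
    by (simp add: mat_1_eq \<phi>_def)
  then show ?thesis
    using Z_herm[of e "(vec2 (1 / r) 0, mat2 1 0 0 1)"] by (simp add: \<phi>_def)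
qed

text \<open>The product formula at x = y = 0. Unipotent parts are already excluded, so only s' = s /
  r with the identity and s' = - s / r with -id remain; each term is \<phi>(s / r) times the
  conjugate of \<phi>(1 / r), which is \<phi>(r).\<close>

lemma \<phi>_quotient:
  assumes r: "r \<noteq> 0"
  shows "\<phi> s 0 * \<phi> r 0 = \<phi> (s / r) 0 * \<phi> r 0"
proof -
  let ?f = "\<lambda>z. Z e z * cnj (Z (vec2 s r, mat2 1 0 0 1) (z \<otimes>\<^bsub>Q2_SL2Q\<^esub> (vec2 0 1, mat2 1 0 0 1)))"
  have target: "Z (vec2 s r, mat2 1 0 0 1) ((vec2 s' 0, mat2 \<epsilon> 0 0 \<epsilon>) \<otimes>\<^bsub>Q2_SL2Q\<^esub> (vec2 0 1, mat2 1 0 0 1))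
      = Z e (vec2 (\<epsilon> / r) (s * \<epsilon> - r * s'), mat2 \<epsilon> 0 0 \<epsilon>)"
    if "\<epsilon> = 1 \<or> \<epsilon> = - 1" for \<epsilon> s'
    using Z_target[OF r that, of s 0 0 s' 0] r by (auto simp: algebra_simps)
  have "2 * (\<phi> s 0 * \<phi> r 0) = (\<Sum>\<^sub>\<infinity>z\<in>\<Lambda>. ?f z)"
    using \<phi>_product[of s 0 r 0] by simp
  also have "\<dots> = ?f (vec2 (s / r) 0, mat2 1 0 0 1) + ?f (vec2 (- s / r) 0, mat2 (- 1) 0 0 (- 1))"
  proof (rule infsum_two)
    fix z assume z: "z \<in> \<Lambda>" "z \<noteq> (vec2 (s / r) 0, mat2 1 0 0 1)" "z \<noteq> (vec2 (- s / r) 0, mat2 (- 1) 0 0 (- 1))"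
    show "?f z = 0"
    proof (rule ccontr)
      assume nz: "?f z \<noteq> 0"
      then obtain s' \<epsilon> x' where \<epsilon>: "\<epsilon> = 1 \<or> \<epsilon> = - 1" and z': "z = (vec2 s' 0, mat2 \<epsilon> x' 0 \<epsilon>)"
        using Z_e_support_cases[OF z(1)] by (metis mult_zero_left)
      have "Z e z \<noteq> 0" using nz by auto
      then have x': "x' = 0"
        using \<epsilon> \<phi>_unipotent[of x' s'] \<phi>_unipotent[of "- x'" s'] \<phi>_neg[of s' x']
        unfolding z' \<phi>_def by (metis mult_zero_right neg_equal_0_iff_equal)
      have "Z e (vec2 (\<epsilon> / r) (s * \<epsilon> - r * s'), mat2 \<epsilon> 0 0 \<epsilon>) \<noteq> 0"
        using nz target[OF \<epsilon>, of s'] by (auto simp: z' x')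
      from Z_e_support[OF _ this] have "s * \<epsilon> - r * s' = 0" using \<epsilon> by auto
      then have "s' = \<epsilon> * s / r" using r by (simp add: field_simps)
      then show False using z \<epsilon> by (auto simp: z' x')
    qed
  qed auto
  also have "?f (vec2 (s / r) 0, mat2 1 0 0 1) = \<phi> (s / r) 0 * cnj (\<phi> (1 / r) 0)"
    using target[of 1 "s / r"] r by (simp add: \<phi>_def)
  also have "?f (vec2 (- s / r) 0, mat2 (- 1) 0 0 (- 1)) = \<phi> (s / r) 0 * cnj (\<phi> (1 / r) 0)"
    using target[of "-1" "- s / r"] r \<phi>_even[of "s / r" 0] \<phi>_even[of "1 / r" 0] by (simp add: \<phi>_neg)
  finally show ?thesis using \<phi>_herm[OF r] by simp
qed

lemma \<phi>_power:
  assumes "r \<noteq> 0" "\<phi> r 0 \<noteq> 0"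
  shows "\<phi> (r ^ Suc n) 0 = \<phi> r 0"
proof (induction n)
  case (Suc n)
  then show ?case using \<phi>_quotient[OF assms(1), of "r ^ Suc (Suc n)"] assms by simp
qed simp

text \<open>A nonzero value would be repeated, by \<open>\<phi>_power\<close>, at the infinitely
  many powers of r, against square-summability.\<close>

lemma \<phi>_supp_gt:
  assumes r: "\<bar>r\<bar> > 1"
  shows "\<phi> r 0 = 0"
proof (rule ccontr)
  assume nz: "\<phi> r 0 \<noteq> 0"
  define S where "S = range (\<lambda>n. (vec2 (r ^ Suc n) 0, mat2 1 0 0 1))"
  have "inj (\<lambda>n. (vec2 (r ^ Suc n) 0, mat2 1 0 0 1))"
  proof (rule injI)
    fix m n :: nat
    assume "(vec2 (r ^ Suc m) 0, mat2 1 0 0 1) = (vec2 (r ^ Suc n) 0, mat2 1 0 0 1)"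
    then have "r ^ Suc m = r ^ Suc n" by (simp only: prod.inject vec2_eq_iff)
    then have "\<bar>r\<bar> ^ Suc m = \<bar>r\<bar> ^ Suc n" by (metis power_abs)
    then show "m = n" using power_inject_exp[OF r, of "Suc m" "Suc n"] by simp
  qed
  then have "infinite S" unfolding S_def using range_inj_infinite by blast
  then have "\<phi> r 0 = 0"
    using r nz \<phi>_power[of r] by (intro ell2_const_infinite[OF Z_ell2[OF e_mem], of S])
      (auto simp: S_def \<phi>_def)
  then show False using nz by blast
qed

lemma \<phi>_supp:
  assumes "r \<noteq> 1" "r \<noteq> - 1"
  shows "\<phi> r 0 = 0"
proof -
  consider "r = 0" | "\<bar>r\<bar> > 1" | "r \<noteq> 0" "\<bar>1 / r\<bar> > 1"
  proof -
    have "r \<noteq> 0 \<Longrightarrow> \<bar>r\<bar> < 1 \<Longrightarrow> \<bar>1 / r\<bar> > 1" by (simp add: abs_divide less_divide_eq)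
    moreover have "\<bar>r\<bar> \<noteq> 1" using assms by linarith
    ultimately show ?thesis using that by linarith
  qed
  then show ?thesis
  proof cases
    case 3
    then show ?thesis using \<phi>_supp_gt[OF 3(2)] \<phi>_herm[OF 3(1)] by (metis complex_cnj_zero)
  qed (simp_all add: \<phi>_0 \<phi>_supp_gt)
qed

section \<open>The kernel at an arbitrary point off SL2(Q)\<close>

abbreviation c where "c \<equiv> (0, - mat 1) :: q2sl2"

abbreviation mul (infixl "\<cdot>" 70) where "x \<cdot> y \<equiv> x \<otimes>\<^bsub>Q2_SL2Q\<^esub> y"

text \<open>Four times the projection of \<open>ket x\<close> onto the functions that left and right
  translation by c multiply by \<eta>; the last coefficient is \<eta>^2 = 1.\<close>

definition ket4 :: "q2sl2 \<Rightarrow> q2sl2 \<Rightarrow> complex" where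
  "ket4 x z = ket x z + \<eta> * ket (c \<cdot> x) z + \<eta> * ket (x \<cdot> c) z + ket (c \<cdot> x \<cdot> c) z"

lemma ket4_transport:
  assumes k: "k \<in> SL2Q" and g: "g \<in> SL2Q" and x: "x \<in> \<Lambda>" and y: "y \<in> \<Lambda>"
  shows "ket4 ((0, k) \<cdot> x \<cdot> (0, g)) ((0, k) \<cdot> y \<cdot> (0, g)) = ket4 x y"
proof -
  have mem: "(0, k) \<in> \<Lambda>" "(0, g) \<in> \<Lambda>" using k g by simp_all
  have central: "c \<cdot> (0, h) = (0, h) \<cdot> c" for h
    by (rule mat2_cases[of h]) (simp add: mat_1_eq vec2_zero)
  have "c \<cdot> ((0, k) \<cdot> z \<cdot> (0, g)) = (0, k) \<cdot> (c \<cdot> z) \<cdot> (0, g)"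
    "((0, k) \<cdot> z \<cdot> (0, g)) \<cdot> c = (0, k) \<cdot> (z \<cdot> c) \<cdot> (0, g)" if z: "z \<in> \<Lambda>" for z
  proof -
    note ac = m_assoc m_closed z mem cX
    have "c \<cdot> ((0, k) \<cdot> z \<cdot> (0, g)) = (c \<cdot> (0, k)) \<cdot> z \<cdot> (0, g)" by (simp only: ac)
    also have "\<dots> = (0, k) \<cdot> (c \<cdot> z) \<cdot> (0, g)" unfolding central by (simp only: ac)
    finally show "c \<cdot> ((0, k) \<cdot> z \<cdot> (0, g)) = (0, k) \<cdot> (c \<cdot> z) \<cdot> (0, g)" .
    have "((0, k) \<cdot> z \<cdot> (0, g)) \<cdot> c = (0, k) \<cdot> z \<cdot> ((0, g) \<cdot> c)" by (simp only: ac)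
    also have "\<dots> = (0, k) \<cdot> (z \<cdot> c) \<cdot> (0, g)" unfolding central[symmetric] by (simp only: ac)
    finally show "((0, k) \<cdot> z \<cdot> (0, g)) \<cdot> c = (0, k) \<cdot> (z \<cdot> c) \<cdot> (0, g)" .
  qed
  moreover have "ket ((0, k) \<cdot> z \<cdot> (0, g)) ((0, k) \<cdot> y \<cdot> (0, g)) = ket z y" if "z \<in> \<Lambda>" for z
    using that mem y by (simp add: ket_def del: \<Lambda>_mult)
  ultimately show ?thesis
    using x cX by (simp add: ket4_def del: \<Lambda>_mult)
qed

text \<open>The support is down to the four points with vector (\<plusminus>1, 0) and matrix
  \<plusminus>id, and the c-symmetries fix the ratios of the values there.\<close>

lemma Z_e_eq: "Z e z = \<phi> 1 0 * ket4 e z"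
proof (cases "z \<in> \<Lambda>")
  case z: True
  have ket4: "ket4 e z = ket (vec2 1 0, mat2 1 0 0 1) z + \<eta> * ket (vec2 (- 1) 0, mat2 (- 1) 0 0 (- 1)) z
      + \<eta> * ket (vec2 1 0, mat2 (- 1) 0 0 (- 1)) z + ket (vec2 (- 1) 0, mat2 1 0 0 1) z"
    by (simp add: ket4_def c_eq)
  show ?thesis
  proof (cases "z \<in> {(vec2 1 0, mat2 1 0 0 1), (vec2 (- 1) 0, mat2 (- 1) 0 0 (- 1)), (vec2 1 0, mat2 (- 1) 0 0 (- 1)),
      (vec2 (- 1) 0, mat2 1 0 0 1)}")
    case True
    then show ?thesis
      unfolding ket4 using \<phi>_neg[of 1 0] \<phi>_neg[of "- 1" 0] \<phi>_even[of 1 0]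
      by (auto simp: ket_def \<phi>_def)
  next
    case False
    have "Z e z = 0"
    proof (rule ccontr)
      assume nz: "Z e z \<noteq> 0"
      then obtain s \<epsilon> x where \<epsilon>: "\<epsilon> = 1 \<or> \<epsilon> = - 1" and z': "z = (vec2 s 0, mat2 \<epsilon> x 0 \<epsilon>)"
        using Z_e_support_cases[OF z] by metis
      have "\<phi> s x \<noteq> 0 \<or> \<phi> s (- x) \<noteq> 0"
        using nz \<epsilon> \<phi>_neg[of s x] by (auto simp: z' \<phi>_def)
      then have "x = 0" using \<phi>_unipotent[of x s] \<phi>_unipotent[of "- x" s] by auto
      moreover have "s = 1 \<or> s = - 1"
        using \<open>\<phi> s x \<noteq> 0 \<or> \<phi> s (- x) \<noteq> 0\<close> \<open>x = 0\<close> \<phi>_supp[of s] by auto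
      ultimately show False using False \<epsilon> by (auto simp: z')
    qed
    then show ?thesis unfolding ket4 using False by (auto simp: ket_def)
  qed
next
  case False
  have "ket4 e z = 0"
    using False unfolding ket4_def ket_def by (auto simp: c_eq)
  then show ?thesis using ell2_outside[OF Z_ell2[OF e_mem] False] by simp
qed

text \<open>\<open>Z e\<close> reproduces itself, so its value t at e is its squared norm; the
  symmetries evaluate that norm as 4 t^2, with t real.\<close>

lemma \<phi>_1: "\<phi> 1 0 = 0 \<or> \<phi> 1 0 = 1 / 4"
proof -
  let ?a = "\<lambda>x. ket x + (\<lambda>z. \<eta> * ket (c \<cdot> x) z)"
  have Ze: "Z e = (\<lambda>z. \<phi> 1 0 * (?a e + (\<lambda>z. \<eta> * ?a (e \<cdot> c) z)) z)"
    by (auto simp: fun_eq_iff Z_e_eq ket4_def algebra_simps m_assoc simp del: \<Lambda>_mult)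
  have ec: "e \<cdot> c \<in> \<Lambda>" using cX by (intro m_closed) auto
  have "\<phi> 1 0 = ell2_inner \<Lambda> (Z e) (Z e)"
    using Z_reproducing[OF e_mem Z_H[OF e_mem]] by (simp add: \<phi>_def)
  also have "\<dots> = ell2_inner \<Lambda> (\<lambda>z. \<phi> 1 0 * (?a e + (\<lambda>z. \<eta> * ?a (e \<cdot> c) z)) z) (Z e)"
    by (subst (1) Ze) (rule refl)
  also have "\<dots> = \<phi> 1 0 * (2 * cnj (Z e e) + \<eta> * (2 * cnj (Z e (e \<cdot> c))))"
    unfolding ell2_inner_scale_left
    by (subst ell2_inner_add_left)
       (simp_all only: ell2_inner_scale_left ell2_inner_ket_sum Z_ell2 e_mem ec Z_c ell2_add ell2_scale
          ket_ell2 m_closed cX)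
  also have "Z e (e \<cdot> c) = \<eta> * Z e e" by (rule Z_c') simp_all
  also have "Z e e = \<phi> 1 0" by (simp add: \<phi>_def)
  finally have 1: "\<phi> 1 0 = \<phi> 1 0 * (4 * cnj (\<phi> 1 0))"
    by (simp add: mult.left_commute[of \<eta> 2])
  have "cnj (\<phi> 1 0) = \<phi> 1 0" using \<phi>_herm[of 1] by simp
  then have "\<phi> 1 0 * (1 - 4 * \<phi> 1 0) = 0" using 1 by (simp add: algebra_simps)
  then show ?thesis by (auto simp: field_simps)
qed

lemma Z_eq:
  assumes x: "x \<in> \<Lambda>" "x \<notin> {0} \<times> SL2Q"
  shows "Z x z = \<phi> 1 0 * ket4 x z"
proof (cases "z \<in> \<Lambda>")
  case z: True
  obtain v1 v2 h where x': "x = (vec2 v1 v2, h)" "h \<in> SL2Q"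
    by (metis vec2_cases \<Lambda>_iff surj_pair x(1))
  have v: "v1 \<noteq> 0 \<or> v2 \<noteq> 0" using x x' by (auto simp: vec2_zero)
  \<comment> \<open>Transitivity on nonzero vectors: (v1, v2) is completed to the first column of a
    matrix of determinant 1.\<close>
  obtain k where k: "k \<in> SL2Q" "k *v vec2 1 0 = vec2 v1 v2"
  proof (cases "v2 = 0")
    case True
    then show ?thesis using v that[of "mat2 v1 0 0 (1 / v1)"] by simp
  next
    case False
    then show ?thesis using that[of "mat2 v1 (- 1 / v2) v2 0"] by simp
  qed
  have kX: "(0, k) \<in> \<Lambda>" using k by simp
  obtain ki where ki: "ki \<in> SL2Q" "k ** ki = mat 1"
  proof -
    obtain a b c d where abcd: "k = mat2 a b c d" by (rule mat2_cases)
    show ?thesis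
      using that[of "mat2 d (- b) (- c) a"] k(1) by (simp add: abcd mat_1_eq algebra_simps)
  qed
  define g where "g = ki ** h"
  have g: "g \<in> SL2Q" using ki x' by (simp add: g_def SL2Q_mult)
  have gX: "(0, g) \<in> \<Lambda>" using g by simp
  have xe: "x = (0, k) \<cdot> e \<cdot> (0, g)"
    using k ki by (simp add: x' g_def mat_1_eq[symmetric] matrix_mul_assoc)
  define y where "y = inv\<^bsub>Q2_SL2Q\<^esub> (0, k) \<cdot> z \<cdot> inv\<^bsub>Q2_SL2Q\<^esub> (0, g)"
  have y: "y \<in> \<Lambda>" using kX gX z by (simp add: y_def del: \<Lambda>_mult)
  have zy: "z = (0, k) \<cdot> y \<cdot> (0, g)"
    using kX gX z by (simp add: y_def m_assoc del: \<Lambda>_mult) (simp add: m_assoc[symmetric] del: \<Lambda>_mult)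
  show ?thesis
    unfolding xe zy Z_transport_mult[OF k(1) g y] ket4_transport[OF k(1) g e_mem y] by (rule Z_e_eq)
next
  case False
  have "ket4 x z = 0"
    using False x(1) cX unfolding ket4_def ket_def by (auto simp del: \<Lambda>_mult)
  then show ?thesis using ell2_outside[OF Z_ell2[OF x(1)] False] by simp
qed

text \<open>If \<open>\<phi> 1 0\<close> is 0, then \<open>H\<close> carries nothing off SL2(Q); if
  it is 1/4, then \<open>H\<close> carries everything that the c-symmetries permit.\<close>

lemma dichotomy:
  "(\<forall>T\<in>P. proj \<circ> T \<in> L_SL2Q) \<or>
   (\<forall>T\<in>left_ops Q2_SL2Q. canonical_unitary Q2_SL2Q c (T (ket \<one>\<^bsub>Q2_SL2Q\<^esub>))
      = T (canonical_unitary Q2_SL2Q c (ket \<one>\<^bsub>Q2_SL2Q\<^esub>)) \<longrightarrow> proj \<circ> T \<in> P)"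
proof -
  have L: "L_SL2Q = group_vna Q2_SL2Q ({0} \<times> SL2Q)"
    unfolding L_SL2Q_def by (rule arg_cong[where f = "group_vna Q2_SL2Q"]) auto
  from \<phi>_1 show ?thesis
  proof
    assume "\<phi> 1 0 = 0"
    then have "Z x = 0" if "x \<in> \<Lambda>" "x \<notin> {0} \<times> SL2Q" for x
      using Z_eq[OF that] by (auto simp: fun_eq_iff)
    then show ?thesis using proj_comp_group_vna unfolding L by blast
  next
    assume "\<phi> 1 0 = 1 / 4"
    then have "Z x z = 1 / 4 * (ket x z + \<eta> * ket (c \<cdot> x) z + \<eta> * ket (x \<cdot> c) z + ket (c \<cdot> x \<cdot> c) z)"
      if "x \<in> \<Lambda>" "x \<notin> {0} \<times> SL2Q" for x z
      using Z_eq[OF that] by (simp add: ket4_def)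
    then show ?thesis using proj_comp_mem by blast
  qed
qed

end

section \<open>Classification\<close>

abbreviation cc :: q2sl2 where "cc \<equiv> (0, - mat 1)"

abbreviation ucc :: "q2sl2 operator" where "ucc \<equiv> canonical_unitary Q2_SL2Q cc"

text \<open>In Fourier coefficients the commutation reads c(-w, g) = c(w, g), the symmetry defining
  A carried over to the crossed product. Being a commutant, this is a von Neumann algebra, so it
  contains \<open>A_crossed_SL2Q\<close> once it contains the generators.\<close>

definition even_ops :: "q2sl2 operator set" where
  "even_ops = commutant \<Lambda> (rtrans Q2_SL2Q ` \<Lambda> \<union> {ucc})"

text \<open>q and its complement in one formula, for \<eta> = 1 and \<eta> = -1.\<close>

definition qpm :: "complex \<Rightarrow> q2sl2 operator" where
  "qpm \<eta> = (\<lambda>f x. (id_op \<Lambda> f x + \<eta> * ucc f x) / 2)"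

interpretation QS: group Q2_SL2Q
  by (rule group_Q2_SL2Q)

lemma cc_mem [simp]: "cc \<in> \<Lambda>"
  by simp

lemma cc_square: "cc \<otimes>\<^bsub>Q2_SL2Q\<^esub> cc = \<one>\<^bsub>Q2_SL2Q\<^esub>"
  by (simp add: \<Lambda>_one mat_1_eq vec2_zero)

lemma cc_mult: "cc \<otimes>\<^bsub>Q2_SL2Q\<^esub> (w, h) = (- w, - h)" "(w, h) \<otimes>\<^bsub>Q2_SL2Q\<^esub> cc = (w, - h)"
  by (rule vec2_cases[of w], rule mat2_cases[of h], simp add: mat_1_eq vec2_zero)+

lemma inv_cc [simp]: "inv\<^bsub>Q2_SL2Q\<^esub> cc = cc"
  by (rule QS.inv_equality[OF cc_square cc_mem cc_mem])

lemma even_ops_left_ops: "even_ops \<subseteq> left_ops Q2_SL2Q"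
  unfolding even_ops_def left_ops_def by (rule commutant_antimono) blast

lemma even_ops_commute: "T \<in> even_ops \<Longrightarrow> ucc (T f) = T (ucc f)"
  unfolding even_ops_def by (rule commutantD(2)) auto

text \<open>Both compositions with the unitary of -id are in the left algebra, so they agree once
  their vectors do; these are the coefficient function of T shifted on the left and on the
  right.\<close>

lemma even_opsI:
  assumes T: "T \<in> left_ops Q2_SL2Q"
    and eq: "\<And>x. x \<in> \<Lambda> \<Longrightarrow>
      T (ket \<one>\<^bsub>Q2_SL2Q\<^esub>) (cc \<otimes>\<^bsub>Q2_SL2Q\<^esub> x) = T (ket \<one>\<^bsub>Q2_SL2Q\<^esub>) (x \<otimes>\<^bsub>Q2_SL2Q\<^esub> cc)"
  shows "T \<in> even_ops"
proof -
  note Tb = QS.left_ops_bounded[OF T]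
  have "ucc \<circ> T = T \<circ> ucc"
  proof (rule QS.left_ops_eqI)
    show "ucc \<circ> T \<in> left_ops Q2_SL2Q" "T \<circ> ucc \<in> left_ops Q2_SL2Q"
      using T QS.canonical_unitary_left_ops[OF cc_mem] commutant_comp unfolding left_ops_def by blast+
    have "ucc (T (ket \<one>\<^bsub>Q2_SL2Q\<^esub>)) = T (ket cc)"
    proof (rule ell2_eqI[of _ \<Lambda>])
      fix x assume x: "x \<in> \<Lambda>"
      show "ucc (T (ket \<one>\<^bsub>Q2_SL2Q\<^esub>)) x = T (ket cc) x"
        unfolding QS.left_ops_ket[OF T cc_mem]
        using x by (simp add: QS.canonical_unitary_apply QS.rtrans_apply bounded_ops_ell2[OF Tb] eq
            del: \<Lambda>_mult)
    qed (use bounded_ops_ell2[OF Tb] bounded_ops_ell2[OF QS.canonical_unitary_bounded[OF cc_mem]] in auto)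
    then show "(ucc \<circ> T) (ket \<one>\<^bsub>Q2_SL2Q\<^esub>) = (T \<circ> ucc) (ket \<one>\<^bsub>Q2_SL2Q\<^esub>)"
      using QS.canonical_unitary_ket[OF cc_mem QS.one_closed] by (simp del: \<Lambda>_mult)
  qed
  then show ?thesis
    using T unfolding even_ops_def left_ops_def commutant_def by auto
qed

lemma von_neumann_algebra_even_ops: "von_neumann_algebra \<Lambda> even_ops"
  unfolding even_ops_def
proof (rule von_neumann_algebra_commutant)
  fix T assume "T \<in> rtrans Q2_SL2Q ` \<Lambda> \<union> {ucc}"
  then show "\<exists>S\<in>rtrans Q2_SL2Q ` \<Lambda> \<union> {ucc}. adjoint_pair \<Lambda> S T"
    using QS.rtrans_adjoint QS.canonical_unitary_adjoint[OF cc_mem] by auto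
qed (use QS.rtrans_bounded QS.canonical_unitary_bounded[OF cc_mem] in auto)

lemma unitary_even_ops:
  assumes "g \<in> SL2Q"
  shows "canonical_unitary Q2_SL2Q (0, g) \<in> even_ops"
proof (rule even_opsI)
  have g: "(0, g) \<in> \<Lambda>" using assms by simp
  show "canonical_unitary Q2_SL2Q (0, g) \<in> left_ops Q2_SL2Q"
    by (rule QS.canonical_unitary_left_ops[OF g])
  fix x assume x: "x \<in> \<Lambda>"
  have "cc \<otimes>\<^bsub>Q2_SL2Q\<^esub> x = (0, g) \<longleftrightarrow> x \<otimes>\<^bsub>Q2_SL2Q\<^esub> cc = (0, g)"
    by (cases x) (simp only: cc_mult prod.inject neg_equal_0_iff_equal)
  then show "canonical_unitary Q2_SL2Q (0, g) (ket \<one>\<^bsub>Q2_SL2Q\<^esub>) (cc \<otimes>\<^bsub>Q2_SL2Q\<^esub> x)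
      = canonical_unitary Q2_SL2Q (0, g) (ket \<one>\<^bsub>Q2_SL2Q\<^esub>) (x \<otimes>\<^bsub>Q2_SL2Q\<^esub> cc)"
    unfolding QS.canonical_unitary_ket[OF g QS.one_closed] QS.r_one[OF g] by (simp only: ket_def)
qed

lemma L_SL2Q_eq: "L_SL2Q = generated_vna \<Lambda> (canonical_unitary Q2_SL2Q ` ({0} \<times> SL2Q))"
  unfolding L_SL2Q_def group_vna_def by (rule arg_cong[where f = "generated_vna \<Lambda>"]) auto

lemma unitary_L_SL2Q: "x \<in> {0} \<times> SL2Q \<Longrightarrow> canonical_unitary Q2_SL2Q x \<in> L_SL2Q"
  unfolding L_SL2Q_eq by (rule subsetD[OF generated_vna_superset imageI])

lemma L_SL2Q_even_ops: "L_SL2Q \<subseteq> even_ops"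
  unfolding L_SL2Q_eq
  by (rule generated_vna_minimal[OF von_neumann_algebra_even_ops]) (auto intro: unitary_even_ops)

text \<open>The two products with -id differ only in the sign of the vector. Coefficients off the
  plane vanish, and on it the required equality is the defining evenness.\<close>

lemma A_even_even_ops: "A_even \<subseteq> even_ops"
proof
  fix T assume T: "T \<in> A_even"
  let ?H = "{(v, mat 1 :: rat^2^2) | v :: rat^2. True}"
  have H: "subgroup ?H Q2_SL2Q"
  proof (rule QS.subgroupI)
    fix x assume "x \<in> ?H"
    then obtain v where v: "x = (v, mat 1)" by blast
    obtain a b where ab: "v = vec2 a b" by (rule vec2_cases)
    have "inv\<^bsub>Q2_SL2Q\<^esub> x = (- v, mat 1)"
      using \<Lambda>_inv[of 1 1 0 0 a b] by (simp add: v ab mat_1_eq)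
    then show "inv\<^bsub>Q2_SL2Q\<^esub> x \<in> ?H" by simp
  qed (auto simp: SL2Q_def)
  have TG: "T \<in> group_vna Q2_SL2Q ?H"
    and coeff: "\<And>v. T (ket \<one>\<^bsub>Q2_SL2Q\<^esub>) (v, mat 1) = T (ket \<one>\<^bsub>Q2_SL2Q\<^esub>) (- v, mat 1)"
    using T by (auto simp: A_even_def L_Q2_def fourier_coeff_def ket_def)
  show "T \<in> even_ops"
  proof (rule even_opsI[OF QS.group_vna_support(1)[OF H TG]])
    fix x assume x: "x \<in> \<Lambda>"
    obtain w g where xw: "x = (w, g)" by fastforce
    have cx: "cc \<otimes>\<^bsub>Q2_SL2Q\<^esub> x = (- w, - g)" "x \<otimes>\<^bsub>Q2_SL2Q\<^esub> cc = (w, - g)"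
      by (simp_all only: xw cc_mult)
    show "T (ket \<one>\<^bsub>Q2_SL2Q\<^esub>) (cc \<otimes>\<^bsub>Q2_SL2Q\<^esub> x) = T (ket \<one>\<^bsub>Q2_SL2Q\<^esub>) (x \<otimes>\<^bsub>Q2_SL2Q\<^esub> cc)"
    proof (cases "- g = mat 1")
      case True
      then show ?thesis unfolding cx using coeff[of w] by simp
    next
      case False
      then show ?thesis unfolding cx using QS.group_vna_support(2)[OF H TG] by auto
    qed
  qed
qed

lemma A_crossed_even_ops: "A_crossed_SL2Q \<subseteq> even_ops"
  unfolding A_crossed_SL2Q_def
  by (rule generated_vna_minimal[OF von_neumann_algebra_even_ops])
     (use A_even_even_ops L_SL2Q_even_ops in blast)

lemma L_SL2Q_A_crossed: "L_SL2Q \<subseteq> A_crossed_SL2Q"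
  unfolding A_crossed_SL2Q_def
  by (rule order_trans[OF Un_upper2 generated_vna_superset])

lemma id_op_unitary: "canonical_unitary Q2_SL2Q (0, mat 1) = id_op \<Lambda>"
proof (rule bounded_ops_eqI[of _ \<Lambda>])
  have one: "(0, mat 1) = \<one>\<^bsub>Q2_SL2Q\<^esub>" by (simp add: Q2_SL2Q_def)
  show "canonical_unitary Q2_SL2Q (0, mat 1) \<in> bounded_ops \<Lambda>"
    unfolding one by (rule QS.canonical_unitary_bounded) simp
  fix x assume "x \<in> \<Lambda>"
  then show "canonical_unitary Q2_SL2Q (0, mat 1) (ket x) = id_op \<Lambda> (ket x)"
    unfolding one by (simp add: QS.canonical_unitary_ket id_op_def)
qed (rule id_op_bounded)

lemma q_eq: "q = qpm 1"
  by (simp add: q_def qpm_def u_def id_op_unitary)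

lemma id_op_minus_q: "id_op \<Lambda> - q = qpm (- 1)"
  by (auto simp: q_eq qpm_def fun_eq_iff field_simps)

lemma qpm_L_SL2Q: "qpm \<eta> \<in> L_SL2Q"
proof -
  have c: "ucc \<in> L_SL2Q" by (rule unitary_L_SL2Q) simp
  note closed = generated_vna_closed[of _ \<Lambda> "canonical_unitary Q2_SL2Q ` ({0} \<times> SL2Q)",
      folded L_SL2Q_eq]
  have "(\<lambda>f x. 1 / 2 * (id_op \<Lambda> + (\<lambda>f x. \<eta> * ucc f x)) f x) \<in> L_SL2Q"
    by (rule closed(3)[OF c], rule closed(2)[OF closed(4)[OF c c] closed(3)[OF c c]])
  then show ?thesis by (simp add: qpm_def)
qed

lemma intermediate_SL2Q_I:
  assumes P: "von_neumann_algebra \<Lambda> P" "L_SL2Q \<subseteq> P" "P \<subseteq> even_ops" and \<eta>: "\<eta> = 1 \<or> \<eta> = - 1"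
  shows "intermediate_SL2Q P \<eta>"
proof (intro intermediate_SL2Q.intro intermediate_algebra.intro intermediate_algebra_axioms.intro)
  show "subgroup ({0} \<times> SL2Q) Q2_SL2Q" by (rule subgroup_SL2Q)
  show "cc \<otimes>\<^bsub>Q2_SL2Q\<^esub> cc = \<one>\<^bsub>Q2_SL2Q\<^esub>" by (rule cc_square)
qed (use assms even_ops_left_ops even_ops_commute unitary_L_SL2Q in auto)

lemma q_central_projection: "central_projection \<Lambda> A_crossed_SL2Q q"
proof -
  \<comment> \<open>\<open>even_ops\<close> is itself an instance of the locale, so q inherits the
    formulas proved for \<open>proj\<close>.\<close>
  interpret E: intermediate_SL2Q even_ops 1
    by (rule intermediate_SL2Q_I) (simp_all add: von_neumann_algebra_even_ops L_SL2Q_even_ops)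
  have qE: "q = E.proj" unfolding q_eq qpm_def E.proj_def ..
  have qb: "q \<in> bounded_ops \<Lambda>" unfolding qE by (rule E.P_bounded[OF E.proj_P])
  note qX = bounded_ops_ell2[OF qb]
  have "q \<circ> q = q"
  proof (rule bounded_ops_eqI[OF bounded_ops_comp[OF qb qb] qb])
    fix x assume x: "x \<in> \<Lambda>"
    show "(q \<circ> q) (ket x) = q (ket x)"
    proof (rule ell2_eqI[of _ \<Lambda>])
      fix y assume y: "y \<in> \<Lambda>"
      show "(q \<circ> q) (ket x) y = q (ket x) y"
        using E.proj_apply[OF qX[of "ket x", unfolded qE] y] E.proj_c[OF ket_ell2[OF x] y]
        by (simp add: qE)
    qed (use qX in auto)
  qed
  moreover have "adjoint_pair \<Lambda> q q"
    unfolding adjoint_pair_def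
  proof (intro ballI)
    fix f h assume fh: "f \<in> ell2 \<Lambda>" "h \<in> ell2 \<Lambda>"
    have qf: "q f = (\<lambda>x. 1 / 2 * (f + ucc f) x)" if "f \<in> ell2 \<Lambda>" for f
      using that by (simp add: q_eq qpm_def id_op_def)
    have uX: "ucc f \<in> ell2 \<Lambda>" for f
      by (rule bounded_ops_ell2[OF QS.canonical_unitary_bounded[OF cc_mem]])
    have "ell2_inner \<Lambda> (ucc f) h = ell2_inner \<Lambda> f (ucc h)"
      using adjoint_pairD[OF QS.canonical_unitary_adjoint[OF cc_mem] fh] by simp
    then show "ell2_inner \<Lambda> (q f) h = ell2_inner \<Lambda> f (q h)"
      unfolding qf[OF fh(1)] qf[OF fh(2)] ell2_inner_scale_left ell2_inner_scale_right
        ell2_inner_add_left[OF fh(1) uX fh(2)] ell2_inner_add_right[OF fh(2) uX fh(1)] by simp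
  qed
  moreover have "q \<circ> T = T \<circ> q" if T: "T \<in> A_crossed_SL2Q" for T
  proof -
    have TE: "T \<in> even_ops" using T A_crossed_even_ops by blast
    note Tb = E.P_bounded[OF TE]
    show ?thesis
    proof (rule bounded_ops_eqI[OF bounded_ops_comp[OF qb Tb] bounded_ops_comp[OF Tb qb]])
      fix x assume x: "x \<in> \<Lambda>"
      have uX: "ucc f \<in> ell2 \<Lambda>" for f
        by (rule bounded_ops_ell2[OF QS.canonical_unitary_bounded[OF cc_mem]])
      have qf: "q f = (\<lambda>x. 1 / 2 * (f + ucc f) x)" if "f \<in> ell2 \<Lambda>" for f
        using that by (simp add: q_eq qpm_def id_op_def)
      have k: "ket x \<in> ell2 \<Lambda>" using x by simp
      have "q (T (ket x)) = T (q (ket x))"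
        unfolding qf[OF k] qf[OF bounded_ops_ell2[OF Tb]] bounded_opsD(3)[OF Tb ell2_add[OF k uX]]
          bounded_opsD(2)[OF Tb k uX] even_ops_commute[OF TE] ..
      then show "(q \<circ> T) (ket x) = (T \<circ> q) (ket x)" by simp
    qed
  qed
  ultimately show ?thesis
    using qpm_L_SL2Q[of 1] L_SL2Q_A_crossed unfolding central_projection_def q_eq by blast
qed

section \<open>Assembling the four possibilities\<close>

lemma intermediate_dichotomy:
  assumes P: "von_neumann_algebra \<Lambda> P" "L_SL2Q \<subseteq> P" "P \<subseteq> A_crossed_SL2Q" and \<eta>: "\<eta> = 1 \<or> \<eta> = - 1"
  shows "(\<forall>T\<in>P. qpm \<eta> \<circ> T \<in> L_SL2Q) \<or> (\<forall>T\<in>A_crossed_SL2Q. qpm \<eta> \<circ> T \<in> P)"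
proof -
  interpret intermediate_SL2Q P \<eta>
    by (rule intermediate_SL2Q_I[OF P(1,2) _ \<eta>]) (use P(3) A_crossed_even_ops in blast)
  have proj: "proj = qpm \<eta>" unfolding proj_def qpm_def ..
  have "T \<in> left_ops Q2_SL2Q" "ucc (T f) = T (ucc f)" if "T \<in> A_crossed_SL2Q" for T f
    using that A_crossed_even_ops even_ops_left_ops even_ops_commute[of T f] by blast+
  then show ?thesis using dichotomy unfolding proj by blast
qed

lemma qpm_decomp:
  assumes "T \<in> bounded_ops \<Lambda>"
  shows "(qpm \<eta> \<circ> T) + (qpm (- \<eta>) \<circ> T) = T"
  using bounded_ops_ell2[OF assms] by (auto simp: qpm_def id_op_def fun_eq_iff field_simps)

lemma qpm_idem:
  assumes "\<eta> = 1 \<or> \<eta> = - 1"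
  shows "qpm \<eta> \<circ> (qpm \<eta> \<circ> T) = qpm \<eta> \<circ> T"
proof -
  interpret E: intermediate_SL2Q even_ops \<eta>
    by (rule intermediate_SL2Q_I) (simp_all add: von_neumann_algebra_even_ops L_SL2Q_even_ops assms)
  have eq: "qpm \<eta> = E.proj" unfolding qpm_def E.proj_def ..
  have X: "E.proj f \<in> ell2 \<Lambda>" for f using E.P_ell2[OF E.proj_P] .
  have "E.proj (E.proj f) = E.proj f" for f
  proof (cases "f \<in> ell2 \<Lambda>")
    case True
    show ?thesis
    proof (rule ell2_eqI[OF X X])
      fix x assume x: "x \<in> \<Lambda>"
      show "E.proj (E.proj f) x = E.proj f x"
        unfolding E.proj_apply[OF X x] E.proj_c[OF True x] by simp
    qed
  next
    case False
    then show ?thesis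
      using bounded_opsD(4)[OF E.P_bounded[OF E.proj_P] False]
        bounded_ops_zero[OF E.P_bounded[OF E.proj_P]] by metis
  qed
  then show ?thesis by (auto simp: eq fun_eq_iff)
qed

text \<open>Here \<eta> marks the corner in which P is small; both mixed algebras are covered by
  letting it be 1 or -1.\<close>

lemma mixed_case:
  assumes P: "von_neumann_algebra \<Lambda> P" "L_SL2Q \<subseteq> P" "P \<subseteq> A_crossed_SL2Q" and \<eta>: "\<eta> = 1 \<or> \<eta> = - 1"
    and 0: "\<And>T. T \<in> P \<Longrightarrow> qpm \<eta> \<circ> T \<in> L_SL2Q"
    and 1: "\<And>T. T \<in> A_crossed_SL2Q \<Longrightarrow> qpm (- \<eta>) \<circ> T \<in> P"
  shows "P = corner (qpm \<eta>) L_SL2Q + corner (qpm (- \<eta>)) A_crossed_SL2Q"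
proof (intro equalityI subsetI)
  fix T assume T: "T \<in> P"
  \<comment> \<open>Idempotence makes \<open>qpm \<eta> \<circ> T\<close>, already known to be in
    L(G), its own witness for membership in the corner.\<close>
  have "qpm \<eta> \<circ> T = qpm \<eta> \<circ> (qpm \<eta> \<circ> T)" by (rule qpm_idem[OF \<eta>, symmetric])
  then have "qpm \<eta> \<circ> T \<in> corner (qpm \<eta>) L_SL2Q" using 0[OF T] unfolding corner_def by blast
  moreover have "qpm (- \<eta>) \<circ> T \<in> corner (qpm (- \<eta>)) A_crossed_SL2Q"
    using T P(3) unfolding corner_def by blast
  moreover have "T = (qpm \<eta> \<circ> T) + (qpm (- \<eta>) \<circ> T)"
    using qpm_decomp[OF subsetD[OF von_neumann_algebraD(1)[OF P(1)] T]] by simp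
  ultimately show "T \<in> corner (qpm \<eta>) L_SL2Q + corner (qpm (- \<eta>)) A_crossed_SL2Q"
    unfolding set_plus_def by blast
next
  fix T assume "T \<in> corner (qpm \<eta>) L_SL2Q + corner (qpm (- \<eta>)) A_crossed_SL2Q"
  then obtain R S where RS: "R \<in> L_SL2Q" "S \<in> A_crossed_SL2Q" "T = (qpm \<eta> \<circ> R) + (qpm (- \<eta>) \<circ> S)"
    unfolding corner_def set_plus_def by blast
  have "qpm \<eta> \<circ> R \<in> P"
    using von_neumann_algebra_closed(1)[OF P(1)] qpm_L_SL2Q P(2) RS(1) by blast
  then show "T \<in> P"
    unfolding RS(3) using von_neumann_algebra_closed(2)[OF P(1)] 1[OF RS(2)] by blast
qed

theorem theorem3p1:
  shows "central_projection \<Lambda> A_crossed_SL2Q q \<and>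
    (\<forall>P. von_neumann_algebra \<Lambda> P \<and> L_SL2Q \<subseteq> P \<and> P \<subseteq> A_crossed_SL2Q \<longrightarrow>
       P \<in> {L_SL2Q,
            A_crossed_SL2Q,
            corner q L_SL2Q + corner (id_op \<Lambda> - q) A_crossed_SL2Q,
            corner (id_op \<Lambda> - q) L_SL2Q + corner q A_crossed_SL2Q})"
proof (intro conjI allI impI)
  show "central_projection \<Lambda> A_crossed_SL2Q q" by (rule q_central_projection)
  fix P assume "von_neumann_algebra \<Lambda> P \<and> L_SL2Q \<subseteq> P \<and> P \<subseteq> A_crossed_SL2Q"
  then have P: "von_neumann_algebra \<Lambda> P" "L_SL2Q \<subseteq> P" "P \<subseteq> A_crossed_SL2Q" by auto
  have decomp: "T = (qpm 1 \<circ> T) + (qpm (- 1) \<circ> T)" if "T \<in> A_crossed_SL2Q" for T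
  proof -
    have "T \<in> bounded_ops \<Lambda>"
      using that A_crossed_even_ops von_neumann_algebraD(1)[OF von_neumann_algebra_even_ops] by blast
    then show ?thesis using qpm_decomp[of T 1] by simp
  qed
  \<comment> \<open>The digits refer to \<eta> = 1 and \<eta> = -1 in this order, with 0 for the
    small and 1 for the large alternative.\<close>
  consider (00) "\<forall>T\<in>P. qpm 1 \<circ> T \<in> L_SL2Q" "\<forall>T\<in>P. qpm (- 1) \<circ> T \<in> L_SL2Q"
    | (01) "\<forall>T\<in>P. qpm 1 \<circ> T \<in> L_SL2Q" "\<forall>T\<in>A_crossed_SL2Q. qpm (- 1) \<circ> T \<in> P"
    | (10) "\<forall>T\<in>A_crossed_SL2Q. qpm 1 \<circ> T \<in> P" "\<forall>T\<in>P. qpm (- 1) \<circ> T \<in> L_SL2Q"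
    | (11) "\<forall>T\<in>A_crossed_SL2Q. qpm 1 \<circ> T \<in> P" "\<forall>T\<in>A_crossed_SL2Q. qpm (- 1) \<circ> T \<in> P"
    using intermediate_dichotomy[OF P, of 1] intermediate_dichotomy[OF P, of "- 1"] by blast
  then show "P \<in> {L_SL2Q, A_crossed_SL2Q,
            corner q L_SL2Q + corner (id_op \<Lambda> - q) A_crossed_SL2Q,
            corner (id_op \<Lambda> - q) L_SL2Q + corner q A_crossed_SL2Q}"
  proof cases
    case 00
    have "T \<in> L_SL2Q" if T: "T \<in> P" for T
    proof -
      have "(qpm 1 \<circ> T) + (qpm (- 1) \<circ> T) \<in> L_SL2Q"
        using 00 T unfolding L_SL2Q_eq by (intro generated_vna_closed(2)) auto
      then show ?thesis using decomp[of T] T P(3) by auto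
    qed
    then show ?thesis using P(2) by blast
  next
    case 01
    then show ?thesis using mixed_case[OF P, of 1] unfolding id_op_minus_q unfolding q_eq by blast
  next
    case 10
    then have "P = corner (qpm (- 1)) L_SL2Q + corner (qpm 1) A_crossed_SL2Q"
      using mixed_case[OF P, of "- 1"] by simp
    then show ?thesis unfolding id_op_minus_q unfolding q_eq by blast
  next
    case 11
    have "T \<in> P" if T: "T \<in> A_crossed_SL2Q" for T
    proof -
      have "(qpm 1 \<circ> T) + (qpm (- 1) \<circ> T) \<in> P"
        using 11 T by (intro von_neumann_algebra_closed(2)[OF P(1)]) auto
      then show ?thesis using decomp[OF T] by simp
    qed
    then show ?thesis using P(3) by blast
  qed
qed

end
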